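(* Let $n \ge 3$, let $G$ be a dihedral group of order $2n$, and let $S$ be a sequence over $G$. (1) Suppose $n \ge 4$ is even. Then the following are equivalent: (a) $|S| = \mathsf s(G) - 1$ and $S$ has no product-one subsequence of length $\exp(G) = n$; (b) there exist $\alpha, \tau \in G$ with $G = \langle \alpha,\tau \mid \alpha^n=\tau^2=1_G,\ \tau\alpha=\alpha^{-1}\tau\rangle$ and $S = (\alpha^{r_1})^{[n-1]} \boldsymbol{\cdot} (\alpha^{r_2})^{[n-1]} \boldsymbol{\cdot} \alpha^{r_3}\tau$ for some $r_1,r_2,r_3 \in [0,n-1]$ with $\gcd(r_1-r_2,n)=1$. (2) The following are equivalent: (a) $|S| = \mathsf E(G) - 1$ and $S$ has no product-one subsequence of length $|G|$; (b) there exist $\alpha,\tau \in G$ with $G = \langle \alpha,\tau \mid \alpha^n=\tau^2=1_G,\ \tau\alpha=\alpha^{-1}\tau\rangle$ such that either (i) $n \ge 4$ and $S = (\alpha^{r_1})^{[2n-1]} \boldsymbol{\cdot} (\alpha^{r_2})^{[n-1]} \boldsymbol{\cdot} \alpha^{r_3}\tau$ with $r_1,r_2,r_3 \in [0,n-1]$ and $\gcd(r_1-r_2,n)=1$; or (ii) $n=3$ and either $S = 1_G^{[5]} \boldsymbol{\cdot} \tau \boldsymbol{\cdot} \alpha\tau \boldsymbol{\cdot} \alpha^2\tau$, or $S = (\alpha^{t_1})^{[5]} \boldsymbol{\cdot} (\alpha^{t_2})^{[2]} \boldsymbol{\cdot} \alpha^{t_3}\tau$ with $t_1,t_2,t_3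 \in [0,2]$ and $\gcd(t_1-t_2,3)=1$.
   Context: A sequence over a finite group $G$ is a finite unordered list of elements of $G$ with repetitions allowed; $|S|$ is its length, a subsequence is a sub-multiset, $S_1 \boldsymbol{\cdot} S_2$ denotes concatenation and $g^{[k]}$ denotes the sequence consisting of $g$ repeated $k$ times. A sequence is product-one if its terms can be ordered so that their product equals $1_G$. $\exp(G) = \operatorname{lcm}\{\operatorname{ord}(g) \mid g\in G\}$. $\mathsf s(G)$ (resp. $\mathsf E(G)$) is the smallest integer $\ell$ such that every sequence over $G$ of length at least $\ell$ has a product-one subsequence of length $\exp(G)$ (resp. $|G|$). For integers $a\le b$, $[a,b]=\{x\in\mathbb Z \mid a\le x\le b\}$. A dihedral group of order $2n$ is a group with presentation $\langle \alpha,\tau \mid \alpha^n=\tau^2=1,\ \tau\alpha=\alpha^{-1}\tau\rangle$. *)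

theory Defs
  imports "HOL-Algebra.Algebra" "HOL-Library.Multiset"
begin

section \<open>Sequences over a group\<close>

definition product_one :: "('a, 'b) monoid_scheme \<Rightarrow> 'a multiset \<Rightarrow> bool" where
  "product_one G S \<longleftrightarrow>
     (\<exists>xs. mset xs = S \<and> foldr (\<otimes>\<^bsub>G\<^esub>) xs \<one>\<^bsub>G\<^esub> = \<one>\<^bsub>G\<^esub>)"

definition has_product_one_subsequence ::
    "('a, 'b) monoid_scheme \<Rightarrow> nat \<Rightarrow> 'a multiset \<Rightarrow> bool" where
  "has_product_one_subsequence G k S \<longleftrightarrow>
     (\<exists>T. T \<subseteq># S \<and> size T = k \<and> product_one G T)"

definition group_exponent :: "('a, 'b) monoid_scheme \<Rightarrow> nat" where
  "group_exponent G = Lcm (group.ord G ` carrier G)"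

text \<open>Restricting the two minima below to natural numbers loses nothing: for a finite group the
  prescribed lengths are positive, so the empty sequence rules out every bound \<open>l \<le> 0\<close>.\<close>

definition s_constant :: "('a, 'b) monoid_scheme \<Rightarrow> nat" where
  "s_constant G = (LEAST l. \<forall>S. set_mset S \<subseteq> carrier G \<and> size S \<ge> l
     \<longrightarrow> has_product_one_subsequence G (group_exponent G) S)"

definition E_constant :: "('a, 'b) monoid_scheme \<Rightarrow> nat" where
  "E_constant G = (LEAST l. \<forall>S. set_mset S \<subseteq> carrier G \<and> size S \<ge> l
     \<longrightarrow> has_product_one_subsequence G (order G) S)"

section \<open>Group presentations\<close>

text \<open>A letter \<open>(x, True)\<close> stands for the generator \<open>x\<close> and \<open>(x, False)\<close> for its formal inverse.\<close>

type_synonym 'x word = "('x \<times> bool) list"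

definition word_value :: "('a, 'b) monoid_scheme \<Rightarrow> ('x \<Rightarrow> 'a) \<Rightarrow> 'x word \<Rightarrow> 'a" where
  "word_value G f w =
     foldr (\<otimes>\<^bsub>G\<^esub>) (map (\<lambda>(x, b). if b then f x else inv\<^bsub>G\<^esub> f x) w) \<one>\<^bsub>G\<^esub>"

text \<open>Two words are related iff they represent the same element of the quotient of the free group
  on \<open>'x\<close> by the normal closure of all \<open>u v\<^sup>-\<^sup>1\<close> with \<open>(u, v) \<in> R\<close>.\<close>

inductive word_equiv :: "('x word \<times> 'x word) set \<Rightarrow> 'x word \<Rightarrow> 'x word \<Rightarrow> bool"
  for R :: "('x word \<times> 'x word) set" where
  relation: "(u, v) \<in> R \<Longrightarrow> word_equiv R u v"
| cancel: "word_equiv R [(x, b), (x, \<not> b)] []"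
| append: "word_equiv R u u' \<Longrightarrow> word_equiv R v v' \<Longrightarrow> word_equiv R (u @ v) (u' @ v')"
| refl: "word_equiv R u u"
| sym: "word_equiv R u v \<Longrightarrow> word_equiv R v u"
| trans: "word_equiv R u v \<Longrightarrow> word_equiv R v w \<Longrightarrow> word_equiv R u w"

text \<open>\<open>x \<mapsto> f x\<close> induces an isomorphism from the group presented by \<open>\<langle>'x | R\<rangle>\<close> onto \<open>G\<close>: surjectivity
  is generation, well-definedness and injectivity are the two directions of the equivalence.\<close>

definition has_presentation ::
    "('a, 'b) monoid_scheme \<Rightarrow> ('x \<Rightarrow> 'a) \<Rightarrow> ('x word \<times> 'x word) set \<Rightarrow> bool" where
  "has_presentation G f R \<longleftrightarrow>
     group G \<and> range f \<subseteq> carrier G \<and> generate G (range f) = carrier G \<and>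
     (\<forall>u v. word_equiv R u v \<longleftrightarrow> word_value G f u = word_value G f v)"

section \<open>Dihedral groups\<close>

datatype dihedral_gen = Alpha | Tau

definition dihedral_relations :: "nat \<Rightarrow> (dihedral_gen word \<times> dihedral_gen word) set" where
  "dihedral_relations n =
     {(replicate n (Alpha, True), []),
      (replicate 2 (Tau, True), []),
      ([(Tau, True), (Alpha, True)], [(Alpha, False), (Tau, True)])}"

definition dihedral_presentation ::
    "('a, 'b) monoid_scheme \<Rightarrow> nat \<Rightarrow> 'a \<Rightarrow> 'a \<Rightarrow> bool" where
  "dihedral_presentation G n \<alpha> \<tau> \<longleftrightarrow>
     has_presentation G (case_dihedral_gen \<alpha> \<tau>) (dihedral_relations n)"

text \<open>The parameter \<open>n\<close> is half the order of the group.\<close>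

definition dihedral_group :: "('a, 'b) monoid_scheme \<Rightarrow> nat \<Rightarrow> bool" where
  "dihedral_group G n \<longleftrightarrow>
     (\<exists>\<alpha>\<in>carrier G. \<exists>\<tau>\<in>carrier G. dihedral_presentation G n \<alpha> \<tau>)"

end

theory Submission
  imports Defs "HOL-Number_Theory.Cong"
begin

hide_const (open) Divisibility.prime

text \<open>
  Write the elements of \<open>G\<close> as \<open>\<alpha>\<^sup>x\<close> and \<open>\<alpha>\<^sup>y \<tau>\<close>. With at most one reflection, everything reduces to
  the Erdos--Ginzburg--Ziv theorem for the cyclic group of order \<open>n\<close> and its inverse: \<open>2n - 2\<close>
  elements without a zero-sum of length \<open>n\<close> take two values, each \<open>n - 1\<close> times, whose difference
  generates the group.

  With two or more reflections one looks for a product-one subsequence. A product that contains a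
  reflection can be reordered so that its rotations enter with arbitrary signs and its reflections
  pairwise as \<open>\<plusminus>(y - y')\<close>. For \<open>n = 2m\<close> pair up the terms by type and parity; halving the products of the
  pairs gives a sequence of at least \<open>2m - 2\<close> elements modulo \<open>m\<close>, and the theorem and its inverse
  for \<open>m\<close> apply, the freedom of signs and of the pairing ruling out the extremal case. The double length
  \<open>|G|\<close> is reached by two product-one subsequences of length \<open>n\<close>.

  For odd \<open>n\<close> pair up the terms by type and choose \<open>n\<close> of the at least \<open>(3n - 3)/2\<close> pairs. The choice
  of signs realises all subset sums of the doubled pair values, which cover all residues unless most
  pair values lie in a proper subgroup. There the Erdos--Ginzburg--Ziv theorem for the subgroup
  applies, except for the trivial subgroup; many zero pairs then leave only the sequence
  \<open>1\<^sup>[\<^sup>5\<^sup>]\<cdot>\<tau>\<cdot>\<alpha>\<tau>\<cdot>\<alpha>\<^sup>2\<tau>\<close> for \<open>n = 3\<close>.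
\<close>

section \<open>Multisets\<close>

text \<open>For even n = 2m the lengths leave no slack: up to three of the 4m-1 terms stay unpaired,
  so only 2m-2 pairs are guaranteed, one short of the bound for m. The extremal case is unavoidable,
  and the inverse theorem is used through its rigidity: no single value can be changed without
  losing the extremal shape, so exchanging a term of a pair with an unpaired one, or reversing a
  pair of reflections, cannot alter the value of the pair. For odd n nothing is halved, but 2 is
  invertible modulo n, so a change of sign, which shifts the exponent by twice a pair value, is as
  good as a free choice of a subset. Signs are available only if a reflection takes part, so every
  signed selection has to keep a reflection pair. The values of s(G) and E(G) are not presupposed:
  the results for lengths 2n-1 and 3n-1 yield the upper bounds 2n and 3n, the extremal sequences the
  lower ones. Exponents are integers and n enters only through divisibility, so they can be divided
  by 2 or by a divisor of n when passing to a smaller modulus.\<close>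

definition zero_sum :: "nat \<Rightarrow> nat \<Rightarrow> int multiset \<Rightarrow> bool" where
  "zero_sum n k M \<longleftrightarrow> (\<exists>T. T \<subseteq># M \<and> size T = k \<and> int n dvd \<Sum>\<^sub># T)"

lemma subset_image_msetE:
  assumes "T \<subseteq># image_mset f B"
  obtains B' where "B' \<subseteq># B" "T = image_mset f B'"
proof -
  obtain U where "image_mset f B = T + U" using assms by (auto simp: subset_mset.le_iff_add)
  then show ?thesis using that by (metis image_mset_eq_plusD mset_subset_eq_add_left)
qed

lemma subset_plusE:
  assumes "T \<subseteq># A + B"
  obtains T1 T2 where "T1 \<subseteq># A" "T2 \<subseteq># B" "T = T1 + T2"
proof
  show "T \<inter># A \<subseteq># A" by simp
  show "T - A \<subseteq># B" using assms by (simp add: subset_eq_diff_conv add.commute)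
  show "T = T \<inter># A + (T - A)" by (auto simp: multiset_eq_iff min_def)
qed

lemma ex_subset_size_between:
  assumes "Y \<subseteq># M" "size Y \<le> k" "k \<le> size M"
  obtains Z where "Y \<subseteq># Z" "Z \<subseteq># M" "size Z = k"
proof -
  obtain U where U: "M = Y + U" using assms(1) by (auto simp: subset_mset.le_iff_add)
  obtain xs where xs: "mset xs = U" using ex_mset by blast
  define V where "V = mset (take (k - size Y) xs)"
  have "V \<subseteq># U" unfolding V_def xs[symmetric] by (metis append_take_drop_id mset_append mset_subset_eq_add_left)
  moreover have "length xs = size U" using xs by auto
  then have "size V = k - size Y" using assms U unfolding V_def by auto
  ultimately show ?thesis using that[of "Y + V"] U assms by simp
qed

lemma ex_subset_size:
  assumes "k \<le> size M"
  obtains Z where "Z \<subseteq># M" "size Z = k"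
  using ex_subset_size_between[of "{#}" M k] assms by auto

lemma sum_mset_diff:
  fixes f :: "'a \<Rightarrow> int"
  assumes "A \<subseteq># B"
  shows "(\<Sum>x\<in>#B - A. f x) = (\<Sum>x\<in>#B. f x) - (\<Sum>x\<in>#A. f x)"
  using assms by (auto simp: subset_mset.le_iff_add)

lemma filter_mset_none: "(\<And>x. x \<in># R \<Longrightarrow> \<not> P x) \<Longrightarrow> filter_mset P R = {#}"
  by (induction R) auto

lemma dvd_sum_mset:
  fixes f :: "'a \<Rightarrow> int"
  shows "(\<And>x. x \<in># A \<Longrightarrow> d dvd f x) \<Longrightarrow> d dvd (\<Sum>x\<in>#A. f x)"
  by (induction A) auto

section \<open>Subset sums modulo \<open>n\<close>\<close>

text \<open>A union of residue classes modulo \<open>n\<close>, kept as a set of integers so that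
  invariance under a translation can be stated without quotients; \<open>card_sums\<close> counts
  the classes.\<close>

definition subsums :: "nat \<Rightarrow> int multiset \<Rightarrow> int set" where
  "subsums n Y = {t. \<exists>J. J \<subseteq># Y \<and> [\<Sum>\<^sub># J = t] (mod int n)}"

lemma subsums_cong: "t \<in> subsums n Y \<Longrightarrow> [t = s] (mod int n) \<Longrightarrow> s \<in> subsums n Y"
  unfolding subsums_def using cong_trans by blast

lemma subsums_mono: "Y \<subseteq># Z \<Longrightarrow> subsums n Y \<subseteq> subsums n Z"
  unfolding subsums_def using subset_mset.order_trans by blast

lemma subsums_add:
  assumes "t \<in> subsums n Y" shows "t + x \<in> subsums n (add_mset x Y)"
proof -
  obtain J where "J \<subseteq># Y" "[\<Sum>\<^sub># J = t] (mod int n)" using assms by (auto simp: subsums_def)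
  then have "add_mset x J \<subseteq># add_mset x Y" "[\<Sum>\<^sub># (add_mset x J) = t + x] (mod int n)"
    using cong_add[of "\<Sum>\<^sub># J" t "int n" x x] by (simp_all add: add.commute)
  then show ?thesis unfolding subsums_def by blast
qed

definition card_sums :: "nat \<Rightarrow> int multiset \<Rightarrow> nat" where
  "card_sums n Y = card (subsums n Y \<inter> {0..<int n})"

lemma card_sums_le: "card_sums n Y \<le> n"
proof -
  have "card_sums n Y \<le> card {0..<int n}" unfolding card_sums_def by (rule card_mono) auto
  then show ?thesis by simp
qed

lemma subsums_full:
  assumes "n > 0" "card_sums n Y \<ge> n" shows "t \<in> subsums n Y"
proof -
  have "subsums n Y \<inter> {0..<int n} = {0..<int n}"
  proof (rule card_seteq)
    show "card {0..<int n} \<le> card (subsums n Y \<inter> {0..<int n})"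
      using assms(2) unfolding card_sums_def by simp
  qed simp_all
  moreover have "t mod int n \<in> {0..<int n}" using assms(1) by simp
  ultimately have "t mod int n \<in> subsums n Y" by blast
  then show ?thesis using subsums_cong by (metis cong_mod_left cong_refl)
qed

text \<open>Subset sums only grow with the multiset, so a count that does not increase forces both
  sets to agree, and \<open>subsums_add\<close> puts the translate into the larger one.\<close>

lemma subsums_closed_add:
  assumes "n > 0" "card_sums n (add_mset x Y) \<le> card_sums n Y" "t \<in> subsums n Y"
  shows "t + x \<in> subsums n Y"
proof -
  have "subsums n Y \<inter> {0..<int n} = subsums n (add_mset x Y) \<inter> {0..<int n}"
  proof (rule card_seteq)
    show "subsums n Y \<inter> {0..<int n} \<subseteq> subsums n (add_mset x Y) \<inter> {0..<int n}"
      using subsums_mono[of Y "add_mset x Y"] by (auto simp: subset_mset.le_iff_add)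
    show "card (subsums n (add_mset x Y) \<inter> {0..<int n}) \<le> card (subsums n Y \<inter> {0..<int n})"
      using assms(2) unfolding card_sums_def by simp
  qed simp
  moreover have "(t + x) mod int n \<in> subsums n (add_mset x Y) \<inter> {0..<int n}"
    using subsums_cong[OF subsums_add[OF assms(3)]] assms(1) by (auto simp: cong_def)
  ultimately have "(t + x) mod int n \<in> subsums n Y" by blast
  then show ?thesis using subsums_cong by (metis cong_mod_left cong_refl)
qed

text \<open>\<open>H\<close> is a subgroup of the integers, so Bezout applies; the finite set is
  absorbed one element at a time.\<close>

lemma Gcd_closed:
  fixes H :: "int set"
  assumes "finite A" "A \<subseteq> H" "n \<in> H" and add: "\<And>a b. a \<in> H \<Longrightarrow> b \<in> H \<Longrightarrow> a + b \<in> H"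
    and neg: "\<And>a. a \<in> H \<Longrightarrow> - a \<in> H"
  shows "Gcd (insert n A) \<in> H"
proof -
  have z: "0 \<in> H" using add[OF assms(3) neg[OF assms(3)]] by simp
  have nat_mult: "int k * a \<in> H" if "a \<in> H" for k a
    by (induction k) (use z add that in \<open>auto simp: algebra_simps\<close>)
  have mult: "u * a \<in> H" if "a \<in> H" for u a
  proof (cases "u \<ge> 0")
    case True then show ?thesis using nat_mult[OF that, of "nat u"] by simp
  next
    case False then show ?thesis using neg[OF nat_mult[OF that, of "nat (-u)"]] by simp
  qed
  have gcd: "gcd a b \<in> H" if "a \<in> H" "b \<in> H" for a b
    using bezout_int[of a b] mult that add by metis
  have "gcd n (Gcd A) \<in> H" using assms(1,2)
  proof (induction A rule: finite_induct)
    case empty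
    then show ?case using gcd[OF assms(3) assms(3)] by simp
  next
    case (insert x F)
    then have "gcd x (gcd n (Gcd F)) \<in> H" using gcd by simp
    then show ?case by (simp add: gcd.left_commute)
  qed
  then show ?thesis by simp
qed

text \<open>Take a largest \<open>Y\<close> that has more subset sums than elements. Its subset sums are invariant under
  \<open>g = gcd(n, M - Y)\<close>, and by induction they meet every class modulo \<open>g\<close> unless \<open>g = n\<close>, when
  \<open>Y\<close> contains all nonzero elements.\<close>

lemma subset_sums_cover:
  assumes "n > 0" "\<And>d. d dvd n \<Longrightarrow> d > 1 \<Longrightarrow> d - 1 \<le> size {#x\<in>#M. \<not> int d dvd x#}"
  obtains Y where "Y \<subseteq># M" "size Y \<le> n - 1" "\<And>t. t \<in> subsums n Y"
proof -
  have "\<exists>Y. Y \<subseteq># M \<and> size Y \<le> n - 1 \<and> (\<forall>t. t \<in> subsums n Y)"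
    using assms
  proof (induction n rule: less_induct)
    case (less n)
    \<comment> \<open>Strictness is available because the empty multiset already has the sum 0. As
      there are at most \<open>n\<close> classes, it also bounds the size of \<open>Y\<close> by
      \<open>n - 1\<close>.\<close>
    define good where "good Y \<longleftrightarrow> Y \<subseteq># M \<and> size Y < card_sums n Y" for Y
    have "0 \<in> subsums n {#} \<inter> {0..<int n}" using less.prems(1) by (auto simp: subsums_def)
    then have "card_sums n {#} > 0" unfolding card_sums_def by (auto simp: card_gt_0_iff)
    then have g0: "good {#}" by (simp add: good_def)
    have bound: "size Y \<le> n" if "good Y" for Y
      using card_sums_le[of n Y] that unfolding good_def by linarith
    obtain Y where Y: "good Y" and max: "\<And>Z. good Z \<Longrightarrow> size Z \<le> size Y"
      using ex_has_greatest_nat[of good "{#}" size "Suc n"] g0 bound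
      by (auto simp: less_Suc_eq_le)
    have YM: "Y \<subseteq># M" using Y good_def by blast
    have closed: "t + x \<in> subsums n Y" if x: "x \<in># M - Y" and t: "t \<in> subsums n Y" for x t
    proof (rule subsums_closed_add[OF less.prems(1) _ t])
      have "add_mset x Y \<subseteq># M" using x YM
        by (auto simp: subset_mset.le_iff_add dest!: multi_member_split)
      then show "card_sums n (add_mset x Y) \<le> card_sums n Y"
        using max[of "add_mset x Y"] Y unfolding good_def by force
    qed
    have szY: "size Y \<le> n - 1" using card_sums_le[of n Y] Y unfolding good_def by linarith
    define H where "H = {h. \<forall>t\<in>subsums n Y. t + h \<in> subsums n Y}"
    define g where "g = Gcd (insert (int n) (set_mset (M - Y)))"
    have Hcong: "h' \<in> H" if "h \<in> H" "[h = h'] (mod int n)" for h h'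
      using that unfolding H_def by (blast intro: subsums_cong cong_add cong_refl)
    have "0 \<in> H" by (simp add: H_def)
    then have Hn: "int n \<in> H" by (rule Hcong) (simp add: cong_def)
    have Hadd: "a + b \<in> H" if "a \<in> H" "b \<in> H" for a b
    proof -
      have "t + (a + b) \<in> subsums n Y" if "t \<in> subsums n Y" for t
        using \<open>a \<in> H\<close> \<open>b \<in> H\<close> that unfolding H_def by (simp flip: add.assoc)
      then show ?thesis by (simp add: H_def)
    qed
    have Hmul: "int k * a \<in> H" if "a \<in> H" for k a
    proof (induction k)
      case 0 show ?case using \<open>0 \<in> H\<close> by simp
    next
      case (Suc k) then show ?case using Hadd[OF that Suc] by (simp add: algebra_simps)
    qed
    have Hneg: "- a \<in> H" if "a \<in> H" for a
    proof -
      \<comment> \<open>\<open>H\<close> is invariant modulo \<open>n\<close>, so negation can be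
        replaced by the multiple \<open>n - 1\<close>.\<close>
      have "int (n - 1) * a = - a + a * int n" using less.prems(1)
        by (simp add: of_nat_diff algebra_simps)
      then have "[int (n - 1) * a = - a] (mod int n)" by (simp only: cong_def mod_mult_self1)
      then show ?thesis using Hmul[OF that, of "n - 1"] Hcong by blast
    qed
    have gH: "g \<in> H" unfolding g_def
      by (rule Gcd_closed) (use Hn Hadd Hneg closed in \<open>auto simp: H_def\<close>)
    have gn: "g dvd int n" unfolding g_def by (simp add: Gcd_dvd)
    have "g \<ge> 0" unfolding g_def by (rule Gcd_int_greater_eq_0)
    moreover have "g \<noteq> 0" using gn less.prems(1) by auto
    ultimately have gpos: "g > 0" by simp
    have gM: "g dvd x" if "x \<in># M - Y" for x unfolding g_def using that by (simp add: Gcd_dvd del: Gcd_insert)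
    define d where "d = nat g"
    have dg: "int d = g" using gpos by (simp add: d_def)
    have dn: "d dvd n" using gn dg by (metis int_dvd_int_iff)
    have all: "t \<in> subsums n Y" for t
    proof (cases "d < n")
      case True
      obtain Z where Z: "Z \<subseteq># M" "t \<in> subsums d Z"
        using less.IH[OF True] less.prems dn gpos dg by (metis dvd_trans of_nat_0_less_iff)
      then obtain J where J: "J \<subseteq># Z" "[\<Sum>\<^sub># J = t] (mod g)" using dg by (auto simp: subsums_def)
      \<comment> \<open>The terms of \<open>J\<close> outside \<open>Y\<close> are multiples of
        \<open>g\<close>. Dropping them changes the sum by a multiple of \<open>g\<close>, which the
        invariance of the subset sums of \<open>Y\<close> makes up for.\<close>
      define J' where "J' = J \<inter># Y"
      have J'Y: "J' \<subseteq># Y" unfolding J'_def by simp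
      have "J - Y \<subseteq># M - Y"
        using subset_mset.order_trans[OF J(1) Z(1)] by (auto simp: subseteq_mset_def intro: diff_le_mono)
      then have "g dvd x" if "x \<in># J - Y" for x using gM that by (meson mset_subset_eqD)
      then have "g dvd \<Sum>\<^sub># (J - Y)" using dvd_sum_mset[of "J - Y" g "\<lambda>x. x"] by simp
      moreover have "J = J' + (J - Y)" unfolding J'_def by (auto simp: multiset_eq_iff min_def)
      then have "\<Sum>\<^sub># J = \<Sum>\<^sub># J' + \<Sum>\<^sub># (J - Y)" by (metis sum_mset.union)
      moreover from this have "t - \<Sum>\<^sub># J' = \<Sum>\<^sub># (J - Y) - (\<Sum>\<^sub># J - t)" by simp
      moreover have "g dvd \<Sum>\<^sub># J - t" using J(2) by (simp add: cong_iff_dvd_diff)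
      ultimately have "g dvd t - \<Sum>\<^sub># J'" by (metis dvd_diff)
      then obtain k where "t - \<Sum>\<^sub># J' = g * k" by (metis dvdE)
      then have k: "t = \<Sum>\<^sub># J' + k * g" by (simp add: algebra_simps)
      have "k * g \<in> H"
      proof (cases "k \<ge> 0")
        case True then show ?thesis using Hmul[OF gH, of "nat k"] by simp
      next
        case False then show ?thesis using Hneg[OF Hmul[OF gH, of "nat (-k)"]] by simp
      qed
      moreover have "\<Sum>\<^sub># J' \<in> subsums n Y" using J'Y by (auto simp: subsums_def)
      ultimately show ?thesis using k by (auto simp: H_def)
    next
      case False
      then have "d = n" using dn less.prems(1) by (meson dvd_imp_le linorder_neqE_nat not_le)
      then have nM: "int n dvd x" if "x \<in># M - Y" for x using gM dg that by simp
      have "n - 1 \<le> size Y"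
      proof (cases "n > 1")
        case True
        have "{#x\<in>#M. \<not> int n dvd x#} = {#x\<in>#Y. \<not> int n dvd x#} + {#x\<in>#M - Y. \<not> int n dvd x#}"
          using YM by (metis filter_union_mset subset_mset.add_diff_inverse)
        also have "{#x\<in>#M - Y. \<not> int n dvd x#} = {#}" using nM by (intro filter_mset_none) blast
        finally have "size {#x\<in>#M. \<not> int n dvd x#} \<le> size Y" by (simp add: size_mset_mono)
        then show ?thesis using less.prems(2)[OF _ True] by force
      qed simp
      then have "card_sums n Y \<ge> n" using Y unfolding good_def by linarith
      then show ?thesis using subsums_full less.prems(1) by blast
    qed
    show ?case using YM szY all by blast
  qed
  then show ?thesis using that by blast
qed

section \<open>The Erdos--Ginzburg--Ziv theorem\<close>

lemma cong_sum_mset: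
  fixes f g :: "'a \<Rightarrow> int"
  assumes "\<And>x. x \<in># A \<Longrightarrow> [f x = g x] (mod n)"
  shows "[(\<Sum>x\<in>#A. f x) = (\<Sum>x\<in>#A. g x)] (mod n)"
  using assms by (induction A) (auto intro!: cong_add)

abbreviation residues :: "nat \<Rightarrow> int multiset \<Rightarrow> int multiset" where
  "residues n \<equiv> image_mset (\<lambda>x. x mod int n)"

lemma cong_sum_mset_mod: "[\<Sum>\<^sub># (residues n T) = \<Sum>\<^sub># T] (mod int n)"
  using cong_sum_mset[of T "\<lambda>x. x mod int n" "\<lambda>x. x" "int n"] by simp

lemma zero_sum_mod: "zero_sum n k (residues n M) \<longleftrightarrow> zero_sum n k M"
proof
  assume "zero_sum n k (residues n M)"
  then obtain T where T: "T \<subseteq># residues n M" "size T = k" "int n dvd \<Sum>\<^sub># T"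
    by (auto simp: zero_sum_def)
  obtain T' where "T' \<subseteq># M" "T = residues n T'"
    using subset_image_msetE[OF T(1)] .
  then show "zero_sum n k M" using T cong_dvd_iff[OF cong_sum_mset_mod[of n T']]
    unfolding zero_sum_def by (intro exI[of _ T']) simp
next
  assume "zero_sum n k M"
  then obtain T where T: "T \<subseteq># M" "size T = k" "int n dvd \<Sum>\<^sub># T" by (auto simp: zero_sum_def)
  then show "zero_sum n k (residues n M)" using cong_dvd_iff[OF cong_sum_mset_mod[of n T]]
    unfolding zero_sum_def by (intro exI[of _ "residues n T"]) (simp add: image_mset_subseteq_mono)
qed

lemma zero_sum_mono: "zero_sum n k M \<Longrightarrow> M \<subseteq># M' \<Longrightarrow> zero_sum n k M'"
  unfolding zero_sum_def using subset_mset.order_trans by blast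

lemma zero_sum_count: "count M c \<ge> n \<Longrightarrow> zero_sum n n M"
  unfolding zero_sum_def by (intro exI[of _ "replicate_mset n c"]) (simp add: count_le_replicate_mset_subset_eq)

text \<open>Sort and pair position \<open>i\<close> with position \<open>k + i\<close>. Equal
  entries there would make all \<open>k + 1\<close> entries in between equal, more than the bound on
  multiplicities allows.\<close>

lemma distinct_pairing:
  fixes M :: "'a::linorder multiset"
  assumes "size M = 2 * k" "\<And>x. count M x \<le> k"
  obtains P where "size P = k" "M = image_mset fst P + image_mset snd P"
    "\<And>p. p \<in># P \<Longrightarrow> fst p \<noteq> snd p"
proof -
  define xs where "xs = sorted_list_of_multiset M"
  have xs: "mset xs = M" "sorted xs" "length xs = 2 * k"
    using assms(1) by (auto simp: xs_def simp flip: size_mset)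
  define ps where "ps = zip (take k xs) (drop k xs)"
  have 1: "size (mset ps) = k" using xs by (simp add: ps_def)
  have "map fst ps = take k xs" "map snd ps = drop k xs" using xs by (simp_all add: ps_def)
  then have 2: "M = image_mset fst (mset ps) + image_mset snd (mset ps)"
    using xs(1) by (metis append_take_drop_id mset_append mset_map)
  have 3: "fst p \<noteq> snd p" if "p \<in># mset ps" for p
  proof
    assume eq: "fst p = snd p"
    note pin = that
    obtain i where i: "i < k" "p = (xs ! i, xs ! (k + i))"
      using pin xs(3) by (force simp: ps_def set_zip)
    have "{i..k + i} \<subseteq> {j. j < length xs \<and> xs ! i = xs ! j}"
    proof
      fix j assume j: "j \<in> {i..k + i}"
      then have "xs ! i \<le> xs ! j" "xs ! j \<le> xs ! (k + i)" "j < length xs"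
        using sorted_nth_mono[OF xs(2)] i(1) xs(3) by auto
      then show "j \<in> {j. j < length xs \<and> xs ! i = xs ! j}" using eq i(2) by auto
    qed
    then have "card {i..k + i} \<le> card {j. j < length xs \<and> xs ! i = xs ! j}"
      by (intro card_mono) auto
    also have "\<dots> = count M (xs ! i)"
      unfolding xs(1)[symmetric] count_mset count_list_eq_length_filter length_filter_conv_card ..
    finally show False using assms(2)[of "xs ! i"] by simp
  qed
  show ?thesis using that[of "mset ps"] 1 2 3 by blast
qed

text \<open>One entry is taken from each pair: starting with the first entries, every difference in
  \<open>J\<close> switches its pair to the second entry.\<close>

lemma pair_choice:
  fixes P :: "(int \<times> int) multiset"
  assumes "J \<subseteq># image_mset (\<lambda>p. snd p - fst p) P"
  obtains T where "T \<subseteq># image_mset fst P + image_mset snd P" "size T = size P"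
    "\<Sum>\<^sub># T = (\<Sum>p\<in>#P. fst p) + \<Sum>\<^sub># J"
proof -
  obtain P' where P': "P' \<subseteq># P" "J = image_mset (\<lambda>p. snd p - fst p) P'"
    using subset_image_msetE[OF assms] .
  obtain Q where Q: "P = P' + Q" using P' by (auto simp: subset_mset.le_iff_add)
  have sum_diff: "(\<Sum>p\<in>#A. snd p - fst p) = (\<Sum>p\<in>#A. snd p) - (\<Sum>p\<in>#A. fst p)" for A :: "(int \<times> int) multiset"
    by (induction A) auto
  show ?thesis
    by (rule that[of "image_mset fst Q + image_mset snd P'"])
      (auto simp: Q P'(2) sum_diff subset_mset.add_mono algebra_simps)
qed

lemma subsums_coverE:
  assumes "t \<in> subsums n Y" "Y \<subseteq># M"
  obtains J where "J \<subseteq># M" "[\<Sum>\<^sub># J = t] (mod int n)"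
  using assms subset_mset.order_trans unfolding subsums_def by blast

text \<open>Unless a residue occurs \<open>p\<close> times, set one term \<open>c\<close> aside and
  pair the others with distinct residues. The subset sums of the p-1 nonzero differences are all
  residues, so one entry per pair can be chosen such that the total cancels
  \<open>c\<close>.\<close>

lemma egz_prime:
  assumes "prime p" "size M \<ge> 2 * p - 1"
  shows "zero_sum p p M"
proof -
  define M' where "M' = residues p M"
  have p1: "p > 1" using assms(1) prime_gt_1_nat by blast
  have "zero_sum p p M'"
  proof (cases "\<exists>c. count M' c \<ge> p")
    case True then show ?thesis using zero_sum_count by blast
  next
    case False
    have "2 * p - 1 \<le> size M'" using assms(2) by (simp add: M'_def)
    then obtain N where N: "N \<subseteq># M'" "size N = 2 * p - 1" using ex_subset_size by blast
    then obtain c N2 where N2: "N = add_mset c N2" using p1 by (metis diff_is_0_eq multiset_cases not_less mult_2 size_empty trans_less_add1)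
    have "size N2 = 2 * (p - 1)" using N N2 by simp
    moreover have "count N2 x \<le> p - 1" for x
    proof -
      have "count N2 x \<le> count M' x" using N N2 by (meson mset_subset_eq_add_mset_cancel mset_subset_eq_count mset_subset_eq_insertD subset_mset.less_imp_le subset_mset.order_trans)
      then show ?thesis using False by (metis Suc_pred' le_trans not_less_eq_eq p1 zero_less_one order.strict_trans)
    qed
    ultimately obtain P where P: "size P = p - 1" "N2 = image_mset fst P + image_mset snd P"
      "\<And>q. q \<in># P \<Longrightarrow> fst q \<noteq> snd q" using distinct_pairing by metis
    have res: "0 \<le> x \<and> x < int p" if "x \<in># N2" for x
    proof -
      have "x \<in># M'" using that N N2 by (meson mset_subset_eqD mset_subset_eq_insertD subset_mset.less_imp_le)
      then show ?thesis using p1 by (auto simp: M'_def)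
    qed
    have nd: "\<not> int p dvd snd q - fst q" if "q \<in># P" for q
    proof
      assume "int p dvd snd q - fst q"
      then have "snd q mod int p = fst q mod int p" by (simp add: mod_eq_dvd_iff)
      moreover have "fst q \<in># N2" "snd q \<in># N2" using that P(2) by auto
      ultimately show False using res P(3)[OF that] by fastforce
    qed
    define D where "D = image_mset (\<lambda>q. snd q - fst q) P"
    have "{#x\<in>#D. \<not> int p dvd x#} = D" using nd by (auto simp: D_def filter_mset_eq_conv)
    then have szD: "size {#x\<in>#D. \<not> int p dvd x#} = p - 1" using P(1) by (simp add: D_def)
    obtain Y where Y: "Y \<subseteq># D" "\<And>t. t \<in> subsums p Y"
    proof (rule subset_sums_cover[of p D])
      fix d assume "d dvd p" "d > 1"
      then have "d = p" using assms(1) prime_nat_iff by (metis less_irrefl)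
      then show "d - 1 \<le> size {#x\<in>#D. \<not> int d dvd x#}" using szD by simp
    qed (use p1 in auto)
    obtain J where J: "J \<subseteq># D" "[\<Sum>\<^sub># J = - (c + (\<Sum>q\<in>#P. fst q))] (mod int p)"
      using subsums_coverE[OF Y(2) Y(1)] .
    obtain T where T: "T \<subseteq># N2" "size T = p - 1" "\<Sum>\<^sub># T = (\<Sum>q\<in>#P. fst q) + \<Sum>\<^sub># J"
      using pair_choice[OF J(1)[unfolded D_def]] P by metis
    have "add_mset c T \<subseteq># M'" using T(1) N N2 by (metis mset_subset_eq_add_mset_cancel subset_mset.order_trans)
    moreover have "size (add_mset c T) = p" using T p1 by simp
    moreover have "int p dvd \<Sum>\<^sub># (add_mset c T)"
      using J(2) T(3) by (simp add: cong_iff_dvd_diff algebra_simps)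
    ultimately show ?thesis unfolding zero_sum_def by blast
  qed
  then show ?thesis by (simp add: M'_def zero_sum_mod)
qed

section \<open>Composite moduli: blocks of length p with sum divisible by p\<close>

definition blocks :: "nat \<Rightarrow> int multiset multiset \<Rightarrow> bool" where
  "blocks p Bs \<longleftrightarrow> (\<forall>B\<in>#Bs. size B = p \<and> int p dvd \<Sum>\<^sub># B)"

text \<open>Zero-sums are split off one at a time; before the last one, 2p-1 terms are still
  there.\<close>

lemma extract_blocks:
  assumes egz: "\<And>M. size M \<ge> 2 * p - 1 \<Longrightarrow> zero_sum p p M" and "p > 0" "size M \<ge> p * k + p - 1"
  obtains Bs where "size Bs = k" "\<Sum>\<^sub># Bs \<subseteq># M" "blocks p Bs"
proof -
  have "\<exists>Bs. size Bs = k \<and> \<Sum>\<^sub># Bs \<subseteq># M \<and> blocks p Bs"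
    using assms(3)
  proof (induction k arbitrary: M)
    case 0
    show ?case by (rule exI[of _ "{#}"]) (simp add: blocks_def)
  next
    case (Suc k)
    then have "zero_sum p p M" by (intro egz) (auto simp: algebra_simps)
    then obtain T where T: "T \<subseteq># M" "size T = p" "int p dvd \<Sum>\<^sub># T" by (auto simp: zero_sum_def)
    then have "size (M - T) \<ge> p * k + p - 1" using Suc.prems by (simp add: size_Diff_submset)
    then obtain Bs where "size Bs = k" "\<Sum>\<^sub># Bs \<subseteq># M - T" "blocks p Bs" using Suc.IH by blast
    then show ?case using T
      by (intro exI[of _ "add_mset T Bs"]) (auto simp: blocks_def subset_mset.le_diff_conv2 union_commute)
  qed
  then show ?thesis using that by blast
qed

lemma size_Union_blocks: "blocks p Bs \<Longrightarrow> size (\<Sum>\<^sub># Bs) = p * size Bs"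
  by (induction Bs) (auto simp: blocks_def)

lemma blocks_sum: "blocks p Bs \<Longrightarrow> \<Sum>\<^sub># (\<Sum>\<^sub># Bs) = int p * (\<Sum>B\<in>#Bs. \<Sum>\<^sub># B div int p)"
  by (induction Bs) (auto simp: blocks_def algebra_simps)

lemma blocks_mono: "blocks p Bs \<Longrightarrow> Bs' \<subseteq># Bs \<Longrightarrow> blocks p Bs'"
  unfolding blocks_def by (meson mset_subset_eqD)

text \<open>The block sums divided by \<open>p\<close> are a sequence for the modulus
  \<open>m\<close>. A zero-sum of \<open>m\<close> of them is a union of blocks with pm terms and a
  sum divisible by pm.\<close>

lemma combine_blocks:
  assumes "blocks p Bs" "zero_sum m m (image_mset (\<lambda>B. \<Sum>\<^sub># B div int p) Bs)"
  shows "zero_sum (p * m) (p * m) (\<Sum>\<^sub># Bs)"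
proof -
  obtain T where T: "T \<subseteq># image_mset (\<lambda>B. \<Sum>\<^sub># B div int p) Bs" "size T = m" "int m dvd \<Sum>\<^sub># T"
    using assms(2) by (auto simp: zero_sum_def)
  obtain Bs' where Bs': "Bs' \<subseteq># Bs" "T = image_mset (\<lambda>B. \<Sum>\<^sub># B div int p) Bs'"
    using subset_image_msetE[OF T(1)] .
  have b: "blocks p Bs'" using blocks_mono assms(1) Bs' by blast
  have "\<Sum>\<^sub># Bs' \<subseteq># \<Sum>\<^sub># Bs" using Bs'(1) by (auto simp: subset_mset.le_iff_add)
  moreover have "size (\<Sum>\<^sub># Bs') = p * m" using size_Union_blocks[OF b] T Bs' by simp
  moreover have "int (p * m) dvd \<Sum>\<^sub># (\<Sum>\<^sub># Bs')" using blocks_sum[OF b] T(3) Bs' by simp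
  ultimately show ?thesis unfolding zero_sum_def by blast
qed

theorem egz:
  assumes "n > 0" "size M \<ge> 2 * n - 1"
  shows "zero_sum n n M"
  using assms
proof (induction n arbitrary: M rule: prime_divisors_induct[case_names zero unit factor])
  case zero
  then show ?case by simp
next
  case (unit u)
  then have "size M \<ge> 1" and "u = 1" by auto
  then obtain x where "x \<in># M" by fastforce
  then show ?case using \<open>u = 1\<close> by (auto simp: zero_sum_def intro!: exI[of _ "{#x#}"])
next
  case (factor p m)
  have p: "p > 0" "m > 0" using factor.hyps factor.prems by (auto simp: prime_gt_0_nat)
  \<comment> \<open>Since p(2m-1) + p - 1 = 2pm - 1, the bounds for \<open>p\<close> and
    \<open>m\<close> compose without loss.\<close>
  have "size M \<ge> p * (2 * m - 1) + p - 1" using factor.prems p by (simp add: algebra_simps diff_mult_distrib2)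
  then obtain Bs where Bs: "size Bs = 2 * m - 1" "\<Sum>\<^sub># Bs \<subseteq># M" "blocks p Bs"
    using extract_blocks[of p "2 * m - 1" M] egz_prime[OF factor.hyps] p by metis
  have "zero_sum m m (image_mset (\<lambda>B. \<Sum>\<^sub># B div int p) Bs)" using factor.IH p Bs by simp
  then show ?case using combine_blocks[OF Bs(3)] zero_sum_mono Bs(2) by blast
qed

section \<open>Sequences extremal for the Erdos--Ginzburg--Ziv theorem\<close>

text \<open>Coprimality means that a-b generates the cyclic group of order \<open>n\<close>. The
  multiplicities are parameters because both shapes (n-1, n-1) and (2n-1, n-1) occur.\<close>

definition two_valued :: "nat \<Rightarrow> nat \<Rightarrow> nat \<Rightarrow> int \<Rightarrow> int \<Rightarrow> int multiset \<Rightarrow> bool" where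
  "two_valued n i j a b M \<longleftrightarrow> coprime (a - b) (int n) \<and>
     residues n M = replicate_mset i (a mod int n) + replicate_mset j (b mod int n)"

text \<open>The inverse theorem as a property of one modulus, so that it can be proved
  multiplicatively.\<close>

definition egz_inverse :: "nat \<Rightarrow> bool" where
  "egz_inverse n \<longleftrightarrow> (\<forall>M. size M = 2 * n - 2 \<longrightarrow> \<not> zero_sum n n M \<longrightarrow> (\<exists>a b. two_valued n (n - 1) (n - 1) a b M))"

section \<open>The inverse theorem for prime moduli\<close>

lemma card_sums_mono: "Y \<subseteq># Z \<Longrightarrow> card_sums n Y \<le> card_sums n Z"
  unfolding card_sums_def using subsums_mono[of Y Z n] by (intro card_mono) auto

text \<open>If \<open>x\<close> brings no new sum, the set is invariant under adding
  \<open>x\<close>. It then contains all multiples of \<open>x\<close>, starting from the empty sum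
  0, and these meet every residue class.\<close>

lemma card_sums_grow:
  assumes "n > 0" "coprime x (int n)"
  shows "min n (card_sums n Y + 1) \<le> card_sums n (add_mset x Y)"
proof (rule ccontr)
  assume "\<not> ?thesis"
  then have le: "card_sums n (add_mset x Y) \<le> card_sums n Y" and lt: "card_sums n (add_mset x Y) < n" by auto
  have cl: "t + x \<in> subsums n Y" if "t \<in> subsums n Y" for t
    using subsums_closed_add[OF assms(1) le that] .
  have kx: "int k * x \<in> subsums n Y" for k
  proof (induction k)
    case 0 show ?case by (auto simp: subsums_def intro: exI[of _ "{#}"])
  next
    case (Suc k) then show ?case using cl[OF Suc] by (simp add: algebra_simps)
  qed
  have "t \<in> subsums n Y" for t
  proof -
    obtain u where u: "[x * u = 1] (mod int n)" using assms(2) by (meson cong_solve_coprime_int)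
    define k where "k = nat ((u * t) mod int n)"
    have "int k = (u * t) mod int n" using assms(1) by (simp add: k_def)
    then have "[int k * x = (u * t) * x] (mod int n)" by (simp add: cong_scalar_right)
    also have "(u * t) * x = (x * u) * t" by simp
    also have "[(x * u) * t = 1 * t] (mod int n)" using u by (rule cong_scalar_right)
    finally show ?thesis using subsums_cong[OF kx] by simp
  qed
  then have "subsums n Y \<inter> {0..<int n} = {0..<int n}" by auto
  then have "card_sums n Y = n" unfolding card_sums_def by simp
  then have "card_sums n (add_mset x Y) \<ge> n" using card_sums_mono[of Y "add_mset x Y" n] by (simp add: subset_mset.le_iff_add)
  then show False using lt by simp
qed

lemma card_sums_grow_mset:
  assumes "n > 0" "\<And>x. x \<in># V \<Longrightarrow> coprime x (int n)"
  shows "min n (card_sums n Y + size V) \<le> card_sums n (V + Y)"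
  using assms(2)
proof (induction V)
  case (add x V)
  then show ?case using card_sums_grow[OF assms(1), of x "V + Y"] by fastforce
qed simp

text \<open>Since ia + jb = i(a-b) + (i+j)b and n divides i+j, divisibility of the sum reduces to
  that of i(a-b), where a-b is invertible.\<close>

lemma two_valued_zero_sum:
  assumes "coprime (a - b) (int n)" "T = replicate_mset i (a mod int n) + replicate_mset j (b mod int n)"
    "n dvd i + j" "int n dvd \<Sum>\<^sub># T"
  shows "n dvd i"
proof -
  have "\<Sum>\<^sub># T = int i * (a mod int n) + int j * (b mod int n)" using assms(2) by (simp add: sum_mset_replicate_mset)
  moreover have "[int i * (a mod int n) + int j * (b mod int n) = int i * a + int j * b] (mod int n)"
    by (intro cong_add cong_mult) auto
  ultimately have "int n dvd int i * a + int j * b" using assms(4) cong_dvd_iff by metis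
  also have "int i * a + int j * b = int i * (a - b) + int (i + j) * b"
    by (simp add: algebra_simps)
  moreover have "int n dvd int (i + j) * b" using assms(3) by (simp only: int_dvd_int_iff dvd_mult2)
  ultimately have "int n dvd int i * (a - b)" by (metis dvd_add_left_iff)
  then show ?thesis using assms(1) by (simp add: coprime_dvd_mult_left_iff coprime_commute)
qed

lemma swap_pairs:
  "image_mset fst (image_mset (\<lambda>q. if c q then q else (snd q, fst q)) P)
     + image_mset snd (image_mset (\<lambda>q. if c q then q else (snd q, fst q)) P)
   = image_mset fst P + image_mset snd (P :: ('a \<times> 'a) multiset)"
  by (induction P) auto

text \<open>Two differences that differ by more than a sign have four subset sums, one more than needed to
  reach all residues without using the choice in one of the pairs; both entries of that pair then
  complete a zero-sum of length \<open>p\<close>.\<close>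

lemma equal_differences:
  assumes p: "prime p"
    and P: "size P = p - 1" "\<And>q. q \<in># P \<Longrightarrow> \<not> int p dvd snd q - fst q"
    and nz: "\<not> zero_sum p p (image_mset fst P + image_mset snd P)"
    and q: "q \<in># P" "r \<in># P"
  shows "int p dvd (snd q - fst q) - (snd r - fst r) \<or> int p dvd (snd q - fst q) + (snd r - fst r)"
proof -
  define f where "f q = snd q - fst q" for q :: "int \<times> int"
  have p0: "p > 0" using p prime_gt_0_nat by blast
  have cop: "coprime (f q) (int p)" if "q \<in># P" for q
    using P(2)[OF that] p by (simp add: f_def coprime_commute prime_imp_coprime)
  have "int p dvd f q - f r \<or> int p dvd f q + f r"
  proof (rule ccontr)
    assume contr: "\<not> ?thesis"
    then have "q \<noteq> r" by auto
    \<comment> \<open>For p = 2 there is only one pair, and for p = 3 any two nonzero residues agree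
      up to sign.\<close>
    have p3: "p > 3"
    proof (rule ccontr)
      assume "\<not> p > 3"
      moreover have "p \<noteq> 2"
      proof
        assume "p = 2"
        then have "size P = 1" using P(1) by simp
        then obtain z where "P = {#z#}" using size_1_singleton_mset by blast
        then show False using q \<open>q \<noteq> r\<close> by simp
      qed
      ultimately have "p = 3" using prime_ge_2_nat[OF p] by linarith
      moreover have "\<not> int p dvd f q" "\<not> int p dvd f r" using P(2) q by (auto simp: f_def)
      ultimately show False using contr by presburger
    qed
    obtain R1 where R1: "P = add_mset q R1" using q by (meson multi_member_split)
    then have "r \<in># R1" using q \<open>q \<noteq> r\<close> by auto
    then obtain R where "R1 = add_mset r R" by (meson multi_member_split)
    then have R: "P = {#q, r#} + R" using R1 by simp
    have "p \<noteq> 4" using p by auto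
    then have "size R = p - 3" "p > 4" using R P(1) p3 by auto
    then obtain s R' where R': "R = add_mset s R'" "size R' = p - 4" by (cases R) auto
    define D where "D = image_mset f ({#q, r#} + R')"
    have four: "card_sums p {#f q, f r#} \<ge> 4"
    proof -
      have sub: "(\<lambda>t. t mod int p) ` {0, f q, f r, f q + f r} \<subseteq> subsums p {#f q, f r#} \<inter> {0..<int p}"
      proof -
        have *: "t mod int p \<in> subsums p {#f q, f r#} \<inter> {0..<int p}" if "J \<subseteq># {#f q, f r#}" "t = \<Sum>\<^sub># J" for J t
          using that p0 by (auto simp: subsums_def intro!: exI[of _ J])
        show ?thesis using *[of "{#}" 0] *[of "{#f q#}"] *[of "{#f r#}"] *[of "{#f q, f r#}"] by auto
      qed
      have ne: "\<not> int p dvd f q" "\<not> int p dvd f r" "\<not> int p dvd f r + f q"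
        using P(2) q contr by (auto simp: f_def add.commute)
      have "inj_on (\<lambda>t. t mod int p) {0, f q, f r, f q + f r}"
        using contr ne by (auto simp: inj_on_def mod_eq_dvd_iff dvd_diff_commute dvd_diff_commute[of _ 0])
      moreover have "card {0, f q, f r, f q + f r} = 4"
        using contr ne by (auto simp: card_insert_if)
      ultimately have "card ((\<lambda>t. t mod int p) ` {0, f q, f r, f q + f r}) = 4" by (simp only: card_image)
      then show ?thesis using card_mono[OF _ sub] unfolding card_sums_def by simp
    qed
    have "min p (card_sums p {#f q, f r#} + size (image_mset f R')) \<le> card_sums p (image_mset f R' + {#f q, f r#})"
      by (rule card_sums_grow_mset) (use p0 cop R R' in auto)
    then have "card_sums p D \<ge> p" using four R' p3 by (simp add: D_def add_mset_commute)
    then have full: "t \<in> subsums p D" for t using subsums_full p0 by blast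
    define P' where "P' = {#q, r#} + R'"
    obtain J where J: "J \<subseteq># D" "[\<Sum>\<^sub># J = - (fst s + snd s + (\<Sum>q\<in>#P'. fst q))] (mod int p)"
      using full unfolding subsums_def by blast
    obtain T where T: "T \<subseteq># image_mset fst P' + image_mset snd P'" "size T = size P'"
      "\<Sum>\<^sub># T = (\<Sum>q\<in>#P'. fst q) + \<Sum>\<^sub># J"
      using pair_choice[OF J(1)[unfolded D_def f_def, folded P'_def]] .
    have "T + {#fst s, snd s#} \<subseteq># image_mset fst P + image_mset snd P"
      using T(1) unfolding R R' P'_def by (simp add: add_mset_commute)
    moreover have "size (T + {#fst s, snd s#}) = p" using T(2) R' p3 by (simp add: P'_def)
    moreover have "int p dvd \<Sum>\<^sub># (T + {#fst s, snd s#})"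
      using J(2) T(3) by (simp add: cong_iff_dvd_diff algebra_simps)
    ultimately show False using nz unfolding zero_sum_def by blast
  qed
  then show ?thesis by (simp add: f_def)
qed

text \<open>Orient all pairs to have the same difference \<open>d\<close>. Taking both entries of a pair \<open>s\<close> and one
  entry of each other pair shows that \<open>U + fst s + k d\<close> is nonzero for \<open>0 < k < p\<close>, whence
  \<open>fst s = - U\<close> for every \<open>s\<close>.\<close>

lemma egz_inverse_prime:
  assumes p: "prime p"
  shows "egz_inverse p"
  unfolding egz_inverse_def
proof (intro allI impI)
  fix M assume M: "size M = 2 * p - 2" "\<not> zero_sum p p M"
  define M' where "M' = residues p M"
  have p1: "p > 1" using p prime_gt_1_nat by blast
  have nz: "\<not> zero_sum p p M'" using M(2) by (simp add: M'_def zero_sum_mod)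
  then have "count M' x \<le> p - 1" for x using zero_sum_count[of p M' x] p1 by (metis Suc_pred' not_less_eq_eq zero_less_one order.strict_trans)
  moreover have "size M' = 2 * (p - 1)" using M(1) by (simp add: M'_def)
  ultimately obtain P where P: "size P = p - 1" "M' = image_mset fst P + image_mset snd P"
    "\<And>q. q \<in># P \<Longrightarrow> fst q \<noteq> snd q" using distinct_pairing by metis
  have res: "0 \<le> x \<and> x < int p" if "x \<in># M'" for x
    using that p1 by (auto simp: M'_def)
  have nd: "\<not> int p dvd snd q - fst q" if "q \<in># P" for q
  proof
    assume "int p dvd snd q - fst q"
    then have "snd q mod int p = fst q mod int p" by (simp add: mod_eq_dvd_iff)
    moreover have "fst q \<in># M'" "snd q \<in># M'" using that P(2) by auto
    ultimately show False using res P(3)[OF that] by fastforce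
  qed
  have "P \<noteq> {#}" using P(1) p1 by auto
  then obtain r where r: "r \<in># P" by blast
  define d where "d = snd r - fst r"
  define orient where "orient q = (if int p dvd (snd q - fst q) - d then q else (snd q, fst q))" for q
  define Q where "Q = image_mset orient P"
  have QM: "image_mset fst Q + image_mset snd Q = M'" unfolding Q_def orient_def P(2) by (rule swap_pairs)
  have szQ: "size Q = p - 1" using P(1) by (simp add: Q_def)
  have dQ: "[snd q - fst q = d] (mod int p)" if "q \<in># Q" for q
  proof -
    obtain q' where q': "q' \<in># P" "q = orient q'" using \<open>q \<in># Q\<close> unfolding Q_def by auto
    have "int p dvd (snd q' - fst q') - d \<or> int p dvd (snd q' - fst q') + d"
      using equal_differences[OF p P(1) nd _ q'(1) r] nz P(2) unfolding d_def by simp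
    then show ?thesis unfolding cong_iff_dvd_diff q'(2) orient_def
      by (auto simp: dvd_diff_commute algebra_simps)
  qed
  have cop: "coprime d (int p)" using nd[OF r] p by (simp add: d_def coprime_commute prime_imp_coprime)
  define U where "U = (\<Sum>q\<in>#Q. fst q)"
  have fstQ: "[fst s = - U] (mod int p)" if s: "s \<in># Q" for s
  proof -
    obtain Q' where Q': "Q = add_mset s Q'" using s by (meson multi_member_split)
    have no: "\<not> int p dvd U + fst s + int (Suc k) * d" if k: "k \<le> p - 2" for k
    proof
      assume dvd: "int p dvd U + fst s + int (Suc k) * d"
      obtain Q1 where Q1: "Q1 \<subseteq># Q'" "size Q1 = k"
      proof (rule ex_subset_size)
        show "k \<le> size Q'" using k szQ Q' p1 by simp
      qed
      define J where "J = image_mset (\<lambda>q. snd q - fst q) Q1"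
      have "J \<subseteq># image_mset (\<lambda>q. snd q - fst q) Q'" unfolding J_def using Q1(1) by (rule image_mset_subseteq_mono)
      then obtain T where T: "T \<subseteq># image_mset fst Q' + image_mset snd Q'" "size T = size Q'"
        "\<Sum>\<^sub># T = (\<Sum>q\<in>#Q'. fst q) + \<Sum>\<^sub># J" using pair_choice by metis
      have "[\<Sum>\<^sub># J = (\<Sum>q\<in>#Q1. d)] (mod int p)" unfolding J_def
        by (rule cong_sum_mset) (use dQ Q' Q1(1) in \<open>auto dest: mset_subset_eqD\<close>)
      then have "[\<Sum>\<^sub># J = int k * d] (mod int p)" using Q1 by simp
      moreover have "[snd s = fst s + d] (mod int p)" using dQ[OF s] by (simp add: cong_iff_dvd_diff algebra_simps)
      ultimately have "[(\<Sum>q\<in>#Q'. fst q) + fst s + (snd s + \<Sum>\<^sub># J) = (\<Sum>q\<in>#Q'. fst q) + fst s + ((fst s + d) + int k * d)] (mod int p)"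
        by (intro cong_add) auto
      also have "(\<Sum>q\<in>#Q'. fst q) + fst s + ((fst s + d) + int k * d) = U + fst s + int (Suc k) * d"
        by (simp add: U_def Q' algebra_simps)
      finally have "int p dvd \<Sum>\<^sub># (T + {#fst s, snd s#})" using dvd T(3) by (simp add: cong_dvd_iff algebra_simps)
      moreover have "T + {#fst s, snd s#} \<subseteq># M'" using T(1) QM[symmetric] unfolding Q' by (simp add: add_mset_commute)
      moreover have "size (T + {#fst s, snd s#}) = p" using T(2) szQ Q' p1 by simp
      ultimately show False using nz unfolding zero_sum_def by blast
    qed
    show ?thesis
    proof (rule ccontr)
      assume ne: "\<not> ?thesis"
      \<comment> \<open>If U + \<open>fst s\<close> is nonzero modulo p, it is -td for some 0 < t <
        p, which \<open>no\<close> excludes with k = t-1.\<close>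
      obtain u where u: "[d * u = 1] (mod int p)" using cop by (meson cong_solve_coprime_int)
      define t where "t = (- (U + fst s) * u) mod int p"
      have "[t * d = (- (U + fst s) * u) * d] (mod int p)" by (simp add: t_def cong_scalar_right)
      also have "(- (U + fst s) * u) * d = - (U + fst s) * (d * u)" by simp
      also have "[- (U + fst s) * (d * u) = - (U + fst s) * 1] (mod int p)" using u by (rule cong_scalar_left)
      finally have td: "int p dvd U + fst s + t * d" by (simp add: cong_iff_dvd_diff algebra_simps)
      have "t \<noteq> 0" using td ne by (auto simp: cong_iff_dvd_diff algebra_simps)
      moreover have "0 \<le> t" "t < int p" using p1 by (auto simp: t_def)
      ultimately have "t = int (Suc (nat t - 1))" "nat t - 1 \<le> p - 2" by auto
      then show False using no[of "nat t - 1"] td by metis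
    qed
  qed
  have sndQ: "[snd s = d - U] (mod int p)" if s: "s \<in># Q" for s
    using cong_add[OF dQ[OF s] fstQ[OF s]] by simp
  have "residues p M' = residues p (image_mset fst Q) + residues p (image_mset snd Q)"
    unfolding QM[symmetric] by simp
  also have "residues p (image_mset fst Q) = image_mset (\<lambda>_. (- U) mod int p) Q"
    unfolding multiset.map_comp comp_def by (rule image_mset_cong) (use fstQ in \<open>simp add: cong_def\<close>)
  also have "residues p (image_mset snd Q) = image_mset (\<lambda>_. (d - U) mod int p) Q"
    unfolding multiset.map_comp comp_def by (rule image_mset_cong) (use sndQ in \<open>simp add: cong_def\<close>)
  finally have "residues p M' = replicate_mset (p - 1) ((d - U) mod int p) + replicate_mset (p - 1) ((- U) mod int p)"
    using szQ by (simp add: image_mset_const_eq)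
  then have "two_valued p (p - 1) (p - 1) (d - U) (- U) M"
    using cop by (simp add: two_valued_def M'_def multiset.map_comp comp_def)
  then show "\<exists>a b. two_valued p (p - 1) (p - 1) a b M" by blast
qed

section \<open>Sequences of length 3n-2 without two disjoint zero-sums of length n\<close>

lemma zero_sum2_mod:
  assumes "T1 + T2 \<subseteq># residues n M" "size T1 = n" "size T2 = n"
    "int n dvd \<Sum>\<^sub># T1" "int n dvd \<Sum>\<^sub># T2"
  shows "\<exists>T1 T2. T1 + T2 \<subseteq># M \<and> size T1 = n \<and> size T2 = n \<and> int n dvd \<Sum>\<^sub># T1 \<and> int n dvd \<Sum>\<^sub># T2"
proof -
  obtain T where T: "T \<subseteq># M" "T1 + T2 = residues n T"
    using subset_image_msetE[OF assms(1)] .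
  then obtain U1 U2 where "T = U1 + U2" "T1 = residues n U1" "T2 = residues n U2"
    by (metis image_mset_eq_plusD)
  then show ?thesis using assms T cong_dvd_iff[OF cong_sum_mset_mod[of n U1]] cong_dvd_iff[OF cong_sum_mset_mod[of n U2]]
    by (intro exI[of _ U1] exI[of _ U2]) auto
qed

lemma mset_two_elements:
  assumes "set_mset T \<subseteq> {x, y}" "x \<noteq> y"
  shows "T = replicate_mset (count T x) x + replicate_mset (count T y) y"
  using assms by (auto simp: multiset_eq_iff not_in_iff[symmetric] dest: set_mp)

lemma coprime_residues_distinct:
  assumes "coprime (a - b) (int n)" "n \<ge> 2"
  shows "a mod int n \<noteq> b mod int n"
proof
  assume "a mod int n = b mod int n"
  then have "int n dvd a - b" by (simp add: mod_eq_dvd_iff)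
  then have "int n dvd 1" using assms(1) by (meson coprime_common_divisor dvd_refl)
  then show False using assms(2) by simp
qed

text \<open>Removing any zero-sum of length n leaves an extremal sequence: two values, n-1 times
  each. If the removed \<open>T\<close> had a third value c, a second zero-sum \<open>T2\<close>
  could be built from c and copies of both values. Removing \<open>T2\<close> must leave the same
  two values n-1 times each, and as \<open>T2\<close> contains both, each occurs n times: two
  disjoint zero-sums. So \<open>T\<close> takes only the two values, and
  \<open>two_valued_zero_sum\<close> makes it constant.\<close>

lemma egz_inverse_long:
  assumes n: "n \<ge> 2" and inv: "egz_inverse n" and M: "size M = 3 * n - 2"
    and no: "\<nexists>T1 T2. T1 + T2 \<subseteq># M \<and> size T1 = n \<and> size T2 = n \<and> int n dvd \<Sum>\<^sub># T1 \<and> int n dvd \<Sum>\<^sub># T2"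
  shows "\<exists>a b. two_valued n (2 * n - 1) (n - 1) a b M"
proof -
  define M' where "M' = residues n M"
  have no': False if "T1 + T2 \<subseteq># M'" "size T1 = n" "size T2 = n" "int n dvd \<Sum>\<^sub># T1" "int n dvd \<Sum>\<^sub># T2" for T1 T2
    using zero_sum2_mod that no unfolding M'_def by blast
  have szM': "size M' = 3 * n - 2" using M by (simp add: M'_def)
  have res: "x mod int n = x" if "x \<in># M'" for x using that n by (auto simp: M'_def)
  have inv': "\<exists>a b. coprime (a - b) (int n) \<and> M' - T = replicate_mset (n - 1) (a mod int n) + replicate_mset (n - 1) (b mod int n)"
    if T: "T \<subseteq># M'" "size T = n" "int n dvd \<Sum>\<^sub># T" for T
  proof -
    have "\<not> zero_sum n n (M' - T)"
    proof
      assume "zero_sum n n (M' - T)"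
      then obtain T2 where "T2 \<subseteq># M' - T" "size T2 = n" "int n dvd \<Sum>\<^sub># T2" by (auto simp: zero_sum_def)
      then show False using no'[of T T2] T by (simp add: subset_mset.le_diff_conv2 union_commute)
    qed
    moreover have "size (M' - T) = 2 * n - 2" using T szM' by (simp add: size_Diff_submset)
    ultimately obtain a b where "two_valued n (n - 1) (n - 1) a b (M' - T)" using inv unfolding egz_inverse_def by blast
    moreover have "residues n (M' - T) = image_mset (\<lambda>x. x) (M' - T)"
      by (rule image_mset_cong) (use res in \<open>auto dest: in_diffD\<close>)
    ultimately show ?thesis unfolding two_valued_def by auto
  qed
  have "zero_sum n n M'" by (rule egz) (use n szM' in auto)
  then obtain T where T: "T \<subseteq># M'" "size T = n" "int n dvd \<Sum>\<^sub># T" by (auto simp: zero_sum_def)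
  obtain a b where ab: "coprime (a - b) (int n)"
    and R: "M' - T = replicate_mset (n - 1) (a mod int n) + replicate_mset (n - 1) (b mod int n)"
    using inv'[OF T] by blast
  define a' b' where "a' = a mod int n" and "b' = b mod int n"
  note R = R[folded a'_def b'_def]
  have ne: "a' \<noteq> b'" using coprime_residues_distinct[OF ab n] by (simp add: a'_def b'_def)
  have M'eq: "M' = T + (replicate_mset (n - 1) a' + replicate_mset (n - 1) b')"
    using T(1) R by (metis subset_mset.add_diff_inverse)
  have inT: "c = a' \<or> c = b'" if c: "c \<in># T" for c
  proof (rule ccontr)
    assume contr: "\<not> ?thesis"
    have cM: "c \<in># M'" using c T(1) by (meson mset_subset_eqD)
    have "coprime (b - a) (int n)" using ab by (metis coprime_minus_left_iff minus_diff_eq)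
    then obtain u where u: "[(b - a) * u = 1] (mod int n)" by (meson cong_solve_coprime_int)
    define s where "s = nat (((c - a) * u) mod int n)"
    have s: "int s = ((c - a) * u) mod int n" using n by (simp add: s_def)
    then have "[int s * (b - a) = ((c - a) * u) * (b - a)] (mod int n)" by (simp add: cong_scalar_right)
    also have "((c - a) * u) * (b - a) = (c - a) * ((b - a) * u)" by simp
    also have "[(c - a) * ((b - a) * u) = (c - a) * 1] (mod int n)" using u by (rule cong_scalar_left)
    finally have sc: "[a + int s * (b - a) = c] (mod int n)" by (simp add: cong_iff_dvd_diff algebra_simps)
    have "s \<noteq> 0" using sc contr res[OF cM] by (auto simp: cong_def a'_def)
    moreover have "s \<noteq> 1" using sc contr res[OF cM] by (auto simp: cong_def b'_def)
    moreover have "s < n" using s n by (metis of_nat_0_less_iff of_nat_less_iff pos2 pos_mod_bound order_less_le_trans)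
    ultimately have s2: "2 \<le> s" "s < n" by auto
    \<comment> \<open>Modulo n the sum of these terms is (a + s(b-a)) + (n-s)b + (s-1)a =
      nb.\<close>
    define T2 where "T2 = add_mset c (replicate_mset (n - s) b' + replicate_mset (s - 1) a')"
    have rest: "M' - T2 = (T - {#c#}) + (replicate_mset (n - s) a' + replicate_mset (s - 1) b')"
      and T2: "T2 \<subseteq># M'"
    proof -
      have "M' = T2 + ((T - {#c#}) + (replicate_mset (n - s) a' + replicate_mset (s - 1) b'))"
        using s2 ne c unfolding M'eq T2_def by (auto simp: multiset_eq_iff)
      then show "M' - T2 = (T - {#c#}) + (replicate_mset (n - s) a' + replicate_mset (s - 1) b')" "T2 \<subseteq># M'"
        by (metis add_diff_cancel_left', metis mset_subset_eq_add_left)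
    qed
    have "size T2 = n" using s2 by (simp add: T2_def)
    moreover have "int n dvd \<Sum>\<^sub># T2"
    proof -
      have "\<Sum>\<^sub># T2 = c + (int (n - s) * b' + int (s - 1) * a')"
        by (simp add: T2_def sum_mset_replicate_mset)
      also have "[c + (int (n - s) * b' + int (s - 1) * a') = (a + int s * (b - a)) + (int (n - s) * b + int (s - 1) * a)] (mod int n)"
        unfolding a'_def b'_def by (intro cong_add cong_mult cong_sym[OF sc]) auto
      also have "(a + int s * (b - a)) + (int (n - s) * b + int (s - 1) * a) = int n * b"
        using s2 by (simp add: of_nat_diff algebra_simps)
      finally show ?thesis by (simp add: cong_dvd_iff)
    qed
    ultimately obtain a2 b2 where ab2: "coprime (a2 - b2) (int n)"
      and R2: "M' - T2 = replicate_mset (n - 1) (a2 mod int n) + replicate_mset (n - 1) (b2 mod int n)"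
      using inv'[OF T2] by blast
    have "a' \<in># M' - T2" "b' \<in># M' - T2" using s2 unfolding rest by auto
    then have "{a', b'} \<subseteq> {a2 mod int n, b2 mod int n}" unfolding R2 by (auto split: if_splits)
    then have R3: "M' - T2 = replicate_mset (n - 1) a' + replicate_mset (n - 1) b'"
      using ne unfolding R2 by (auto simp: union_commute)
    have "M' = T2 + (M' - T2)" using T2 by simp
    then have "M' = T2 + (replicate_mset (n - 1) a' + replicate_mset (n - 1) b')" using R3 by simp
    then have "replicate_mset n a' + replicate_mset n b' \<subseteq># M'"
      using s2 ne contr by (auto simp: T2_def subseteq_mset_def)
    then show False using no'[of "replicate_mset n a'" "replicate_mset n b'"] by (simp add: sum_mset_replicate_mset)
  qed
  define i j where "i = count T a'" and "j = count T b'"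
  have Teq: "T = replicate_mset i a' + replicate_mset j b'"
    unfolding i_def j_def by (rule mset_two_elements) (use inT ne in auto)
  have ij: "i + j = n" using T(2) by (subst (asm) Teq) simp
  have "n dvd i"
    by (rule two_valued_zero_sum[OF ab Teq[unfolded a'_def b'_def] _ T(3)]) (use ij in simp)
  then have "i > 0 \<longrightarrow> n \<le> i" using dvd_imp_le by blast
  then have "i = 0 \<or> i = n" using ij by linarith
  then show ?thesis
  proof
    assume "i = n"
    then have "M' = replicate_mset (2 * n - 1) a' + replicate_mset (n - 1) b'"
      using ij n ne unfolding M'eq Teq by (auto simp: multiset_eq_iff)
    then have "two_valued n (2 * n - 1) (n - 1) a b M" using ab by (simp add: two_valued_def M'_def a'_def b'_def)
    then show ?thesis by blast
  next
    assume "i = 0"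
    then have "M' = replicate_mset (2 * n - 1) b' + replicate_mset (n - 1) a'"
      using ij n ne unfolding M'eq Teq by (auto simp: multiset_eq_iff)
    moreover have "coprime (b - a) (int n)" using ab by (metis coprime_minus_left_iff minus_diff_eq)
    ultimately have "two_valued n (2 * n - 1) (n - 1) b a M" by (simp add: two_valued_def M'_def a'_def b'_def)
    then show ?thesis by blast
  qed
qed

text \<open>All multiplicities are 0 or m-1. If the residues of \<open>u\<close> and
  \<open>w\<close> differ, that of \<open>u\<close> occurs m-1 times in one multiset and m-2 times
  in the other, which forces m = 2. There \<open>V\<close> has a single term and both
  \<open>u\<close> and \<open>w\<close> must have the other residue.\<close>

lemma two_valued_rigid:
  assumes m: "m \<ge> 2" and u: "two_valued m (m - 1) (m - 1) c d (add_mset u V)"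
    and w: "two_valued m (m - 1) (m - 1) c' d' (add_mset w V)"
  shows "[u = w] (mod int m)"
proof (rule ccontr)
  assume contr: "\<not> ?thesis"
  define u' w' V' where "u' = u mod int m" and "w' = w mod int m" and "V' = residues m V"
  have ne: "u' \<noteq> w'" using contr by (simp add: cong_def u'_def w'_def)
  have U: "add_mset u' V' = replicate_mset (m - 1) (c mod int m) + replicate_mset (m - 1) (d mod int m)"
    and W: "add_mset w' V' = replicate_mset (m - 1) (c' mod int m) + replicate_mset (m - 1) (d' mod int m)"
    using u w by (simp_all add: two_valued_def u'_def w'_def V'_def)
  have cd: "c mod int m \<noteq> d mod int m" "c' mod int m \<noteq> d' mod int m"
    using u w m coprime_residues_distinct unfolding two_valued_def by blast+
  have cU: "count (add_mset u' V') x \<in> {0, m - 1}" for x unfolding U using cd by auto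
  have cW: "count (add_mset w' V') x \<in> {0, m - 1}" for x unfolding W using cd by auto
  have "m - 1 = 1" using cU[of u'] cW[of u'] ne m by auto
  then have m2: "m = 2" by simp
  have "size V' = 1" using arg_cong[OF U, of size] m2 by simp
  then obtain v where v: "V' = {#v#}" using size_1_singleton_mset by blast
  have "u' \<noteq> v" "w' \<noteq> v" using cU[of v] cW[of v] m2 v by auto
  moreover have "v \<in> {0, 1}"
  proof -
    have "v \<in># V'" using v by simp
    then obtain y where "v = y mod 2" unfolding V'_def m2 by auto
    then show ?thesis by auto
  qed
  moreover have "u' \<in> {0, 1}" "w' \<in> {0, 1}" unfolding u'_def w'_def m2 by auto
  ultimately show False using ne by auto
qed

text \<open>Transfers the shape to prescribed representatives \<open>a\<close> and \<open>b\<close>.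
  Taking a = b shows that an extremal sequence cannot be constant modulo \<open>m\<close>.\<close>

lemma two_valued_cases:
  assumes V: "two_valued m (m - 1) (m - 1) c d V" and m: "m \<ge> 2"
    and ab: "\<And>x. x \<in># V \<Longrightarrow> [x = a] (mod int m) \<or> [x = b] (mod int m)"
  shows "coprime (a - b) (int m)" "\<exists>x\<in>#V. [x = a] (mod int m)" "\<exists>x\<in>#V. [x = b] (mod int m)"
proof -
  have cd: "c mod int m \<noteq> d mod int m" "coprime (c - d) (int m)"
    using V m coprime_residues_distinct unfolding two_valued_def by blast+
  have "c mod int m \<in># residues m V" "d mod int m \<in># residues m V"
    using V m unfolding two_valued_def by auto
  then obtain x y where x: "x \<in># V" "x mod int m = c mod int m" and y: "y \<in># V" "y mod int m = d mod int m" by auto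
  have dm: "(c - d) mod int m = (x - y) mod int m" using x y by (metis mod_diff_cong)
  have cop: "coprime (x - y) (int m)" using cd(2) dm by (metis coprime_mod_left_iff m not_numeral_le_zero of_nat_eq_0_iff)
  have "x mod int m \<noteq> y mod int m" using cd(1) x y by simp
  then consider "[x = a] (mod int m)" "[y = b] (mod int m)" | "[x = b] (mod int m)" "[y = a] (mod int m)"
    using ab[OF x(1)] ab[OF y(1)] by (auto simp: cong_def)
  then have "coprime (a - b) (int m) \<and> (\<exists>x\<in>#V. [x = a] (mod int m)) \<and> (\<exists>x\<in>#V. [x = b] (mod int m))"
  proof cases
    case 1
    then have "[x - y = a - b] (mod int m)" by (rule cong_diff)
    then have "coprime (a - b) (int m)" using cop cong_imp_coprime by blast
    then show ?thesis using 1 x y by blast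
  next
    case 2
    then have "[y - x = a - b] (mod int m)" using cong_diff by blast
    moreover have "coprime (y - x) (int m)" using cop by (metis coprime_minus_left_iff minus_diff_eq)
    ultimately have "coprime (a - b) (int m)" using cong_imp_coprime by blast
    then show ?thesis using 2 x y by blast
  qed
  then show "coprime (a - b) (int m)" "\<exists>x\<in>#V. [x = a] (mod int m)" "\<exists>x\<in>#V. [x = b] (mod int m)" by blast+
qed

text \<open>Split off 2m-2 blocks of length p; 2m-1 blocks would contradict \<open>egz\<close> for
  m. Hence the remaining 2p-2 terms \<open>R\<close> have no zero-sum and are two-valued modulo p.
  Moreover \<open>R\<close> with one block has no two disjoint zero-sums, so
  \<open>egz_inverse_long\<close> makes each block constant modulo p, with a value of
  \<open>R\<close>. Exchanging terms between blocks and \<open>R\<close> lifts these congruences to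
  pm, which leaves two values, each at most pm-1 times.\<close>

lemma egz_inverse_mult:
  assumes p: "p \<ge> 2" "egz_inverse p" and m: "m \<ge> 2" "egz_inverse m"
  shows "egz_inverse (p * m)"
  unfolding egz_inverse_def
proof (intro allI impI)
  fix M assume M: "size M = 2 * (p * m) - 2" "\<not> zero_sum (p * m) (p * m) M"
  define n where "n = p * m"
  define val where "val B = \<Sum>\<^sub># B div int p" for B
  have nozs: "\<not> zero_sum m m (image_mset val Bs)" if "blocks p Bs" "\<Sum>\<^sub># Bs \<subseteq># M" for Bs
    using combine_blocks[OF that(1), of m] that(2) M(2) zero_sum_mono unfolding val_def by blast
  have few: "size Bs < 2 * m - 1" if "blocks p Bs" "\<Sum>\<^sub># Bs \<subseteq># M" for Bs
    using nozs[OF that] egz[of m "image_mset val Bs"] m by fastforce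
  have tv: "\<exists>c d. two_valued m (m - 1) (m - 1) c d (image_mset val Bs)"
    if "blocks p Bs" "\<Sum>\<^sub># Bs \<subseteq># M" "size Bs = 2 * m - 2" for Bs
    using m(2) nozs[OF that(1,2)] that(3) unfolding egz_inverse_def by simp
  have szM: "size M \<ge> p * (2 * m - 2) + p - 1"
  proof -
    have "p * (2 * m - 2) + 2 * p = 2 * (p * m)" using m(1) by (simp add: algebra_simps diff_mult_distrib2)
    then show ?thesis using M(1) p(1) by linarith
  qed
  obtain Bs where Bs: "size Bs = 2 * m - 2" "\<Sum>\<^sub># Bs \<subseteq># M" "blocks p Bs"
    using extract_blocks[of p "2 * m - 2" M] egz[of p] p(1) szM by auto
  define R where "R = M - \<Sum>\<^sub># Bs"
  have MR: "M = R + \<Sum>\<^sub># Bs" using Bs(2) by (simp add: R_def)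
  have szR: "size R = 2 * p - 2"
  proof -
    have "size R + p * (2 * m - 2) = 2 * (p * m) - 2" using M(1) size_Union_blocks[OF Bs(3)] Bs(1) by (simp add: MR)
    moreover have "p * (2 * m - 2) + 2 * p = 2 * (p * m)" using m(1) by (simp add: algebra_simps diff_mult_distrib2)
    ultimately show ?thesis by linarith
  qed
  have "\<not> zero_sum p p R"
  proof
    assume "zero_sum p p R"
    then obtain T where T: "T \<subseteq># R" "size T = p" "int p dvd \<Sum>\<^sub># T" by (auto simp: zero_sum_def)
    have "blocks p (add_mset T Bs)" using T Bs(3) by (simp add: blocks_def)
    moreover have "\<Sum>\<^sub># (add_mset T Bs) \<subseteq># M" using T(1) by (simp add: MR)
    ultimately show False using few Bs(1) m(1) by fastforce
  qed
  then obtain a b where ab: "two_valued p (p - 1) (p - 1) a b R" using p(2) szR unfolding egz_inverse_def by blast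
  define a' b' where "a' = a mod int p" and "b' = b mod int p"
  have ne: "a' \<noteq> b'" using ab coprime_residues_distinct p(1) by (auto simp: two_valued_def a'_def b'_def)
  define Rm where "Rm = residues p R"
  have Rab: "Rm = replicate_mset (p - 1) a' + replicate_mset (p - 1) b'"
    using ab by (simp add: two_valued_def a'_def b'_def Rm_def)
  have block_const: "residues p B = replicate_mset p a' \<or> residues p B = replicate_mset p b'"
    if B: "B \<in># Bs" for B
  proof -
    obtain Bs' where Bs': "Bs = add_mset B Bs'" using B by (meson multi_member_split)
    have szB: "size B = p" using Bs(3) B by (simp add: blocks_def)
    have "\<exists>a b. two_valued p (2 * p - 1) (p - 1) a b (R + B)"
    proof (rule egz_inverse_long[OF p])
      show "size (R + B) = 3 * p - 2" using szR szB p(1) by simp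
      show "\<nexists>T1 T2. T1 + T2 \<subseteq># R + B \<and> size T1 = p \<and> size T2 = p \<and> int p dvd \<Sum>\<^sub># T1 \<and> int p dvd \<Sum>\<^sub># T2"
      proof
        assume "\<exists>T1 T2. T1 + T2 \<subseteq># R + B \<and> size T1 = p \<and> size T2 = p \<and> int p dvd \<Sum>\<^sub># T1 \<and> int p dvd \<Sum>\<^sub># T2"
        then obtain T1 T2 where T: "T1 + T2 \<subseteq># R + B" "size T1 = p" "size T2 = p" "int p dvd \<Sum>\<^sub># T1" "int p dvd \<Sum>\<^sub># T2" by blast
        have "blocks p (add_mset T1 (add_mset T2 Bs'))" using T Bs(3) by (auto simp: blocks_def Bs')
        moreover have "\<Sum>\<^sub># (add_mset T1 (add_mset T2 Bs')) \<subseteq># M"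
        proof -
          have "(T1 + T2) + \<Sum>\<^sub># Bs' \<subseteq># (R + B) + \<Sum>\<^sub># Bs'" using T(1) by (rule subset_mset.add_right_mono)
          then show ?thesis by (simp add: MR Bs' ac_simps)
        qed
        ultimately show False using few Bs(1) Bs' m(1) by fastforce
      qed
    qed
    then obtain a2 b2 where "two_valued p (2 * p - 1) (p - 1) a2 b2 (R + B)" by blast
    then have eq: "Rm + residues p B = replicate_mset (2 * p - 1) (a2 mod int p) + replicate_mset (p - 1) (b2 mod int p)"
      by (simp add: two_valued_def Rm_def)
    have "a' \<in># Rm" "b' \<in># Rm" using p(1) unfolding Rab by auto
    then have "a' \<in># Rm + residues p B" "b' \<in># Rm + residues p B" by auto
    then have "{a', b'} \<subseteq> {a2 mod int p, b2 mod int p}" unfolding eq by (auto split: if_splits)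
    moreover have split: "replicate_mset (2 * p - 1) x = replicate_mset (p - 1) x + replicate_mset p x" for x :: int
      using p(1) by (simp add: multiset_eq_iff)
    ultimately consider "a' = a2 mod int p" "b' = b2 mod int p" | "b' = a2 mod int p" "a' = b2 mod int p"
      using ne by auto
    then show ?thesis
    proof cases
      case 1
      then have "Rm + residues p B = Rm + replicate_mset p a'" using eq unfolding split Rab by (simp add: ac_simps)
      then show ?thesis by simp
    next
      case 2
      then have "Rm + residues p B = Rm + replicate_mset p b'" using eq unfolding split Rab by (simp add: ac_simps)
      then show ?thesis by simp
    qed
  qed
  \<comment> \<open>Replacing x by y in a block changes its value by (y-x)/p, and
    \<open>two_valued_rigid\<close> forbids any change modulo m.\<close>
  have exchange: "[x = y] (mod int n)" if B: "B \<in># Bs" and x: "x \<in># B" and y: "y \<in># R" and xy: "x mod int p = y mod int p" for B x y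
  proof -
    obtain Bs' where Bs': "Bs = add_mset B Bs'" using B by (meson multi_member_split)
    obtain B0 where B0: "B = add_mset x B0" using x by (meson multi_member_split)
    obtain R0 where R0: "R = add_mset y R0" using y by (meson multi_member_split)
    obtain k where k: "y - x = int p * k" using xy by (metis dvdE mod_eq_dvd_iff)
    have pB: "int p dvd \<Sum>\<^sub># B" "size B = p" using Bs(3) B by (auto simp: blocks_def)
    have sum': "\<Sum>\<^sub># (add_mset y B0) = \<Sum>\<^sub># B + int p * k" using k by (simp add: B0 algebra_simps)
    have valeq: "val (add_mset y B0) = val B + k" unfolding val_def sum' using p(1) by simp
    have "int p dvd \<Sum>\<^sub># (add_mset y B0)" "size (add_mset y B0) = p" unfolding sum' using pB B0 by simp_all
    then have "blocks p (add_mset (add_mset y B0) Bs')" using Bs(3) unfolding blocks_def Bs' by simp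
    moreover have "\<Sum>\<^sub># (add_mset (add_mset y B0) Bs') \<subseteq># M" by (simp add: MR Bs' B0 R0 subset_mset.add_increasing)
    ultimately obtain c d where "two_valued m (m - 1) (m - 1) c d (image_mset val (add_mset (add_mset y B0) Bs'))"
      using tv[of "add_mset (add_mset y B0) Bs'"] Bs(1) Bs' by auto
    moreover obtain c' d' where "two_valued m (m - 1) (m - 1) c' d' (image_mset val Bs)" using tv[OF Bs(3,2,1)] by blast
    ultimately have "[val (add_mset y B0) = val B] (mod int m)"
      using two_valued_rigid[OF m(1)] unfolding Bs' by simp
    then have "int m dvd k" unfolding valeq by (simp add: cong_iff_dvd_diff)
    then have "int n dvd y - x" unfolding k n_def by simp
    then show ?thesis by (simp add: cong_iff_dvd_diff dvd_diff_commute)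
  qed
  have "a' \<in># Rm" "b' \<in># Rm" using p(1) unfolding Rab by auto
  then obtain a0 b0 where a0: "a0 \<in># R" "a0 mod int p = a'" and b0: "b0 \<in># R" "b0 mod int p = b'" by (auto simp: Rm_def)
  have Bab: "(\<forall>x\<in>#B. [x = a0] (mod int n)) \<or> (\<forall>x\<in>#B. [x = b0] (mod int n))" if B: "B \<in># Bs" for B
    using block_const[OF B]
  proof
    assume eq: "residues p B = replicate_mset p a'"
    have "x mod int p = a0 mod int p" if "x \<in># B" for x
    proof -
      have "x mod int p \<in># residues p B" using that by simp
      then show ?thesis unfolding eq using a0 by (simp split: if_splits)
    qed
    then show ?thesis using exchange[OF B _ a0(1)] by blast
  next
    assume eq: "residues p B = replicate_mset p b'"
    have "x mod int p = b0 mod int p" if "x \<in># B" for x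
    proof -
      have "x mod int p \<in># residues p B" using that by simp
      then show ?thesis unfolding eq using b0 by (simp split: if_splits)
    qed
    then show ?thesis using exchange[OF B _ b0(1)] by blast
  qed
  have valc: "[val B = c] (mod int m)" if B: "B \<in># Bs" and c: "\<forall>x\<in>#B. [x = c] (mod int n)" for B c
  proof -
    have pB: "int p dvd \<Sum>\<^sub># B" "size B = p" using Bs(3) B by (auto simp: blocks_def)
    have "[(\<Sum>x\<in>#B. x) = (\<Sum>x\<in>#B. c)] (mod int n)" by (rule cong_sum_mset) (use c in auto)
    then have "[int p * val B = int p * c] (mod int p * int m)" using pB by (simp add: val_def n_def)
    then show ?thesis using p(1) by (simp add: cong_iff_dvd_diff flip: right_diff_distrib)
  qed
  obtain c d where cd: "two_valued m (m - 1) (m - 1) c d (image_mset val Bs)" using tv[OF Bs(3,2,1)] by blast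
  have vab: "[v = a0] (mod int m) \<or> [v = b0] (mod int m)" if "v \<in># image_mset val Bs" for v
  proof -
    from that obtain B where "B \<in># Bs" "v = val B" by auto
    then show ?thesis using Bab[of B] valc[of B] by blast
  qed
  note cases = two_valued_cases[OF cd m(1) vab]
  have copp: "coprime (a0 - b0) (int p)"
  proof -
    have "[a0 - b0 = a - b] (mod int p)" using a0 b0 unfolding a'_def b'_def cong_def by (metis mod_diff_cong)
    moreover have "coprime (a - b) (int p)" using ab by (simp add: two_valued_def)
    ultimately show ?thesis using cong_imp_coprime cong_sym by blast
  qed
  have cop: "coprime (a0 - b0) (int n)" using copp cases(1) by (simp add: n_def)
  \<comment> \<open>The terms of \<open>R\<close> are known only modulo p. By
    \<open>two_valued_cases\<close> some block is constant with value z modulo n, and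
    \<open>exchange\<close> with a term of it lifts the congruence to n.\<close>
  have all_cong: "[y = z] (mod int n)" if v: "\<exists>x\<in>#image_mset val Bs. [x = z] (mod int m)" and z: "z = a0 \<or> z = b0"
    and y: "y \<in># R" "y mod int p = z mod int p" for y z
  proof -
    obtain B where B: "B \<in># Bs" "[val B = z] (mod int m)" using v by auto
    have nm: "\<not> [a0 = b0] (mod int m)" using coprime_residues_distinct[OF cases(1) m(1)] by (simp add: cong_def)
    then have "\<forall>x\<in>#B. [x = z] (mod int n)"
      using Bab[OF B(1)] valc[OF B(1)] B(2) z by (meson cong_sym cong_trans)
    moreover have "size B = p" using Bs(3) B(1) by (simp add: blocks_def)
    then obtain x where x: "x \<in># B" using p(1) by (metis multiset_nonemptyE not_numeral_le_zero size_empty)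
    ultimately have xz: "[x = z] (mod int n)" by blast
    then have "[x = z] (mod int p)" unfolding n_def by (simp add: cong_modulus_mult)
    then have "x mod int p = y mod int p" using y(2) by (simp add: cong_def)
    then show ?thesis using exchange[OF B(1) x y(1)] xz cong_sym cong_trans by blast
  qed
  have Mab: "x mod int n \<in> {a0 mod int n, b0 mod int n}" if x: "x \<in># M" for x
  proof -
    consider "x \<in># R" | B where "B \<in># Bs" "x \<in># B" using x MR by (auto simp: in_Union_mset_iff)
    then have "[x = a0] (mod int n) \<or> [x = b0] (mod int n)"
    proof cases
      case 1
      then have "x mod int p \<in># Rm" by (simp add: Rm_def)
      then have "x mod int p = a0 mod int p \<or> x mod int p = b0 mod int p" unfolding Rab using a0 b0 by (auto split: if_splits)
      then show ?thesis using all_cong[OF cases(2)] all_cong[OF cases(3)] 1 by blast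
    qed (use Bab in blast)
    then show ?thesis by (auto simp: cong_def)
  qed
  define Mn where "Mn = residues n M"
  have n2: "n \<ge> 2" using p(1) m(1) unfolding n_def by (metis mult_le_mono nat_mult_1 one_le_numeral order_trans)
  have ne0: "a0 mod int n \<noteq> b0 mod int n" using coprime_residues_distinct[OF cop n2] .
  have two: "Mn = replicate_mset (count Mn (a0 mod int n)) (a0 mod int n) + replicate_mset (count Mn (b0 mod int n)) (b0 mod int n)"
    by (rule mset_two_elements) (use Mab ne0 in \<open>auto simp: Mn_def\<close>)
  have "\<not> zero_sum n n Mn" using M(2) unfolding Mn_def zero_sum_mod n_def by simp
  then have le: "count Mn x \<le> n - 1" for x using zero_sum_count[of n Mn x] n2 by linarith
  have "size Mn = 2 * n - 2" using M(1) by (simp add: Mn_def n_def)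
  then have "count Mn (a0 mod int n) + count Mn (b0 mod int n) = 2 * n - 2" by (subst (asm) two) simp
  then have "count Mn (a0 mod int n) = n - 1" "count Mn (b0 mod int n) = n - 1"
    using le[of "a0 mod int n"] le[of "b0 mod int n"] n2 by linarith+
  then have "two_valued n (n - 1) (n - 1) a0 b0 M" using two cop by (simp add: two_valued_def Mn_def)
  then show "\<exists>a b. two_valued (p * m) (p * m - 1) (p * m - 1) a b M" unfolding n_def by blast
qed

theorem egz_inverse:
  assumes "n > 0" shows "egz_inverse n"
  using assms
proof (induction n rule: prime_divisors_induct)
  case (unit u)
  then show ?case by (auto simp: egz_inverse_def two_valued_def)
next
  case (factor p m)
  then have "m > 0" by simp
  then show ?case
    using factor egz_inverse_prime[of p] egz_inverse_mult[of p m] prime_ge_2_nat[of p]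
    by (cases "m = 1") auto
qed simp

section \<open>The infinite dihedral group\<close>

text \<open>The pair \<open>(b, x)\<close> stands for \<open>\<alpha>\<^sup>x \<tau>\<^sup>b\<close>; in a dihedral group of order \<open>2n\<close> the second component
  only matters modulo \<open>n\<close>.\<close>

type_synonym dih = "bool \<times> int"

abbreviation refls :: "dih multiset \<Rightarrow> dih multiset" where
  "refls \<equiv> filter_mset fst"

abbreviation rots :: "dih multiset \<Rightarrow> dih multiset" where
  "rots S \<equiv> {#x\<in>#S. \<not> fst x#}"

definition dmul :: "dih \<Rightarrow> dih \<Rightarrow> dih" where
  "dmul g h = (fst g \<noteq> fst h, snd g + (if fst g then - snd h else snd h))"

definition dprod :: "dih list \<Rightarrow> dih" where
  "dprod xs = foldr dmul xs (False, 0)"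

definition dval :: "dih multiset \<Rightarrow> int \<Rightarrow> bool" where
  "dval T w \<longleftrightarrow> (\<exists>xs. mset xs = T \<and> dprod xs = (False, w))"

text \<open>A product-one subsequence of length \<open>k\<close> in the dihedral group of order 2n,
  in terms of integer exponents; \<open>has_product_one_phi\<close> links it to
  \<open>G\<close>.\<close>

definition pone :: "nat \<Rightarrow> nat \<Rightarrow> dih multiset \<Rightarrow> bool" where
  "pone n k S \<longleftrightarrow> (\<exists>T w. T \<subseteq># S \<and> size T = k \<and> dval T w \<and> int n dvd w)"

lemma dprod_simps [simp]: "dprod [] = (False, 0)" "dprod (x # xs) = dmul x (dprod xs)"
  by (simp_all add: dprod_def)

lemma dmul_assoc: "dmul (dmul a b) c = dmul a (dmul b c)"
  by (auto simp: dmul_def)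

lemma dmul_id [simp]: "dmul (False, 0) x = x" "dmul x (False, 0) = x"
  by (auto simp: dmul_def prod_eq_iff)

lemma dprod_append [simp]: "dprod (xs @ ys) = dmul (dprod xs) (dprod ys)"
  by (induction xs) (auto simp: dmul_assoc)

lemma fst_dprod: "fst (dprod xs) \<longleftrightarrow> odd (size {#x \<in># mset xs. fst x#})"
  by (induction xs) (auto simp: dmul_def)

lemma dval_add: "dval T w \<Longrightarrow> dval U v \<Longrightarrow> dval (T + U) (w + v)"
proof -
  assume "dval T w" "dval U v"
  then obtain xs ys where "mset xs = T" "dprod xs = (False, w)" "mset ys = U" "dprod ys = (False, v)"
    by (auto simp: dval_def)
  then show ?thesis unfolding dval_def by (intro exI[of _ "xs @ ys"]) (simp add: dmul_def)
qed

lemma dval_empty: "dval {#} 0"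
  by (auto simp: dval_def)

lemma dval_rot: "dval {#(False, x)#} x"
  unfolding dval_def by (intro exI[of _ "[(False, x)]"]) simp

lemma dval_refl_pair: "dval {#(True, y), (True, y')#} (y - y')"
  unfolding dval_def by (intro exI[of _ "[(True, y), (True, y')]"]) (simp add: dmul_def)

text \<open>A rotation placed directly behind the first reflection enters the product inverted.\<close>

lemma dval_insert_neg:
  assumes "dval T w" "\<exists>t\<in>#T. fst t"
  shows "dval (add_mset (False, x) T) (w - x)"
proof -
  obtain xs where xs: "mset xs = T" "dprod xs = (False, w)" using assms(1) by (auto simp: dval_def)
  have "\<exists>t\<in>set xs. fst t" using assms(2) xs(1) by auto
  then obtain ys t zs where s: "xs = ys @ t # zs" "fst t" "\<forall>y\<in>set ys. \<not> fst y"
    using split_list_first_prop[of xs fst] by blast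
  have "\<not> fst (dprod ys)" using s(3) by (induction ys) (auto simp: dmul_def)
  then have "dprod (ys @ t # (False, x) # zs) = (False, w - x)"
    using xs(2) s(2) unfolding s(1) by (auto simp: dmul_def)
  then show ?thesis unfolding dval_def using xs(1) s(1)
    by (intro exI[of _ "ys @ t # (False, x) # zs"]) auto
qed

lemma dval_insert_pos: "dval T w \<Longrightarrow> dval (add_mset (False, x) T) (w + x)"
  using dval_add[OF dval_rot[of x], of T w] by (simp add: add.commute)

section \<open>Pairs of terms of equal type and their signed values\<close>

definition elts :: "('a \<times> 'a) multiset \<Rightarrow> 'a multiset" where
  "elts P = image_mset fst P + image_mset snd P"

lemma elts_simps [simp]:
  "elts {#} = {#}" "elts (add_mset p P) = add_mset (fst p) (add_mset (snd p) (elts P))"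
  "elts (P + Q) = elts P + elts Q" "size (elts P) = 2 * size P"
  by (simp_all add: elts_def)

lemma elts_mono: "P \<subseteq># Q \<Longrightarrow> elts P \<subseteq># elts Q"
  by (auto simp: subset_mset.le_iff_add)

text \<open>Greedy: a new term is matched with an unmatched term of its key whenever there is
  one.\<close>

lemma pair_up:
  fixes key :: "'a \<Rightarrow> 'k"
  obtains P L where "S = elts P + L" "\<And>p. p \<in># P \<Longrightarrow> key (fst p) = key (snd p)"
    "\<And>k. count (image_mset key L) k \<le> 1"
proof -
  have "\<exists>P L. S = elts P + L \<and> (\<forall>p\<in>#P. key (fst p) = key (snd p)) \<and> (\<forall>k. count (image_mset key L) k \<le> 1)"
  proof (induction S)
    case empty
    show ?case by (rule exI[of _ "{#}"], rule exI[of _ "{#}"]) simp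
  next
    case (add x S)
    then obtain P L where IH: "S = elts P + L" "\<forall>p\<in>#P. key (fst p) = key (snd p)"
      "\<forall>k. count (image_mset key L) k \<le> 1" by blast
    show ?case
    proof (cases "\<exists>y\<in>#L. key y = key x")
      case True
      then obtain y L' where y: "L = add_mset y L'" "key y = key x" by (meson multi_member_split)
      have "\<forall>k. count (image_mset key L') k \<le> 1"
      proof
        fix k show "count (image_mset key L') k \<le> 1" using IH(3)[rule_format, of k] y(1) by (simp split: if_splits)
      qed
      then show ?thesis using IH y by (intro exI[of _ "add_mset (x, y) P"] exI[of _ L']) auto
    next
      case False
      then have "count (image_mset key L) (key x) = 0" by (auto simp: count_eq_zero_iff)
      then have "\<forall>k. count (image_mset key (add_mset x L)) k \<le> 1" using IH(3) by auto
      then show ?thesis using IH by (intro exI[of _ P] exI[of _ "add_mset x L"]) auto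
    qed
  qed
  then show ?thesis using that by blast
qed

lemma size_le_card_UNIV:
  fixes M :: "'k::finite multiset"
  assumes "\<And>k. count M k \<le> 1" shows "size M \<le> card (UNIV :: 'k set)"
proof -
  have "M \<subseteq># mset_set UNIV" using assms by (simp add: subseteq_mset_def count_mset_set')
  then show ?thesis using size_mset_mono by fastforce
qed

lemma count_le_1_distinct:
  assumes "\<And>k. count (image_mset key L) k \<le> 1" "{#x, y#} \<subseteq># L"
  shows "key x \<noteq> key y"
proof
  assume eq: "key x = key y"
  have "image_mset key {#x, y#} \<subseteq># image_mset key L" using assms(2) by (rule image_mset_subseteq_mono)
  then have "count (image_mset key {#x, y#}) (key x) \<le> count (image_mset key L) (key x)" by (rule mset_subset_eq_count)
  then show False using assms(1)[of "key x"] eq by simp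
qed

text \<open>The exponent of the product of the two terms, meaningful for pairs of one type: two
  reflections with exponents y and y' multiply to the rotation with exponent y-y'.\<close>

definition pval :: "dih \<times> dih \<Rightarrow> int" where
  "pval p = (if fst (fst p) then snd (fst p) - snd (snd p) else snd (fst p) + snd (snd p))"

abbreviation psum :: "(dih \<times> dih) multiset \<Rightarrow> int" where
  "psum P \<equiv> \<Sum>p\<in>#P. pval p"

definition homog :: "(dih \<times> dih) multiset \<Rightarrow> bool" where
  "homog P \<longleftrightarrow> (\<forall>p\<in>#P. fst (fst p) = fst (snd p))"

lemma homog_simps [simp]:
  "homog {#}" "homog (add_mset p P) \<longleftrightarrow> fst (fst p) = fst (snd p) \<and> homog P"
  "homog (P + Q) \<longleftrightarrow> homog P \<and> homog Q"
  by (auto simp: homog_def)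

lemma homog_mono: "homog P \<Longrightarrow> Q \<subseteq># P \<Longrightarrow> homog Q"
  unfolding homog_def by (meson mset_subset_eqD)

lemma dval_pair:
  assumes "fst (fst p) = fst (snd p)"
  shows "dval {#fst p, snd p#} (pval p)"
proof -
  obtain a b where pab: "p = (a, b)" by (cases p)
  show ?thesis
  proof (cases "fst a")
    case True
    then have "a = (True, snd a)" "b = (True, snd b)" using assms pab by (auto simp: prod_eq_iff)
    then show ?thesis using dval_refl_pair[of "snd a" "snd b"] True pab by (simp add: pval_def)
  next
    case False
    then have "a = (False, snd a)" "b = (False, snd b)" using assms pab by (auto simp: prod_eq_iff)
    then show ?thesis using dval_add[OF dval_rot[of "snd a"] dval_rot[of "snd b"]] False pab
      by (simp add: pval_def add_mset_commute)
  qed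
qed

lemma dval_elts: "homog P \<Longrightarrow> dval (elts P) (psum P)"
proof (induction P)
  case (add p P)
  then show ?case using dval_add[OF dval_pair[of p], of "elts P"] by simp
qed (simp add: dval_empty)

lemma dval_add_elts: "homog P \<Longrightarrow> dval T w \<Longrightarrow> dval (elts P + T) (w + psum P)"
  using dval_add[OF dval_elts, of P T w] by (simp add: add.commute)

text \<open>A pair of reflections is inverted by swapping its terms. A pair of rotations is inverted
  by placing both terms behind a reflection of \<open>T\<close>.\<close>

lemma dval_pair_neg:
  assumes "fst (fst p) = fst (snd p)" "dval T w" "\<exists>t\<in>#T. fst t"
  shows "dval (add_mset (fst p) (add_mset (snd p) T)) (w - pval p)"
proof (cases "fst (fst p)")
  case True
  then have "fst p = (True, snd (fst p))" "snd p = (True, snd (snd p))" using assms(1) by (auto simp: prod_eq_iff)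
  then have "dval {#snd p, fst p#} (- pval p)" using dval_refl_pair[of "snd (snd p)" "snd (fst p)"] True
    by (simp add: pval_def)
  from dval_add[OF this assms(2)] show ?thesis by (simp add: add_mset_commute)
next
  case False
  then have p: "fst p = (False, snd (fst p))" "snd p = (False, snd (snd p))" using assms(1) by (auto simp: prod_eq_iff)
  have "dval (add_mset (snd p) T) (w - snd (snd p))" using dval_insert_neg[OF assms(2,3)] p(2) by metis
  then have "dval (add_mset (fst p) (add_mset (snd p) T)) (w - snd (snd p) - snd (fst p))"
    using dval_insert_neg[of "add_mset (snd p) T" "w - snd (snd p)" "snd (fst p)"] p(1) assms(3) by auto
  then show ?thesis using False by (simp add: pval_def algebra_simps)
qed

lemma dval_sub_elts:
  assumes "homog Q" "dval T w" "\<exists>t\<in>#T. fst t"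
  shows "dval (elts Q + T) (w - psum Q)"
  using assms(1)
proof (induction Q)
  case (add q Q)
  have "\<exists>t\<in>#elts Q + T. fst t" using assms(3) by auto
  have "dval (elts Q + T) (w - psum Q)" "fst (fst q) = fst (snd q)" using add by simp_all
  from dval_pair_neg[OF this(2,1) \<open>\<exists>t\<in>#elts Q + T. fst t\<close>] show ?case by (simp add: diff_diff_eq add.commute)
qed (use assms in simp)

text \<open>A reflection has to be in place before rotations can be inverted. If \<open>P\<close>
  has none, a reflection pair of \<open>Q\<close> is swapped and put next to \<open>P\<close> first;
  swapping alone gives it the negative sign.\<close>

lemma dval_signed:
  assumes "homog (P + Q)" "\<exists>p\<in>#P + Q. fst (fst p)"
  shows "dval (elts (P + Q)) (psum P - psum Q)"
proof (cases "\<exists>p\<in>#P. fst (fst p)")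
  case True
  then have "\<exists>t\<in>#elts P. fst t" by (auto simp: elts_def)
  then show ?thesis using dval_sub_elts[of Q "elts P"] dval_elts[of P] assms(1) by (simp add: add.commute)
next
  case False
  then obtain q Q' where q: "Q = add_mset q Q'" "fst (fst q)" using assms(2) by (metis multi_member_split union_iff)
  have h: "fst (fst q) = fst (snd q)" "homog Q'" "homog P" using assms(1) q by auto
  have "dval {#snd q, fst q#} (pval (snd q, fst q))" using dval_pair[of "(snd q, fst q)"] h(1) by simp
  also have "pval (snd q, fst q) = - pval q" using q(2) h(1) by (simp add: pval_def)
  finally have "dval (elts P + {#snd q, fst q#}) (- pval q + psum P)" by (rule dval_add_elts[OF h(3)])
  moreover have "\<exists>t\<in>#elts P + {#snd q, fst q#}. fst t" using q(2) by auto
  ultimately have "dval (elts Q' + (elts P + {#snd q, fst q#})) (- pval q + psum P - psum Q')"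
    using dval_sub_elts[OF h(2)] by blast
  moreover have "elts Q' + (elts P + {#snd q, fst q#}) = elts (P + Q)" unfolding q(1) by (simp add: ac_simps add_mset_commute)
  moreover have "- pval q + psum P - psum Q' = psum P - psum Q"
    unfolding q(1) by simp
  ultimately show ?thesis by (simp only:)
qed

lemma zero_sum_imageE:
  assumes "zero_sum n k (image_mset f P)"
  obtains P' where "P' \<subseteq># P" "size P' = k" "int n dvd (\<Sum>p\<in>#P'. f p)"
proof -
  obtain T where T: "T \<subseteq># image_mset f P" "size T = k" "int n dvd \<Sum>\<^sub># T" using assms by (auto simp: zero_sum_def)
  obtain P' where "P' \<subseteq># P" "T = image_mset f P'" using subset_image_msetE[OF T(1)] .
  then show ?thesis using that T by simp
qed

lemma size_filter_eq_count: "size {#p \<in># P. g p = c#} = count (image_mset g P) c"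
  by (induction P) auto

lemma pone_mono: "pone n k S \<Longrightarrow> S \<subseteq># S' \<Longrightarrow> pone n k S'"
  unfolding pone_def using subset_mset.order_trans by blast

section \<open>Sequences of length \<open>2n - 1\<close> for even \<open>n\<close>\<close>

text \<open>Two terms of equal key multiply to a rotation with an even exponent, so the value of the
  pair can be halved. There are four keys.\<close>

definition pkey :: "dih \<Rightarrow> bool \<times> bool" where
  "pkey x = (fst x, even (snd x))"

definition hval :: "dih \<times> dih \<Rightarrow> int" where
  "hval p = pval p div 2"

lemma size_2_mset: "size M = 2 \<Longrightarrow> \<exists>x y. M = {#x, y#}"
  by (cases M) (auto dest!: size_1_singleton_mset[unfolded One_nat_def])

lemma card_bool_bool: "card (UNIV :: (bool \<times> bool) set) = 4"
  by (simp add: UNIV_Times_UNIV[symmetric] card_cartesian_product UNIV_bool del: UNIV_Times_UNIV)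

lemma double_dvd: "int m dvd a - b \<Longrightarrow> int (2 * m) dvd 2 * a - 2 * b"
  using mult_dvd_mono[of 2 2 "int m" "a - b"] by (simp add: right_diff_distrib)

abbreviation hsum :: "(dih \<times> dih) multiset \<Rightarrow> int" where
  "hsum P \<equiv> \<Sum>p\<in>#P. hval p"

text \<open>The negation of \<open>pone_even\<close> for n = 2m and length 2n-1 = 4m-1, refuted in
  \<open>contradiction\<close>.\<close>

locale even_counterexample =
  fixes m :: nat and S :: "dih multiset"
  assumes m2: "m \<ge> 2" and size_S: "size S = 4 * m - 1"
    and reflections: "size (refls S) \<ge> 2"
    and none: "\<not> pone (2 * m) (2 * m) S"
begin

definition pairing :: "(dih \<times> dih) multiset \<Rightarrow> bool" where
  "pairing P \<longleftrightarrow> (\<forall>p\<in>#P. pkey (fst p) = pkey (snd p)) \<and> elts P \<subseteq># S"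

lemma pairing_mono: "pairing P \<Longrightarrow> Q \<subseteq># P \<Longrightarrow> pairing Q"
  unfolding pairing_def using elts_mono subset_mset.order_trans by (meson mset_subset_eqD)

lemma pairing_homog: "pairing P \<Longrightarrow> homog P"
  by (auto simp: pairing_def homog_def pkey_def)

lemma pval_hval: "pkey (fst p) = pkey (snd p) \<Longrightarrow> pval p = 2 * hval p"
  by (auto simp: hval_def pval_def pkey_def)

lemma pairing_sum:
  assumes "pairing P" shows "psum P = 2 * hsum P"
proof -
  have "image_mset pval P = image_mset (\<lambda>p. 2 * hval p) P"
    by (rule image_mset_cong) (use assms pval_hval in \<open>auto simp: pairing_def\<close>)
  then show ?thesis by (simp add: sum_mset_distrib_left)
qed

text \<open>Halving turns the modulus 2m into m: \<open>m\<close> pairs have 2m terms, and their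
  product has twice the sum of the halves as exponent.\<close>

lemma no_zero_sum:
  assumes "pairing P" shows "\<not> zero_sum m m (image_mset hval P)"
proof
  assume "zero_sum m m (image_mset hval P)"
  then obtain Q where Q: "Q \<subseteq># P" "size Q = m" "int m dvd hsum Q" by (rule zero_sum_imageE)
  have pQ: "pairing Q" using pairing_mono assms Q(1) by blast
  have "pone (2 * m) (2 * m) S" unfolding pone_def
    using dval_elts[OF pairing_homog[OF pQ]] Q pQ pairing_sum[OF pQ]
    by (intro exI[of _ "elts Q"]) (auto simp: pairing_def)
  then show False using none by blast
qed

lemma no_signed:
  assumes "pairing (P + Q)" "size P + size Q = m" "\<exists>p\<in>#P + Q. fst (fst p)"
  shows "\<not> int m dvd hsum P - hsum Q"
proof
  assume "int m dvd hsum P - hsum Q"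
  moreover have "pairing P" "pairing Q" using assms(1) pairing_mono by auto
  ultimately have "int (2 * m) dvd psum P - psum Q"
    using double_dvd by (simp only: pairing_sum)
  then have "pone (2 * m) (2 * m) S" unfolding pone_def
  proof (intro exI conjI)
    show "elts (P + Q) \<subseteq># S" using assms(1) unfolding pairing_def by blast
    show "size (elts (P + Q)) = 2 * m" using assms(2) by simp
  qed (use dval_signed[OF pairing_homog[OF assms(1)] assms(3)] in assumption)
  then show False using none by blast
qed

lemma size_pairing_less: "pairing P \<Longrightarrow> size P < 2 * m - 1"
  using no_zero_sum[of P] egz[of m "image_mset hval P"] m2 by fastforce

lemma pairing_two_valued:
  assumes "pairing P" "size P = 2 * m - 2"
  obtains a b where "two_valued m (m - 1) (m - 1) a b (image_mset hval P)"
proof -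
  have "\<exists>a b. two_valued m (m - 1) (m - 1) a b (image_mset hval P)"
    using egz_inverse[of m] no_zero_sum[OF assms(1)] assms(2) m2 unfolding egz_inverse_def by simp
  then show ?thesis using that by blast
qed

definition decomposition :: "(dih \<times> dih) multiset \<Rightarrow> dih multiset \<Rightarrow> bool" where
  "decomposition P L \<longleftrightarrow> S = elts P + L \<and> (\<forall>p\<in>#P. pkey (fst p) = pkey (snd p))
     \<and> (\<forall>k. count (image_mset pkey L) k \<le> 1)"

lemma ex_decomposition: obtains P L where "decomposition P L"
  using pair_up[of S pkey] unfolding decomposition_def by metis

lemma decomposition_pairing: "decomposition P L \<Longrightarrow> pairing P"
  unfolding decomposition_def pairing_def by simp

text \<open>There are four keys, so at most four terms are unpaired; as 4m-1 is odd, at most three.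
  This gives at least 2m-2 pairs, while 2m-1 pairs are excluded by \<open>egz\<close>.\<close>

lemma decomposition_sizes:
  assumes "decomposition P L" shows "size P = 2 * m - 2" "size L = 3"
proof -
  have "size (image_mset pkey L) \<le> card (UNIV :: (bool \<times> bool) set)"
    by (rule size_le_card_UNIV) (use assms in \<open>auto simp: decomposition_def\<close>)
  also have "card (UNIV :: (bool \<times> bool) set) = 4" by (rule card_bool_bool)
  finally have "size L \<le> 4" by simp
  moreover have "2 * size P + size L = 4 * m - 1" using assms size_S by (auto simp: decomposition_def)
  moreover have "size P < 2 * m - 1" using size_pairing_less decomposition_pairing[OF assms] .
  ultimately show "size P = 2 * m - 2" "size L = 3" using m2 by presburger+
qed

lemma decomposition_two_valued:
  assumes "decomposition P L"
  obtains a b where "two_valued m (m - 1) (m - 1) a b (image_mset hval P)"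
  using pairing_two_valued[OF decomposition_pairing[OF assms] decomposition_sizes(1)[OF assms]] .

lemma decomposition_swap:
  assumes "decomposition (add_mset p P) L" shows "decomposition (add_mset (snd p, fst p) P) L"
  using assms unfolding decomposition_def by (auto simp: add_mset_commute)

lemma decomposition_exchange:
  assumes "decomposition (add_mset p P) (add_mset l L)" "pkey l = pkey (fst p)"
  shows "decomposition (add_mset (l, snd p) P) (add_mset (fst p) L)"
proof -
  have "image_mset pkey (add_mset (fst p) L) = image_mset pkey (add_mset l L)" using assms(2) by simp
  then show ?thesis using assms unfolding decomposition_def
    by (simp add: add_mset_commute del: image_mset_add_mset)
qed

text \<open>The pairs of both decompositions are extremal for \<open>m\<close> and differ in one
  place only, so \<open>two_valued_rigid\<close> applies.\<close>

lemma hval_cong: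
  assumes "decomposition (add_mset p P) L" "decomposition (add_mset q P) L'"
  shows "[hval p = hval q] (mod int m)"
proof -
  obtain a b where 1: "two_valued m (m - 1) (m - 1) a b (image_mset hval (add_mset p P))"
    using decomposition_two_valued[OF assms(1)] .
  obtain a' b' where 2: "two_valued m (m - 1) (m - 1) a' b' (image_mset hval (add_mset q P))"
    using decomposition_two_valued[OF assms(2)] .
  show ?thesis using two_valued_rigid[OF m2] 1 2 by simp
qed

text \<open>Putting \<open>l\<close> in place of the first term of \<open>p\<close> must not change
  the half value modulo m, hence not the value modulo 2m.\<close>

lemma leftover_cong:
  assumes "decomposition (add_mset p P) (add_mset l L)" "pkey l = pkey (fst p)"
  shows "[snd l = snd (fst p)] (mod int (2 * m))"
proof -
  have keys: "pkey (fst p) = pkey (snd p)" using assms(1) by (simp add: decomposition_def)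
  have "[hval p = hval (l, snd p)] (mod int m)"
    using hval_cong assms(1) decomposition_exchange[OF assms] by blast
  then have "int m dvd hval p - hval (l, snd p)" by (simp add: cong_iff_dvd_diff)
  then have "int (2 * m) dvd 2 * hval p - 2 * hval (l, snd p)" by (rule double_dvd)
  also have "2 * hval p - 2 * hval (l, snd p) = pval p - pval (l, snd p)"
    using pval_hval keys assms(2) by simp
  also have "\<dots> = snd (fst p) - snd l" using assms(2) by (simp add: pval_def pkey_def)
  finally show ?thesis by (simp add: cong_iff_dvd_diff dvd_diff_commute)
qed

lemma leftover_cong_snd:
  assumes "decomposition (add_mset p P) (add_mset l L)" "pkey l = pkey (fst p)"
  shows "[snd l = snd (snd p)] (mod int (2 * m))"
  using leftover_cong[OF decomposition_swap[OF assms(1)]] assms by (simp add: decomposition_def)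

text \<open>Both terms of the pair are congruent to \<open>l\<close> modulo 2m. Two equal
  reflections have value 0, two equal rotations twice their exponent.\<close>

lemma hval_leftover:
  assumes "decomposition (add_mset p P) (add_mset l L)" "pkey l = pkey (fst p)"
  shows "[hval p = (if fst l then 0 else snd l)] (mod int m)"
proof -
  have keys: "pkey (fst p) = pkey (snd p)" using assms(1) by (simp add: decomposition_def)
  note c = leftover_cong[OF assms] leftover_cong_snd[OF assms]
  have "int (2 * m) dvd pval p - 2 * (if fst l then 0 else snd l)"
  proof (cases "fst l")
    case True
    then have "fst (fst p)" using assms(2) by (simp add: pkey_def)
    then show ?thesis using True cong_trans[OF cong_sym[OF c(1)] c(2)]
      by (simp add: pval_def cong_iff_dvd_diff)
  next
    case False
    then have "\<not> fst (fst p)" using assms(2) by (simp add: pkey_def)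
    then show ?thesis using False cong_add[OF cong_sym[OF c(1)] cong_sym[OF c(2)]]
      by (simp add: pval_def cong_iff_dvd_diff)
  qed
  also have "pval p - 2 * (if fst l then 0 else snd l) = 2 * (hval p - (if fst l then 0 else snd l))"
    using pval_hval[OF keys] by simp
  finally have "int m dvd hval p - (if fst l then 0 else snd l)"
    using dvd_mult_cancel_left[of 2 "int m" "hval p - (if fst l then 0 else snd l)"] by simp
  then show ?thesis by (simp only: cong_iff_dvd_diff)
qed

lemma not_all_equal:
  assumes "decomposition P L" "\<And>p. p \<in># P \<Longrightarrow> [hval p = c] (mod int m)"
  shows False
proof -
  obtain a b where "two_valued m (m - 1) (m - 1) a b (image_mset hval P)"
    using decomposition_two_valued[OF assms(1)] .
  then have "coprime (c - c) (int m)" by (rule two_valued_cases(1)[OF _ m2]) (use assms(2) in auto)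
  then show False using m2 by simp
qed

lemma two_valued_filter:
  assumes "two_valued m i j a b (image_mset f P)"
  shows "size {#p\<in>#P. [f p = a] (mod int m)#} = i" "size {#p\<in>#P. [f p = b] (mod int m)#} = j"
    "\<And>p. p \<in># P \<Longrightarrow> [f p = a] (mod int m) \<or> [f p = b] (mod int m)"
proof -
  have eq: "image_mset (\<lambda>p. f p mod int m) P = replicate_mset i (a mod int m) + replicate_mset j (b mod int m)"
    and cop: "coprime (a - b) (int m)"
    using assms by (simp_all add: two_valued_def multiset.map_comp comp_def)
  have ne: "a mod int m \<noteq> b mod int m" using coprime_residues_distinct[OF cop m2] .
  show "size {#p\<in>#P. [f p = a] (mod int m)#} = i" "size {#p\<in>#P. [f p = b] (mod int m)#} = j"
    unfolding cong_def size_filter_eq_count eq using ne by auto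
  fix p assume "p \<in># P"
  then have "f p mod int m \<in># image_mset (\<lambda>p. f p mod int m) P" by simp
  then show "[f p = a] (mod int m) \<or> [f p = b] (mod int m)" unfolding eq by (auto simp: cong_def split: if_splits)
qed

text \<open>Swapping the terms of \<open>r\<close> negates its value, so rigidity gives 2a = 0
  modulo m. Now take m-2 pairs of value a, one of them \<open>r\<close>, and two pairs of value b
  with opposite signs: the sum is (m-2)a = ma - 2a = 0. Two pairs of value b exist since m \<ge>
  3.\<close>

lemma no_reflection_pair_aux:
  assumes m3: "m \<ge> 3" and d: "decomposition P L" and tv: "two_valued m (m - 1) (m - 1) a b (image_mset hval P)"
    and r: "r \<in># P" "fst (fst r)" "[hval r = a] (mod int m)"
  shows False
proof -
  have twice: "int m dvd 2 * a"
  proof -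
    obtain P0 where P0: "P = add_mset r P0" using r(1) by (meson multi_member_split)
    have "[hval r = hval (snd r, fst r)] (mod int m)"
      using hval_cong d decomposition_swap unfolding P0 by blast
    also have keys: "pkey (fst r) = pkey (snd r)" using d r(1) by (simp add: decomposition_def)
    then have "pval (snd r, fst r) = - pval r" using r(2) by (simp add: pval_def pkey_def)
    then have "hval (snd r, fst r) = - hval r" using pval_hval[OF keys] pval_hval[of "(snd r, fst r)"] keys by simp
    finally have "int m dvd 2 * hval r" by (simp add: cong_iff_dvd_diff)
    moreover have "[2 * hval r = 2 * a] (mod int m)" using r(3) by (rule cong_scalar_left)
    ultimately show ?thesis using cong_dvd_iff by blast
  qed
  note filters = two_valued_filter[OF tv]
  define A where "A = {#p\<in>#P. [hval p = a] (mod int m)#}"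
  define B where "B = {#p\<in>#P. \<not> [hval p = a] (mod int m)#}"
  have "coprime (a - b) (int m)" using tv by (simp add: two_valued_def)
  from coprime_residues_distinct[OF this m2] have Beq: "B = {#p\<in>#P. [hval p = b] (mod int m)#}"
    unfolding B_def using filters(3) by (intro filter_mset_cong) (auto simp: cong_def)
  have PAB: "P = A + B" unfolding A_def B_def by simp
  have "r \<in># A" using r by (simp add: A_def)
  then obtain A0 where A0: "A = add_mset r A0" by (meson multi_member_split)
  have szA0: "size A0 = m - 2" using filters(1) A0 by (simp add: A_def)
  have "m - 3 \<le> size A0" using szA0 by simp
  then obtain A1 where A1: "A1 \<subseteq># A0" "size A1 = m - 3" by (rule ex_subset_size)
  have szB: "size B = m - 1" using filters(2) Beq by simp
  have "2 \<le> size B" using szB m3 by simp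
  then obtain B1 where B1: "B1 \<subseteq># B" "size B1 = 2" by (rule ex_subset_size)
  then obtain s1 s2 where s: "B1 = {#s1, s2#}" using size_2_mset by blast
  have bb: "[hval s1 = b] (mod int m)" "[hval s2 = b] (mod int m)" using B1 s unfolding Beq by (auto dest: mset_subset_eqD)
  define P1 where "P1 = add_mset r A1 + {#s2#}"
  have sub: "P1 + {#s1#} \<subseteq># P"
  proof -
    have "add_mset r A1 + {#s1, s2#} \<subseteq># A + B" unfolding A0 using A1(1) B1(1) s by (intro subset_mset.add_mono) auto
    then show ?thesis unfolding P1_def PAB by (simp add: add_mset_commute)
  qed
  have "\<not> int m dvd hsum P1 - hsum {#s1#}"
  proof (rule no_signed)
    show "pairing (P1 + {#s1#})" using pairing_mono[OF decomposition_pairing[OF d] sub] .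
    show "size P1 + size {#s1#} = m" using A1 m3 by (simp add: P1_def)
    show "\<exists>p\<in>#P1 + {#s1#}. fst (fst p)" using r(2) by (auto simp: P1_def)
  qed
  moreover have "[hsum P1 - hsum {#s1#} = int (m - 2) * a] (mod int m)"
  proof -
    have "[hsum (add_mset r A1) = (\<Sum>p\<in>#add_mset r A1. a)] (mod int m)"
    proof (rule cong_sum_mset)
      fix p assume "p \<in># add_mset r A1"
      then have "p \<in># A" using A1(1) A0 by (auto dest: mset_subset_eqD)
      then show "[hval p = a] (mod int m)" by (simp add: A_def)
    qed
    moreover have "(\<Sum>p\<in>#add_mset r A1. a) = int (m - 2) * a" using A1(2) m3 by (simp add: of_nat_diff algebra_simps)
    ultimately have "[hsum (add_mset r A1) + hval s2 - hval s1 = int (m - 2) * a + b - b] (mod int m)"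
      using bb by (intro cong_add cong_diff) auto
    then show ?thesis by (simp add: P1_def algebra_simps)
  qed
  moreover have "int m dvd int (m - 2) * a"
  proof -
    have "int (m - 2) * a = int m * a - 2 * a" using m2 by (simp add: of_nat_diff algebra_simps)
    then show ?thesis using twice by simp
  qed
  ultimately show False using cong_dvd_iff by blast
qed

lemma two_valued_commute: "two_valued n i i a b V \<Longrightarrow> two_valued n i i b a V"
  unfolding two_valued_def by (metis coprime_minus_left_iff minus_diff_eq union_commute)

lemma no_reflection_pair:
  assumes "m \<ge> 3" "decomposition P L" "r \<in># P"
  shows "\<not> fst (fst r)"
proof
  assume r: "fst (fst r)"
  obtain a b where tv: "two_valued m (m - 1) (m - 1) a b (image_mset hval P)"
    using decomposition_two_valued[OF assms(2)] .
  from two_valued_filter(3)[OF this assms(3)] show False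
    using no_reflection_pair_aux[OF assms(1,2) tv assms(3) r]
      no_reflection_pair_aux[OF assms(1,2) two_valued_commute[OF tv] assms(3) r] by blast
qed

end

text \<open>The numbers t + id for 0 \<le> i < m run through all residues. If 0 is missed up to i =
  m-2, it is reached at i = m-1, where t + (m-1)d is congruent to t - d.\<close>

lemma missing_multiple:
  assumes "coprime d (int m)" "m \<ge> 2" "\<And>i. i \<le> m - 2 \<Longrightarrow> \<not> int m dvd t + int i * d"
  shows "[t = d] (mod int m)"
proof -
  obtain u where u: "[d * u = 1] (mod int m)" using assms(1) by (meson cong_solve_coprime_int)
  define k where "k = nat ((- t * u) mod int m)"
  have k: "int k = (- t * u) mod int m" using assms(2) by (simp add: k_def)
  have "[int k * d = (- t * u) * d] (mod int m)"
    unfolding k by (rule cong_scalar_right) simp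
  also have "(- t * u) * d = - t * (d * u)" by simp
  also have "[- t * (d * u) = - t * 1] (mod int m)" using u by (rule cong_scalar_left)
  finally have kd: "int m dvd t + int k * d" by (simp add: cong_iff_dvd_diff algebra_simps)
  have "int k < int m" using k assms(2) by simp
  moreover have "\<not> k \<le> m - 2" using assms(3) kd by blast
  ultimately have "k = m - 1" using assms(2) by linarith
  then have "t + int k * d = (t - d) + int m * d" using assms(2) by (simp add: of_nat_diff algebra_simps)
  then have "int m dvd (t - d) + int m * d" using kd by metis
  then show ?thesis unfolding cong_iff_dvd_diff by (simp only: dvd_add_left_iff[OF dvd_triv_left])
qed

lemma subset_filters:
  assumes "A \<subseteq># {#x\<in>#P. Q x#}" "B \<subseteq># {#x\<in>#P. \<not> Q x#}"
  shows "A + B \<subseteq># P"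
  using subset_mset.add_mono[OF assms] by simp

section \<open>The terms left over by the pairing\<close>

context even_counterexample
begin

text \<open>The pairs contain no reflections, so at least two of the three leftover terms are
  reflections. As keys differ, they have different parity, and there is no room for a third
  one.\<close>

lemma leftover_form:
  assumes d: "decomposition P L" and P: "\<And>p. p \<in># P \<Longrightarrow> \<not> fst (fst p)"
  obtains y y' z where "L = {#(True, y), (True, y'), (False, z)#}" "odd (y - y')"
proof -
  have S: "S = elts P + L" and keys: "\<And>k. count (image_mset pkey L) k \<le> 1" using d by (auto simp: decomposition_def)
  have hom: "homog P" using decomposition_pairing[OF d] pairing_homog by blast
  have "refls (elts P) = {#}"
  proof (rule filter_mset_none)
    fix x assume "x \<in># elts P"
    then obtain p where "p \<in># P" "x = fst p \<or> x = snd p" by (auto simp: elts_def)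
    then show "\<not> fst x" using P[of p] hom by (auto simp: homog_def)
  qed
  then have "refls S = refls L" by (subst S) simp
  then have "2 \<le> size (refls L)" using reflections by simp
  then obtain Y where Y: "Y \<subseteq># refls L" "size Y = 2" by (rule ex_subset_size)
  then obtain a b where ab: "Y = {#a, b#}" using size_2_mset by blast
  then have "{#a, b#} \<subseteq># L" using Y(1) by (meson multiset_filter_subset subset_mset.order_trans)
  then obtain C where C: "L = {#a, b#} + C" by (auto simp: subset_mset.le_iff_add)
  have "size C = 1" using decomposition_sizes(2)[OF d] C by simp
  then obtain c where c: "C = {#c#}" using size_1_singleton_mset by blast
  have fab: "fst a" "fst b" using Y(1) ab by (auto dest: mset_subset_eqD)
  have "pkey a \<noteq> pkey b" "pkey a \<noteq> pkey c" "pkey b \<noteq> pkey c"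
    by (rule count_le_1_distinct[OF keys]; simp add: C c)+
  then have "\<not> fst c" "odd (snd a - snd b)" using fab by (auto simp: pkey_def)
  moreover have "a = (True, snd a)" "b = (True, snd b)" using fab by (simp_all add: prod_eq_iff)
  moreover have "c = (False, snd c)" using \<open>\<not> fst c\<close> by (simp add: prod_eq_iff)
  ultimately show ?thesis using that[of "snd a" "snd b" "snd c"] C c by (metis add_mset_add_single union_mset_add_mset_left add_mset_commute empty_neutral(1))
qed

text \<open>Together with the leftover terms, \<open>m - 2\<close> pairs realise \<open>m - 1\<close> values in arithmetic
  progression that all avoid \<open>0\<close>. This determines the value contributed by the leftover terms,
  although \<open>z\<close> and \<open>x\<close> may enter with either sign.\<close>

lemma leftover_divisible:
  assumes d: "decomposition (add_mset p P) {#(True, y), (True, y'), (False, z)#}"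
    and odd: "odd (y - y')" and p: "\<not> fst (fst p)" "even (snd (fst p)) \<noteq> even z"
  shows "int m dvd z" "int m dvd snd (fst p)"
proof -
  define x where "x = snd (fst p)"
  have fp: "fst p = (False, x)" using p(1) by (simp add: prod_eq_iff x_def)
  obtain a b where tv: "two_valued m (m - 1) (m - 1) a b (image_mset hval (add_mset p P))"
    using decomposition_two_valued[OF d] .
  note filters = two_valued_filter[OF tv]
  have cop: "coprime (a - b) (int m)" using tv by (simp add: two_valued_def)
  have ne: "\<not> [a = b] (mod int m)" using coprime_residues_distinct[OF cop m2] by (simp add: cong_def)
  have Beq: "{#q\<in>#P. [hval q = b] (mod int m)#} = {#q\<in>#P. \<not> [hval q = a] (mod int m)#}"
  proof (rule filter_mset_cong)
    fix q assume "q \<in># P"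
    then show "[hval q = b] (mod int m) \<longleftrightarrow> \<not> [hval q = a] (mod int m)"
      using filters(3)[of q] ne by (auto intro: cong_trans cong_sym)
  qed simp
  have szA: "m - 2 \<le> size {#q\<in>#P. [hval q = a] (mod int m)#}" using filters(1) by (auto split: if_splits)
  have szB: "m - 2 \<le> size {#q\<in>#P. \<not> [hval q = a] (mod int m)#}"
    using filters(2) unfolding Beq[symmetric] by (auto split: if_splits)
  have hP: "pairing P" using decomposition_pairing[OF d] pairing_mono by (metis mset_subset_eq_add_mset_cancel mset_subset_eq_add_right add_mset_add_single union_commute mset_subset_eq_add_left)
  have no: "\<not> int (2 * m) dvd (y - y' + s * z + t * x) + 2 * (int i * a + int (m - 2 - i) * b)"
    if i: "i \<le> m - 2" and s: "s = 1 \<or> s = -1" and t: "t = 1 \<or> t = -1" for i s t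
  proof
    assume dvd: "int (2 * m) dvd (y - y' + s * z + t * x) + 2 * (int i * a + int (m - 2 - i) * b)"
    have "i \<le> size {#q\<in>#P. [hval q = a] (mod int m)#}" using i szA by linarith
    then obtain A where A: "A \<subseteq># {#q\<in>#P. [hval q = a] (mod int m)#}" "size A = i" by (rule ex_subset_size)
    have "m - 2 - i \<le> size {#q\<in>#P. \<not> [hval q = a] (mod int m)#}" using szB by linarith
    then obtain B where B: "B \<subseteq># {#q\<in>#P. \<not> [hval q = a] (mod int m)#}" "size B = m - 2 - i" by (rule ex_subset_size)
    have AB: "A + B \<subseteq># P" using subset_filters[OF A(1) B(1)] .
    \<comment> \<open>Besides the leftover terms one term x of \<open>p\<close> is taken: the
      exponents y-y' and x+z are odd, so the total is even, and m-2 pairs complete these four terms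
      to length 2m.\<close>
    define T0 where "T0 = {#(False, x), (False, z), (True, y), (True, y')#}"
    have 1: "dval {#(False, z), (True, y), (True, y')#} (y - y' + s * z)"
      using s dval_insert_pos[OF dval_refl_pair[of y y'], of z] dval_insert_neg[OF dval_refl_pair[of y y'], of z] by auto
    have 2: "dval T0 (y - y' + s * z + t * x)"
      using t dval_insert_pos[OF 1, of x] dval_insert_neg[OF 1, of x] unfolding T0_def by auto
    have pAB: "pairing (A + B)" using pairing_mono[OF hP AB] .
    have 3: "dval (elts (A + B) + T0) (y - y' + s * z + t * x + 2 * hsum (A + B))"
      using dval_add_elts[OF pairing_homog[OF pAB] 2] pairing_sum[OF pAB] by simp
    have "[hsum A = (\<Sum>q\<in>#A. a)] (mod int m)"
      by (rule cong_sum_mset) (use A(1) in \<open>auto dest: mset_subset_eqD\<close>)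
    moreover have "[hsum B = (\<Sum>q\<in>#B. b)] (mod int m)"
      by (rule cong_sum_mset) (use B(1) Beq[symmetric] in \<open>auto dest: mset_subset_eqD\<close>)
    ultimately have "[hsum A + hsum B = (\<Sum>q\<in>#A. a) + (\<Sum>q\<in>#B. b)] (mod int m)"
      by (rule cong_add)
    then have "int m dvd hsum (A + B) - (int i * a + int (m - 2 - i) * b)"
      using A(2) B(2) by (simp add: cong_iff_dvd_diff)
    then have "int (2 * m) dvd 2 * hsum (A + B) - 2 * (int i * a + int (m - 2 - i) * b)" by (rule double_dvd)
    from dvd_add[OF this dvd]
    have "int (2 * m) dvd y - y' + s * z + t * x + 2 * hsum (A + B)" by (simp add: algebra_simps)
    moreover have "elts (A + B) + T0 \<subseteq># S"
    proof -
      have "S = elts P + {#fst p, snd p, (True, y), (True, y'), (False, z)#}" using d by (simp add: decomposition_def ac_simps)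
      moreover have "T0 \<subseteq># {#fst p, snd p, (True, y), (True, y'), (False, z)#}" unfolding T0_def fp by (simp add: add_mset_commute)
      ultimately show ?thesis using subset_mset.add_mono[OF elts_mono[OF AB]] by metis
    qed
    moreover have "size (elts (A + B) + T0) = 2 * m" using A(2) B(2) i m2 by (simp add: T0_def)
    ultimately show False using none 3 unfolding pone_def by blast
  qed
  \<comment> \<open>Writing ia + (m-2-i)b as (m-2)b + i(a-b) gives the progression of
    \<open>missing_multiple\<close>. The residue a-b it returns does not depend on the
    signs.\<close>
  have half: "[h + int (m - 2) * b = a - b] (mod int m)"
    if s: "s = 1 \<or> s = -1" and t: "t = 1 \<or> t = -1" and h: "2 * h = y - y' + s * z + t * x" for s t h
  proof (rule missing_multiple[OF cop m2])
    fix i assume i: "i \<le> m - 2"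
    show "\<not> int m dvd h + int (m - 2) * b + int i * (a - b)"
    proof
      assume "int m dvd h + int (m - 2) * b + int i * (a - b)"
      then have "int m dvd (h + int (m - 2) * b + int i * (a - b)) - 0" by simp
      from double_dvd[OF this] have "int (2 * m) dvd 2 * (h + int (m - 2) * b + int i * (a - b))" by (simp only: diff_zero mult_zero_right)
      moreover have "int (m - 2 - i) = int (m - 2) - int i" using i by simp
      then have "2 * (h + int (m - 2) * b + int i * (a - b)) = 2 * h + 2 * (int i * a + int (m - 2 - i) * b)"
        by (simp only:) (simp add: algebra_simps)
      ultimately have "int (2 * m) dvd 2 * h + 2 * (int i * a + int (m - 2 - i) * b)" by metis
      then show False using no[OF i s t] h by simp
    qed
  qed
  have pm: "2 * ((y - y' + s * z + t * x) div 2) = y - y' + s * z + t * x"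
    if s: "s = 1 \<or> s = -1" and t: "t = 1 \<or> t = -1" for s t
  proof -
    have "even (y - y' + s * z + t * x)" using odd p(2) s t unfolding x_def by auto
    then show ?thesis by simp
  qed
  define h where "h s t = (y - y' + s * z + t * x) div 2" for s t
  have hh: "[h s t = h s' t'] (mod int m)" if "s = 1 \<or> s = -1" "t = 1 \<or> t = -1" "s' = 1 \<or> s' = -1" "t' = 1 \<or> t' = -1" for s t s' t'
  proof -
    have "[h s t + int (m - 2) * b = h s' t' + int (m - 2) * b] (mod int m)"
      using half[OF that(1,2), of "h s t"] half[OF that(3,4), of "h s' t'"] pm[OF that(1,2)] pm[OF that(3,4)]
      unfolding h_def by (meson cong_sym cong_trans)
    then show ?thesis by (simp add: cong_add_rcancel)
  qed
  \<comment> \<open>All four values of \<open>h\<close> are congruent modulo m, and flipping one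
    sign changes \<open>h\<close> by z or by x.\<close>
  have "h 1 1 - h (-1) 1 = z" "h 1 1 - h 1 (-1) = x"
    using pm[of 1 1] pm[of "-1" 1] pm[of 1 "-1"] unfolding h_def by (simp_all)
  then show "int m dvd z" "int m dvd snd (fst p)"
    using hh[of 1 1 "-1" 1] hh[of 1 1 1 "-1"] by (simp_all add: cong_iff_dvd_diff x_def)
qed

text \<open>All pairs are rotations and the leftover is y, y', z. If a pair has the parity opposite
  to z, \<open>leftover_divisible\<close> makes z and its terms multiples of m, so m is odd.
  Exchanging z with terms of the remaining pairs shows the same for these, and all half values
  vanish modulo m. Otherwise all pairs share the key of z and have half value z by
  \<open>hval_leftover\<close>. An extremal sequence allows neither.\<close>

lemma m_not_ge_3: "\<not> m \<ge> 3"
proof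
  assume m3: "m \<ge> 3"
  obtain P L where d: "decomposition P L" by (rule ex_decomposition)
  have rot: "\<not> fst (fst p)" if "p \<in># P" for p using no_reflection_pair[OF m3 d that] .
  have keys: "pkey (fst p) = pkey (snd p)" if "p \<in># P" for p using d that by (simp add: decomposition_def)
  obtain y y' z where L: "L = {#(True, y), (True, y'), (False, z)#}" "odd (y - y')"
    using leftover_form[OF d rot] .
  show False
  proof (cases "\<exists>p\<in>#P. even (snd (fst p)) \<noteq> even z")
    case True
    then obtain p0 where p0: "p0 \<in># P" "even (snd (fst p0)) \<noteq> even z" by blast
    have div: "int m dvd z" "int m dvd snd (fst q)" "int m dvd snd (snd q)"
      if q: "q \<in># P" "even (snd (fst q)) \<noteq> even z" for q
    proof -
      obtain Q where Q: "P = add_mset q Q" using q(1) by (meson multi_member_split)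
      show "int m dvd z" "int m dvd snd (fst q)"
        using leftover_divisible[OF d[unfolded Q L(1)] L(2) rot[OF q(1)] q(2)] .
      show "int m dvd snd (snd q)"
        using leftover_divisible(2)[OF decomposition_swap[OF d[unfolded Q L(1)]] L(2)] rot[OF q(1)] q keys[OF q(1)]
        by (simp add: pkey_def)
    qed
    have "odd m"
    proof
      assume "even m"
      then have "even z" "even (snd (fst p0))" using div(1,2)[OF p0] by (auto intro: dvd_trans[of 2 "int m"])
      then show False using p0(2) by simp
    qed
    have same: "int m dvd snd (fst q)" if d': "decomposition (add_mset q Q) L" and q: "p0 \<in># Q" "\<not> fst (fst q)" "even (snd (fst q)) = even z" for q Q
    proof -
      obtain Q' where Q': "Q = add_mset p0 Q'" using q(1) by (meson multi_member_split)
      have "decomposition (add_mset q Q) (add_mset (False, z) {#(True, y), (True, y')#})"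
        using d' L(1) by (simp add: add_mset_commute)
      from decomposition_exchange[OF this] have "decomposition (add_mset ((False, z), snd q) Q) (add_mset (fst q) {#(True, y), (True, y')#})"
        using q by (simp add: pkey_def)
      moreover have "fst q = (False, snd (fst q))" using q(2) by (simp add: prod_eq_iff)
      ultimately have "decomposition (add_mset p0 (add_mset ((False, z), snd q) Q')) {#(True, y), (True, y'), (False, snd (fst q))#}"
        unfolding Q' by (metis add_mset_commute)
      from leftover_divisible(1)[OF this L(2) rot[OF p0(1)]] show ?thesis using p0(2) q(3) by simp
    qed
    have all: "[hval q = 0] (mod int m)" if q: "q \<in># P" for q
    proof -
      have "int m dvd snd (fst q) \<and> int m dvd snd (snd q)"
      proof (cases "even (snd (fst q)) = even z")
        case True
        obtain Q where Q: "P = add_mset q Q" using q by (meson multi_member_split)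
        have pQ: "p0 \<in># Q" using p0 True Q by auto
        have "int m dvd snd (fst q)" using same[OF d[unfolded Q] pQ rot[OF q] True] .
        moreover have "int m dvd snd (fst (snd q, fst q))"
          using same[OF decomposition_swap[OF d[unfolded Q]] pQ] rot[OF q] True keys[OF q] by (simp add: pkey_def)
        ultimately show ?thesis by simp
      qed (use div q in blast)
      then have "int m dvd pval q" using rot[OF q] by (simp add: pval_def)
      then have "int m dvd 2 * hval q" using pval_hval[OF keys[OF q]] by simp
      moreover have "coprime (int m) 2" using \<open>odd m\<close> by simp
      ultimately show ?thesis by (simp add: cong_0_iff coprime_dvd_mult_right_iff)
    qed
    show False using not_all_equal[OF d all] .
  next
    case False
    have "[hval q = z] (mod int m)" if q: "q \<in># P" for q
    proof -
      obtain Q where Q: "P = add_mset q Q" using q by (meson multi_member_split)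
      have "decomposition (add_mset q Q) (add_mset (False, z) {#(True, y), (True, y')#})"
        using d Q L(1) by (simp add: add_mset_commute)
      from hval_leftover[OF this] show ?thesis using rot[OF q] False q by (auto simp: pkey_def)
    qed
    then show False using not_all_equal[OF d] by blast
  qed
qed

text \<open>One of e, f is odd. Flipping its sign changes the even exponent by 2 modulo 4, so one of
  the two signs gives a multiple of 4.\<close>

lemma four_classes:
  assumes m: "m = 2" and sub: "{#(False, e), (False, f), (True, y), (True, y')#} \<subseteq># S" "odd (e - f)" "odd (y - y')"
  shows False
proof -
  have 0: "dval {#(False, f), (True, y), (True, y')#} (y - y' + f)" "dval {#(False, f), (True, y), (True, y')#} (y - y' - f)"
    using dval_insert_pos[OF dval_refl_pair] dval_insert_neg[OF dval_refl_pair] by auto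
  have 1: "dval {#(False, e), (False, f), (True, y), (True, y')#} (y - y' + f + e)"
    "dval {#(False, e), (False, f), (True, y), (True, y')#} (y - y' - f + e)"
    "dval {#(False, e), (False, f), (True, y), (True, y')#} (y - y' + f - e)"
    using dval_insert_pos[OF 0(1), of e] dval_insert_pos[OF 0(2), of e] dval_insert_neg[OF 0(1), of e] by auto
  have "4 dvd y - y' + f + e \<or> 4 dvd y - y' - f + e \<or> 4 dvd y - y' + f - e" using sub(2,3) by presburger
  then have "pone 4 4 S" unfolding pone_def
    by (intro exI[of _ "{#(False, e), (False, f), (True, y), (True, y')#}"]) (use 1 sub(1) in auto)
  then show False using none m by simp
qed

text \<open>There are two pairs and three leftover terms. A pair whose key is not left over would
  supply all four keys for \<open>four_classes\<close>, so \<open>hval_leftover\<close> determines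
  both values. They must differ. A reflection pair and a rotation pair multiply to one if the two
  congruent rotations enter with opposite signs. Two rotation pairs with different keys leave room
  for only one reflection.\<close>

lemma m_not_2: "m \<noteq> 2"
proof
  assume m: "m = 2"
  obtain P L where d: "decomposition P L" by (rule ex_decomposition)
  have S: "S = elts P + L" and keys: "\<And>k. count (image_mset pkey L) k \<le> 1"
    and pkeys: "\<And>p. p \<in># P \<Longrightarrow> pkey (fst p) = pkey (snd p)" using d by (auto simp: decomposition_def)
  note sizes = decomposition_sizes[OF d]
  have meet: "\<exists>l\<in>#L. pkey l = pkey (fst p)" if p: "p \<in># P" for p
  proof (rule ccontr)
    assume contr: "\<not> ?thesis"
    define L4 where "L4 = add_mset (fst p) L"
    have L4S: "L4 \<subseteq># S" using p unfolding L4_def S by (auto simp: elts_def dest!: multi_member_split)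
    have "count (image_mset pkey L) (pkey (fst p)) = 0" using contr by (auto simp: count_eq_zero_iff)
    then have k4: "count (image_mset pkey L4) k \<le> 1" for k using keys unfolding L4_def by auto
    have mem: "k \<in># image_mset pkey L4" for k
    proof (rule ccontr)
      assume k: "k \<notin># image_mset pkey L4"
      have "image_mset pkey L4 \<subseteq># mset_set (UNIV - {k})"
      proof (rule mset_subset_eqI)
        fix j show "count (image_mset pkey L4) j \<le> count (mset_set (UNIV - {k})) j"
        proof (cases "j = k")
          case True
          then have "count (image_mset pkey L4) j = 0" using k by (simp only: count_eq_zero_iff not_False_eq_True)
          then show ?thesis by simp
        next
          case False then show ?thesis using k4[of j] by (simp add: count_mset_set')
        qed
      qed
      from size_mset_mono[OF this] have "size L4 \<le> card (UNIV - {k} :: (bool \<times> bool) set)" by simp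
      also have "\<dots> = card (UNIV :: (bool \<times> bool) set) - 1" by (rule card_Diff_singleton) simp
      also have "card (UNIV :: (bool \<times> bool) set) = 4" by (rule card_bool_bool)
      finally show False using sizes by (simp add: L4_def)
    qed
    have ex: "\<exists>x. (b, x) \<in># L4 \<and> even x = c" for b c
      using mem[of "(b, c)"] by (auto simp: pkey_def)
    obtain e f y y' where efy: "(False, e) \<in># L4" "even e" "(False, f) \<in># L4" "odd f" "(True, y) \<in># L4" "even y" "(True, y') \<in># L4" "odd y'"
      using ex[of False True] ex[of False False] ex[of True True] ex[of True False] by auto
    then have "e \<noteq> f" "y \<noteq> y'" by auto
    then have "{#(False, e), (False, f), (True, y), (True, y')#} \<subseteq># L4"
      using efy by (auto simp: subseteq_mset_def Suc_le_eq)
    from four_classes[OF m subset_mset.order_trans[OF this L4S]] show False using efy by simp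
  qed
  have "size P = 2" using sizes m by simp
  then obtain p1 p2 where P: "P = {#p1, p2#}" using size_2_mset by blast
  obtain l1 l2 where l: "l1 \<in># L" "pkey l1 = pkey (fst p1)" "l2 \<in># L" "pkey l2 = pkey (fst p2)"
    using meet[of p1] meet[of p2] P by auto
  obtain L1 L2 where L12: "L = add_mset l1 L1" "L = add_mset l2 L2" using l by (meson multi_member_split)
  have d1: "decomposition (add_mset p1 {#p2#}) (add_mset l1 L1)" using d P L12 by simp
  have d2: "decomposition (add_mset p2 {#p1#}) (add_mset l2 L2)" using d P L12 by (simp add: add_mset_commute)
  note h1 = hval_leftover[OF d1 l(2)] and h2 = hval_leftover[OF d2 l(4)]
  note c1 = leftover_cong[OF d1 l(2)] leftover_cong_snd[OF d1 l(2)]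
  note c2 = leftover_cong[OF d2 l(4)] leftover_cong_snd[OF d2 l(4)]
  have mixed: False
    if "fst l1" "\<not> fst l2" "pkey l1 = pkey (fst p1)" "pkey l2 = pkey (fst p2)" "pkey (fst p1) = pkey (snd p1)" "pkey (fst p2) = pkey (snd p2)"
      and c: "[snd l1 = snd (fst p1)] (mod int (2 * m))" "[snd l1 = snd (snd p1)] (mod int (2 * m))"
        "[snd l2 = snd (fst p2)] (mod int (2 * m))" "[snd l2 = snd (snd p2)] (mod int (2 * m))"
      and sub: "{#fst p1, snd p1, fst p2, snd p2#} \<subseteq># S" for l1 l2 :: dih and p1 p2
  proof -
    have f: "fst p2 = (False, snd (fst p2))" "snd p2 = (False, snd (snd p2))" "fst (fst p1)" "fst (snd p1)"
      using that(1-6) by (auto simp: pkey_def prod_eq_iff)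
    have "dval {#fst p1, snd p1#} (snd (fst p1) - snd (snd p1))"
      using dval_pair[of p1] f by (simp add: pval_def)
    then have "dval {#snd p2, fst p1, snd p1#} (snd (fst p1) - snd (snd p1) - snd (snd p2))"
      using dval_insert_neg[of "{#fst p1, snd p1#}" _ "snd (snd p2)"] f by simp
    then have "dval {#fst p2, snd p2, fst p1, snd p1#} (snd (fst p1) - snd (snd p1) - snd (snd p2) + snd (fst p2))"
      using dval_insert_pos[of "{#snd p2, fst p1, snd p1#}" _ "snd (fst p2)"] f by simp
    moreover have "[snd (fst p1) - snd (snd p1) - snd (snd p2) + snd (fst p2) = snd l1 - snd l1 - snd l2 + snd l2] (mod int (2 * m))"
      using c by (intro cong_add cong_diff) (auto intro: cong_sym)
    then have "int (2 * m) dvd snd (fst p1) - snd (snd p1) - snd (snd p2) + snd (fst p2)" by (simp add: cong_0_iff)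
    moreover have "{#fst p2, snd p2, fst p1, snd p1#} \<subseteq># S" using sub by (simp add: add_mset_commute)
    moreover have "size {#fst p2, snd p2, fst p1, snd p1#} = 2 * m" using m by simp
    ultimately show False using none unfolding pone_def by blast
  qed
  have sub: "{#fst p1, snd p1, fst p2, snd p2#} \<subseteq># S" "{#fst p2, snd p2, fst p1, snd p1#} \<subseteq># S"
    unfolding S P by (simp_all add: add_mset_commute)
  have pk: "pkey (fst p1) = pkey (snd p1)" "pkey (fst p2) = pkey (snd p2)" using pkeys P by auto
  show False
  proof (cases "l1 = l2 \<or> fst l1 \<and> fst l2")
    case True
    show False
    proof (rule not_all_equal[OF d])
      fix p assume "p \<in># P"
      then show "[hval p = (if fst l1 then 0 else snd l1)] (mod int m)" using h1 h2 True P by auto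
    qed
  next
    case False
    consider "fst l1" "\<not> fst l2" | "\<not> fst l1" "fst l2" | "\<not> fst l1" "\<not> fst l2" using False by blast
    then show False
    proof cases
      case 1
      show False using mixed[OF 1 l(2,4) pk c1 c2 sub(1)] .
    next
      case 2
      show False using mixed[OF 2(2,1) l(4,2) pk(2,1) c2 c1 sub(2)] .
    next
      case 3
      have "l2 \<in># L1" using False L12 by (metis insert_noteq_member)
      then obtain L3 where L3: "L1 = add_mset l2 L3" by (meson multi_member_split)
      have "size L3 = 1" using sizes L12(1) L3 by simp
      then have "size (refls L3) \<le> 1" by (metis size_filter_mset_lesseq)
      moreover have "refls S = refls L3"
        using 3 l(2,4) pk unfolding S P L12(1) L3 by (simp add: pkey_def)
      ultimately show False using reflections by simp
    qed
  qed
qed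

lemma contradiction: False
  using m2 m_not_ge_3 m_not_2 by linarith

end

theorem pone_even:
  assumes "m \<ge> 2" "size S = 4 * m - 1" "size (refls S) \<ge> 2"
  shows "pone (2 * m) (2 * m) S"
proof (rule ccontr)
  assume "\<not> ?thesis"
  then interpret even_counterexample m S using assms by unfold_locales auto
  show False by (rule contradiction)
qed

section \<open>Sequences of length \<open>3n - 1\<close> for odd \<open>n\<close>\<close>

lemma egz_multiple:
  assumes "n > 0" "size M \<ge> n * k + n - 1" shows "zero_sum n (n * k) M"
proof -
  obtain Bs where "size Bs = k" "\<Sum>\<^sub># Bs \<subseteq># M" "blocks n Bs"
    using extract_blocks[of n k M] egz[of n] assms by auto
  then show ?thesis using size_Union_blocks blocks_sum unfolding zero_sum_def by (metis dvd_triv_left)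
qed

lemma size_filter_image: "size {#x \<in># image_mset f P. Q x#} = size {#p \<in># P. Q (f p)#}"
  by (induction P) auto

lemma full_residues:
  fixes R :: "int multiset"
  assumes "size R = n" "\<And>c. count (residues n R) c \<le> 1"
  shows "residues n R = mset_set {0..<int n}"
proof (cases "n = 0")
  case False
  have "residues n R \<subseteq># mset_set {0..<int n}"
  proof (rule mset_subset_eqI)
    fix c
    show "count (residues n R) c \<le> count (mset_set {0..<int n}) c"
    proof (cases "c \<in> {0..<int n}")
      case True then show ?thesis using assms(2)[of c] by simp
    next
      case c: False
      have "c \<notin># residues n R"
      proof
        assume "c \<in># residues n R"
        then obtain x where "c = x mod int n" by auto
        then show False using c False by simp
      qed
      then have "count (residues n R) c = 0" by (simp only: count_eq_zero_iff not_False_eq_True)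
      then show ?thesis by simp
    qed
  qed
  then obtain C where C: "mset_set {0..<int n} = residues n R + C" by (auto simp: subset_mset.le_iff_add)
  have "size C = 0" using arg_cong[OF C, of size] assms(1) by simp
  then show ?thesis using C by simp
qed (use assms in simp)

lemma count_ge_2E:
  assumes "count (image_mset f R) c \<ge> 2"
  obtains a b where "{#a, b#} \<subseteq># R" "f a = c" "f b = c"
proof -
  have "2 \<le> size {#x\<in>#R. f x = c#}" using assms by (simp add: size_filter_eq_count)
  then obtain Y where Y: "Y \<subseteq># {#x\<in>#R. f x = c#}" "size Y = 2" by (rule ex_subset_size)
  then obtain a b where ab: "Y = {#a, b#}" using size_2_mset by blast
  then have "{#a, b#} \<subseteq># R" using Y(1) by (meson multiset_filter_subset subset_mset.order_trans)
  moreover have "f a = c" "f b = c" using Y(1) ab by (auto dest: mset_subset_eqD)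
  ultimately show ?thesis using that by blast
qed

lemma sum_mset_two_diffs:
  fixes f :: "'a \<Rightarrow> int"
  shows "(\<Sum>x\<in>#B - A. f x) - (\<Sum>x\<in>#A - B. f x) = (\<Sum>x\<in>#B. f x) - (\<Sum>x\<in>#A. f x)"
proof -
  have "B = (B - A) + (A \<inter># B)" "A = (A - B) + (A \<inter># B)" by (auto simp: multiset_eq_iff min_def)
  then have "(\<Sum>x\<in>#B. f x) = (\<Sum>x\<in>#B - A. f x) + (\<Sum>x\<in>#A \<inter># B. f x)"
    "(\<Sum>x\<in>#A. f x) = (\<Sum>x\<in>#A - B. f x) + (\<Sum>x\<in>#A \<inter># B. f x)"
    by (metis image_mset_union sum_mset.union)+
  then show ?thesis by simp
qed

lemma filter_mset_all: "(\<And>x. x \<in># R \<Longrightarrow> P x) \<Longrightarrow> filter_mset P R = R"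
  by (induction R) auto

text \<open>Unlike the even case these assumptions are consistent: the exceptional sequence for n =
  3 satisfies them, and \<open>exceptional_structure\<close> shows that nothing else does.\<close>

locale odd_counterexample =
  fixes n :: nat and S :: "dih multiset"
  assumes n3: "n \<ge> 3" and odd_n: "odd n" and size_S: "size S = 3 * n - 1"
    and reflections: "size (refls S) \<ge> 2"
    and none: "\<not> pone n (2 * n) S"
begin

definition decomposition :: "(dih \<times> dih) multiset \<Rightarrow> dih multiset \<Rightarrow> bool" where
  "decomposition P L \<longleftrightarrow> S = elts P + L \<and> homog P \<and> (\<forall>b. count (image_mset fst L) b \<le> 1)"

abbreviation zero_pair :: "dih \<times> dih \<Rightarrow> bool" where
  "zero_pair p \<equiv> int n dvd pval p"

lemma no_sum:
  assumes "homog P" "elts P \<subseteq># S" "size P = n" shows "\<not> int n dvd psum P"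
  using dval_elts[OF assms(1)] assms(2,3) none unfolding pone_def by (metis elts_simps(4))

lemma no_signed:
  assumes "homog (P + Q)" "elts (P + Q) \<subseteq># S" "size P + size Q = n" "\<exists>p\<in>#P + Q. fst (fst p)"
  shows "\<not> int n dvd psum P - psum Q"
  using dval_signed[OF assms(1,4)] assms(2,3) none unfolding pone_def by (metis elts_simps(4) size_union)

lemma odd_dvd_double: "d dvd n \<Longrightarrow> int d dvd 2 * k \<longleftrightarrow> int d dvd k"
proof -
  assume "d dvd n"
  then have "coprime (int d) 2" using odd_n by (auto dest: dvd_trans)
  then show ?thesis by (simp add: coprime_dvd_mult_right_iff)
qed

lemma ex_decomposition: obtains P L where "decomposition P L"
proof -
  obtain P L where "S = elts P + L" "\<And>p. p \<in># P \<Longrightarrow> fst (fst p) = fst (snd p)" "\<And>b. count (image_mset fst L) b \<le> 1"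
    using pair_up[of S fst] by blast
  then show ?thesis using that unfolding decomposition_def homog_def by blast
qed

lemma size_L: assumes "decomposition P L" shows "size L \<le> 2"
proof -
  have "size (image_mset fst L) \<le> card (UNIV :: bool set)"
    by (rule size_le_card_UNIV) (use assms in \<open>auto simp: decomposition_def\<close>)
  then show ?thesis by (simp add: UNIV_bool)
qed

lemma sizes:
  assumes "decomposition P L" shows "2 * size P + size L = 3 * n - 1" "2 * size P \<ge> 3 * n - 3"
proof -
  have "size S = 2 * size P + size L" using assms by (simp add: decomposition_def)
  then show "2 * size P + size L = 3 * n - 1" using size_S by simp
  then show "2 * size P \<ge> 3 * n - 3" using size_L[OF assms] by linarith
qed

text \<open>Only one reflection can be left over, but \<open>S\<close> has at least two. The pair
  found here is what makes signs available.\<close>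

lemma ex_reflection_pair:
  assumes "decomposition P L" obtains r where "r \<in># P" "fst (fst r)"
proof -
  have "size (refls L) \<le> 1"
    using assms size_filter_eq_count[where g=fst and P=L and c=True] by (simp add: decomposition_def)
  moreover have "size (refls S) = size (refls (elts P)) + size (refls L)"
    using assms by (simp add: decomposition_def)
  ultimately have "size (refls (elts P)) \<noteq> 0" using reflections by linarith
  then obtain x where "x \<in># elts P" "fst x" by (metis filter_mset_none size_empty)
  then obtain p where "p \<in># P" "x = fst p \<or> x = snd p" by (auto simp: elts_def)
  moreover from this have "fst (fst p)" using \<open>fst x\<close> assms unfolding decomposition_def homog_def by auto
  ultimately show ?thesis using that by blast
qed

lemma sub_pairs:
  assumes "decomposition P L" "Q \<subseteq># P" shows "homog Q" "elts Q \<subseteq># S"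
proof -
  show "homog Q" using assms homog_mono by (auto simp: decomposition_def)
  have "elts Q \<subseteq># elts P" using assms(2) by (rule elts_mono)
  also have "elts P \<subseteq># S" using assms(1) by (simp add: decomposition_def)
  finally show "elts Q \<subseteq># S" .
qed

text \<open>If the subset sums of at most n-1 pair values covered all residues, add a reflection
  pair and extend to n pairs \<open>Z\<close>. Giving a subset \<open>J1\<close> negative signs
  changes the exponent to \<open>psum Z - 2 * psum J1\<close>, so a \<open>J1\<close> with sum half
  of \<open>psum Z\<close> yields product one. Hence a hypothesis of
  \<open>subset_sums_cover\<close> fails.\<close>

lemma no_cover:
  assumes d: "decomposition P L"
  shows "\<exists>d. d dvd n \<and> d > 1 \<and> size {#p\<in>#P. \<not> int d dvd pval p#} < d - 1"
proof (rule ccontr)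
  assume "\<not> ?thesis"
  then have cond: "d - 1 \<le> size {#x\<in>#image_mset pval P. \<not> int d dvd x#}" if "d dvd n" "d > 1" for d
    using that unfolding size_filter_image by (meson not_less)
  obtain Y where Y: "Y \<subseteq># image_mset pval P" "size Y \<le> n - 1" "\<And>t. t \<in> subsums n Y"
    by (rule subset_sums_cover[of n "image_mset pval P"]) (use n3 cond in auto)
  obtain Y1 where Y1: "Y1 \<subseteq># P" "Y = image_mset pval Y1" using subset_image_msetE[OF Y(1)] .
  obtain r where r: "r \<in># P" "fst (fst r)" using ex_reflection_pair[OF d] .
  obtain Y2 where Y2: "Y1 \<subseteq># Y2" "Y2 \<subseteq># P" "r \<in># Y2" "size Y2 \<le> n"
  proof (cases "r \<in># Y1")
    case True
    then show ?thesis using that[of Y1] Y1 Y(2) by simp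
  next
    case False
    have "r \<in># P - Y1" using r(1) False by (simp add: in_diff_count not_in_iff)
    then have "add_mset r Y1 \<subseteq># P" using Y1(1) by (auto simp: subset_mset.le_iff_add dest!: multi_member_split)
    moreover have "size (add_mset r Y1) \<le> n" using Y(2) Y1(2) n3 by simp
    ultimately show ?thesis using that[of "add_mset r Y1"] by simp
  qed
  have "n \<le> size P" using sizes(2)[OF d] n3 by linarith
  then obtain Z where Z: "Y2 \<subseteq># Z" "Z \<subseteq># P" "size Z = n"
    using ex_subset_size_between[OF Y2(2,4)] by metis
  obtain h where h: "n = 2 * h + 1" using odd_n by (rule oddE)
  \<comment> \<open>For n = 2h + 1 the inverse of 2 modulo n is h + 1.\<close>
  define t where "t = psum Z * int (h + 1)"
  obtain J where J: "J \<subseteq># Y" "[\<Sum>\<^sub># J = t] (mod int n)" using Y(3) unfolding subsums_def by blast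
  obtain J1 where J1: "J1 \<subseteq># Y1" "J = image_mset pval J1" using subset_image_msetE[OF J(1)[unfolded Y1(2)]] .
  have J1Z: "J1 \<subseteq># Z" using J1(1) Y2(1) Z(1) by (meson subset_mset.order_trans)
  then have ZJ: "Z - J1 + J1 = Z" by simp
  have "size (Z - J1) + size J1 = n" using ZJ Z(3) by (metis size_union)
  then have no: "\<not> int n dvd psum (Z - J1) - psum J1"
    using no_signed[of "Z - J1" J1] unfolding ZJ using sub_pairs[OF d Z(2)] r(2) Y2(3) Z(1) by (meson mset_subset_eqD)
  have "int n dvd 2 * (\<Sum>\<^sub># J - t)" using J(2) unfolding cong_iff_dvd_diff by (rule dvd_mult)
  moreover have "2 * (\<Sum>\<^sub># J - t) = 2 * psum J1 - psum Z - int n * psum Z"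
    by (simp add: J1(2) t_def h algebra_simps)
  ultimately have "int n dvd 2 * psum J1 - psum Z"
    by (metis dvd_diff_right_iff dvd_triv_left diff_add_cancel dvd_add)
  moreover have "psum (Z - J1) - psum J1 = - (2 * psum J1 - psum Z)"
    using sum_mset_diff[OF J1Z, of pval] by simp
  ultimately show False using no by (metis dvd_minus_iff)
qed

text \<open>Otherwise most pair values are multiples of e. After division by e,
  \<open>egz_multiple\<close> modulo k = n/e selects ke = n of these pairs with sum divisible by ek
  = n.\<close>

lemma proper_divisor:
  assumes d: "decomposition P L" and "e dvd n" "e > 1" "e < n"
  shows "e - 1 \<le> size {#p\<in>#P. \<not> int e dvd pval p#}"
proof (rule ccontr)
  assume contr: "\<not> ?thesis"
  obtain k where k: "n = e * k" using assms(2) by blast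
  have "odd e" "odd k" using odd_n k by auto
  moreover have "e \<noteq> 1" "k \<noteq> 1" using assms k by auto
  ultimately have "e \<ge> 3" "k \<ge> 3" by (auto elim!: oddE)
  then obtain u v where uv: "e = 3 + u" "k = 3 + v" by (meson le_iff_add)
  define F where "F = {#p\<in>#P. int e dvd pval p#}"
  have split: "size P = size F + size {#p\<in>#P. \<not> int e dvd pval p#}"
    unfolding F_def by (metis multiset_partition size_union)
  have "k * e + k - 1 \<le> size F"
  proof -
    have "2 * size P \<ge> 3 * (e * k) - 3" using sizes(2)[OF d] k by simp
    then have "2 * size F + 2 * (e - 2) \<ge> 3 * (e * k) - 3" using split contr by linarith
    \<comment> \<open>The inequality amounts to (e-2)(k-2) \<ge> 1, which holds because e and k are
      odd and not 1.\<close>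
    then show ?thesis unfolding uv by (simp add: algebra_simps)
  qed
  then have "zero_sum k (k * e) (image_mset (\<lambda>p. pval p div int e) F)"
    using egz_multiple[where n=k and k=e] uv by simp
  then obtain F' where F': "F' \<subseteq># F" "size F' = k * e" "int k dvd (\<Sum>p\<in>#F'. pval p div int e)" by (rule zero_sum_imageE)
  have F'P: "F' \<subseteq># P" using F'(1) unfolding F_def by (meson multiset_filter_subset subset_mset.order_trans)
  have "image_mset pval F' = image_mset (\<lambda>p. int e * (pval p div int e)) F'"
  proof (rule image_mset_cong)
    fix p assume "p \<in># F'"
    then have "p \<in># F" using F'(1) by (meson mset_subset_eqD)
    then show "pval p = int e * (pval p div int e)" by (simp add: F_def)
  qed
  then have "psum F' = int e * (\<Sum>p\<in>#F'. pval p div int e)" by (simp add: sum_mset_distrib_left)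
  then have "int n dvd psum F'" using F'(3) k by simp
  then show False using no_sum sub_pairs[OF d F'P] F'(2) k by (simp add: mult.commute)
qed

section \<open>Counting the pairs whose value is zero modulo n\<close>

definition nonzero :: "(dih \<times> dih) multiset \<Rightarrow> (dih \<times> dih) multiset" where
  "nonzero P = {#p\<in>#P. \<not> zero_pair p#}"

definition zeros :: "(dih \<times> dih) multiset \<Rightarrow> (dih \<times> dih) multiset" where
  "zeros P = {#p\<in>#P. zero_pair p#}"

lemma zeros_nonzero: "P = nonzero P + zeros P"
  unfolding nonzero_def zeros_def by (metis multiset_partition union_commute)

lemma size_nonzero_le: assumes "decomposition P L" shows "size (nonzero P) < n - 1"
proof -
  obtain d where d: "d dvd n" "d > 1" "size {#p\<in>#P. \<not> int d dvd pval p#} < d - 1"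
    using no_cover[OF assms] by blast
  then have "d = n" using proper_divisor[OF assms d(1,2)] dvd_imp_le[OF d(1)] n3 by fastforce
  then show ?thesis using d(3) by (simp add: nonzero_def)
qed

lemma size_zeros_less: assumes d: "decomposition P L" shows "size (zeros P) < n"
proof (rule ccontr)
  assume "\<not> ?thesis"
  then have "n \<le> size (zeros P)" by simp
  then obtain Q where Q: "Q \<subseteq># zeros P" "size Q = n" by (rule ex_subset_size)
  have QP: "Q \<subseteq># P" using Q(1) unfolding zeros_def by (meson multiset_filter_subset subset_mset.order_trans)
  have "int n dvd psum Q"
    by (rule dvd_sum_mset) (use Q(1) in \<open>auto simp: zeros_def dest: mset_subset_eqD\<close>)
  then show False using no_sum sub_pairs[OF d QP] Q(2) by blast
qed

text \<open>Here some of the nonzero pairs may be left out of the product. Such a pair enters with a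
  coefficient in \<open>{-1, 0, 1}\<close> instead of \<open>{-1, 1}\<close> and therefore counts twice in
  \<open>subset_sums_cover\<close>.\<close>

lemma size_nonzero_less_half: assumes d: "decomposition P L" shows "2 * size (nonzero P) < n"
proof (rule ccontr)
  assume "\<not> ?thesis"
  then have K2: "2 * size (nonzero P) \<ge> n" by simp
  have K2': "2 * size (nonzero P) \<ge> n + 1" using K2 odd_n by (metis Suc_eq_plus1 even_mult_iff even_numeral le_neq_implies_less Suc_leI)
  define K where "K = nonzero P"
  note Kn = size_nonzero_le[OF d, folded K_def]
  obtain r where r: "r \<in># P" "fst (fst r)" using ex_reflection_pair[OF d] .
  \<comment> \<open>\<open>U\<close> holds the pairs that may be left out. Its size makes |V| + 2|U|
    = n-1, as \<open>subset_sums_cover\<close> demands for the divisor n. One copy of the reflection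
    pair \<open>r\<close> is reserved for \<open>V\<close>, so that it cannot be dropped.\<close>
  have "n - 1 - size K \<le> size (K - {#r#})" using K2' unfolding K_def by (simp add: size_Diff_singleton_if) linarith
  then obtain U where U: "U \<subseteq># K - {#r#}" "size U = n - 1 - size K" by (rule ex_subset_size)
  have UK: "U \<subseteq># K" using U(1) by (meson diff_subset_eq_self subset_mset.order_trans)
  define V where "V = K - U"
  have KVU: "K = V + U" using UK by (simp add: V_def)
  have rV: "r \<in># V" if "r \<in># K"
  proof -
    have "count U r \<le> count K r - 1" using mset_subset_eq_count[OF U(1), of r] by simp
    moreover have "count K r > 0" using that by simp
    ultimately have "count V r > 0" unfolding V_def count_diff by linarith
    then show ?thesis by simp
  qed
  \<comment> \<open>All coefficients start at 1. A pair of \<open>V\<close> can only change its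
    sign, a shift by \<open>2 * pval p\<close>; a pair of \<open>U\<close> can go to 0 and on to -1
    in two shifts by \<open>pval p\<close>.\<close>
  define M where "M = image_mset (\<lambda>p. 2 * pval p) V + (image_mset pval U + image_mset pval U)"
  have Kdiv: "\<not> int n dvd pval p" if "p \<in># K" for p using that by (simp add: K_def nonzero_def)
  have cond: "e - 1 \<le> size {#x\<in>#M. \<not> int e dvd x#}" if e: "e dvd n" "e > 1" for e
  proof -
    have szM: "size {#x\<in>#M. \<not> int e dvd x#} = size {#p\<in>#V. \<not> int e dvd pval p#} + 2 * size {#p\<in>#U. \<not> int e dvd pval p#}"
      unfolding M_def by (simp add: size_filter_image odd_dvd_double[OF e(1)])
    show ?thesis
    proof (cases "e = n")
      case True
      have VU: "\<not> int e dvd pval p" if "p \<in># V \<or> p \<in># U" for p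
        using Kdiv[of p] that unfolding KVU True by auto
      have "{#p\<in>#V. \<not> int e dvd pval p#} = V" "{#p\<in>#U. \<not> int e dvd pval p#} = U"
        by (rule filter_mset_all; use VU in blast)+
      then have "size {#x\<in>#M. \<not> int e dvd x#} = size V + 2 * size U" unfolding szM by (simp only:)
      moreover have "size K = size V + size U" unfolding KVU by simp
      ultimately show ?thesis using U(2) Kn True by linarith
    next
      case False
      then have "e < n" using e(1) n3 by (meson dvd_imp_le le_neq_implies_less less_le_trans zero_less_numeral)
      have "{#p\<in>#P. \<not> int e dvd pval p#} = {#p\<in>#K. \<not> int e dvd pval p#}"
        unfolding K_def nonzero_def filter_filter_mset
      proof (rule filter_mset_cong)
        fix p
        show "\<not> int e dvd pval p \<longleftrightarrow> \<not> zero_pair p \<and> \<not> int e dvd pval p"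
          using dvd_trans[of "int e" "int n" "pval p"] e(1) by auto
      qed simp
      also have "size \<dots> = size {#p\<in>#V. \<not> int e dvd pval p#} + size {#p\<in>#U. \<not> int e dvd pval p#}"
        unfolding KVU by simp
      finally show ?thesis using proper_divisor[OF d e \<open>e < n\<close>] szM by linarith
    qed
  qed
  obtain Y where Y: "Y \<subseteq># M" "\<And>t. t \<in> subsums n Y"
    by (rule subset_sums_cover[of n M]) (use n3 cond in auto)
  obtain J where J: "J \<subseteq># M" "[\<Sum>\<^sub># J = psum K] (mod int n)" using subsums_coverE[OF Y(2) Y(1)] .
  obtain J1 J' where J1: "J1 \<subseteq># image_mset (\<lambda>p. 2 * pval p) V" "J' \<subseteq># image_mset pval U + image_mset pval U" "J = J1 + J'"
    using subset_plusE[OF J(1)[unfolded M_def]] .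
  obtain J2 J3 where J2: "J2 \<subseteq># image_mset pval U" "J3 \<subseteq># image_mset pval U" "J' = J2 + J3"
    using subset_plusE[OF J1(2)] .
  obtain A1 where A1: "A1 \<subseteq># V" "J1 = image_mset (\<lambda>p. 2 * pval p) A1" using subset_image_msetE[OF J1(1)] .
  obtain A2 where A2: "A2 \<subseteq># U" "J2 = image_mset pval A2" using subset_image_msetE[OF J2(1)] .
  obtain A3 where A3: "A3 \<subseteq># U" "J3 = image_mset pval A3" using subset_image_msetE[OF J2(2)] .
  \<comment> \<open>Pairs of \<open>A1\<close> get the sign -1, and a pair of \<open>U\<close> the
    coefficient 1 minus the number of times it is chosen in \<open>A2\<close> and
    \<open>A3\<close>.\<close>
  define Pos where "Pos = (V - A1) + ((U - A2) - A3)"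
  define Neg where "Neg = A1 + (A3 - (U - A2))"
  have PN: "Pos + Neg = V + (((U - A2) - A3) + (A3 - (U - A2)))"
  proof -
    have "Pos + Neg = ((V - A1) + A1) + (((U - A2) - A3) + (A3 - (U - A2)))"
      unfolding Pos_def Neg_def by (simp only: ac_simps)
    also have "(V - A1) + A1 = V" using A1(1) by simp
    finally show ?thesis .
  qed
  have "((U - A2) - A3) + (A3 - (U - A2)) \<subseteq># U"
  proof (rule mset_subset_eqI)
    fix x show "count (((U - A2) - A3) + (A3 - (U - A2))) x \<le> count U x"
      using mset_subset_eq_count[OF A3(1), of x] by simp
  qed
  then have PNK: "Pos + Neg \<subseteq># K" unfolding PN KVU by simp
  have dif: "int n dvd psum Pos - psum Neg"
  proof -
    have "psum Pos - psum Neg = psum (V - A1) - psum A1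
        + (psum ((U - A2) - A3) - psum (A3 - (U - A2)))"
      by (simp add: Pos_def Neg_def)
    also have "\<dots> = psum V - 2 * psum A1 + (psum U - psum A2 - psum A3)"
      by (simp only: sum_mset_two_diffs sum_mset_diff[OF A1(1)] sum_mset_diff[OF A2(1)])
    also have "\<dots> = psum K - \<Sum>\<^sub># J"
      by (simp add: KVU J1(3) J2(3) A1(2) A2(2) A3(2) sum_mset_distrib_left)
    finally show ?thesis using J(2) by (simp add: cong_iff_dvd_diff dvd_diff_commute)
  qed
  have szPN: "size (Pos + Neg) \<le> size K" "size V \<le> size (Pos + Neg)"
    using size_mset_mono[OF PNK] unfolding PN by simp_all
  have "size K = size V + size U" unfolding KVU by simp
  then have szV: "size V = size K - (n - 1 - size K)" using U(2) by linarith
  \<comment> \<open>At least 2|K| - (n-1) pairs are in use, so at most 2n-1 - 2|K| are missing. The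
    (3n-3)/2 - |K| or more zero pairs suffice because 2|K| \<ge> n+1.\<close>
  have szZ: "n - size (Pos + Neg) \<le> size (zeros P)"
  proof -
    have "size P = size K + size (zeros P)" using arg_cong[OF zeros_nonzero[of P], of size] by (simp add: K_def)
    then show ?thesis using sizes(2)[OF d] szPN(2) szV K2' Kn unfolding K_def[symmetric] by linarith
  qed
  \<comment> \<open>Zero pairs fill up the selection without changing the product modulo n. If
    \<open>r\<close> is a zero pair it is included, so that a reflection takes part.\<close>
  obtain F where F: "F \<subseteq># zeros P" "size F = n - size (Pos + Neg)" "r \<in># zeros P \<Longrightarrow> r \<in># F"
  proof (cases "r \<in># zeros P")
    case True
    have "{#r#} \<subseteq># zeros P" "size {#r#} \<le> n - size (Pos + Neg)" using True szPN(1) Kn by auto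
    from ex_subset_size_between[OF this szZ] show ?thesis using that by (metis mset_subset_eqD union_single_eq_member add_mset_add_single)
  next
    case False
    then show ?thesis using that ex_subset_size[OF szZ] by metis
  qed
  have sub: "(Pos + F) + Neg \<subseteq># P"
    using subset_mset.add_mono[OF PNK F(1)] zeros_nonzero[of P] by (simp add: K_def ac_simps)
  have "\<not> int n dvd psum (Pos + F) - psum Neg"
  proof (rule no_signed)
    show "homog ((Pos + F) + Neg)" "elts ((Pos + F) + Neg) \<subseteq># S" using sub_pairs[OF d sub] .
    show "size (Pos + F) + size Neg = n" using F(2) szPN(1) Kn by simp
    have "r \<in># K \<or> r \<in># zeros P" using r(1) zeros_nonzero[of P] unfolding K_def by (metis union_iff)
    then have "r \<in># V + F" using rV F(3) by auto
    then have "r \<in># (Pos + Neg) + F" unfolding PN by auto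
    then show "\<exists>p\<in>#(Pos + F) + Neg. fst (fst p)" using r(2) by auto
  qed
  moreover have "int n dvd psum F"
    by (rule dvd_sum_mset) (use F(1) in \<open>auto simp: zeros_def dest: mset_subset_eqD\<close>)
  then have "int n dvd (psum Pos - psum Neg) + psum F" using dif by simp
  then have "int n dvd psum (Pos + F) - psum Neg" by (simp add: algebra_simps)
  ultimately show False by blast
qed

text \<open>There are at least (3n-3)/2 pairs, while the two strict bounds allow at most n-1 zero
  and (n-1)/2 nonzero ones, so every estimate is tight.\<close>

lemma exact_sizes:
  assumes d: "decomposition P L"
  shows "2 * size (nonzero P) = n - 1" "size (zeros P) = n - 1" "size L = 2"
proof -
  have "size P = size (nonzero P) + size (zeros P)" using arg_cong[OF zeros_nonzero[of P], of size] by simp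
  then show "2 * size (nonzero P) = n - 1" "size (zeros P) = n - 1" "size L = 2"
    using sizes[OF d] size_L[OF d] size_zeros_less[OF d] size_nonzero_less_half[OF d] n3 by linarith+
qed

end

lemma reflection_eq: "fst x \<Longrightarrow> x = (True, snd x)" and rotation_eq: "\<not> fst x \<Longrightarrow> x = (False, snd x)"
  by (simp_all add: prod_eq_iff)

section \<open>Exchanging terms between pairs and the leftover\<close>

context odd_counterexample
begin

lemma pval_swap: "fst (fst p) = fst (snd p) \<Longrightarrow> zero_pair (snd p, fst p) \<longleftrightarrow> zero_pair p"
  by (auto simp: pval_def add.commute dvd_diff_commute)

lemma decomposition_swap:
  assumes "decomposition (add_mset p P) L" shows "decomposition (add_mset (snd p, fst p) P) L"
  using assms unfolding decomposition_def by (auto simp: add_mset_commute)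

text \<open>Every decomposition has exactly n-1 zero pairs, so a change in a single pair cannot
  create or destroy one.\<close>

lemma exchange:
  assumes d: "decomposition (add_mset p P) (add_mset l L)" and t: "fst l = fst (fst p)"
  shows "zero_pair (l, snd p) \<longleftrightarrow> zero_pair p"
proof -
  have "image_mset fst (add_mset (fst p) L) = image_mset fst (add_mset l L)" using t by simp
  then have "decomposition (add_mset (l, snd p) P) (add_mset (fst p) L)"
    using d t unfolding decomposition_def by (simp add: add_mset_commute del: image_mset_add_mset)
  from exact_sizes(2)[OF this] exact_sizes(2)[OF d] show ?thesis by (auto simp: zeros_def split: if_splits)
qed

lemma exchange_snd:
  assumes d: "decomposition (add_mset p P) (add_mset l L)" and t: "fst l = fst (fst p)"
  shows "zero_pair (l, fst p) \<longleftrightarrow> zero_pair p"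
proof -
  have "fst (fst p) = fst (snd p)" using d by (simp add: decomposition_def)
  then show ?thesis using exchange[OF decomposition_swap[OF d]] t pval_swap by simp
qed

lemma regroup:
  assumes d: "decomposition (add_mset p (add_mset q P)) L" and t: "fst (fst p) = fst (fst q)"
  shows "size {#x\<in>#{#(fst p, fst q), (snd p, snd q)#}. zero_pair x#} = size {#x\<in>#{#p, q#}. zero_pair x#}"
proof -
  have "decomposition (add_mset (fst p, fst q) (add_mset (snd p, snd q) P)) L"
    using d t unfolding decomposition_def by (auto simp: add_mset_commute)
  from exact_sizes(2)[OF this] exact_sizes(2)[OF d] show ?thesis by (auto simp: zeros_def split: if_splits)
qed

text \<open>By exchanging, any two of the three exponents have a sum divisible by n. Adding two of
  these sums and subtracting the third gives twice the exponent of \<open>l\<close>, and n is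
  odd.\<close>

lemma rotation_zero_pair:
  assumes d: "decomposition (add_mset p P) (add_mset l L)" and t: "fst l = fst (fst p)"
    and z: "zero_pair p" and r: "\<not> fst l"
  shows "int n dvd snd l" "int n dvd snd (fst p)" "int n dvd snd (snd p)"
proof -
  have "int n dvd snd l + snd (snd p)" "int n dvd snd l + snd (fst p)" "int n dvd snd (fst p) + snd (snd p)"
    using exchange[OF d t] exchange_snd[OF d t] z r t by (auto simp: pval_def)
  then have "int n dvd (snd l + snd (snd p)) + (snd l + snd (fst p)) - (snd (fst p) + snd (snd p))"
    by (meson dvd_diff dvd_add)
  also have "(snd l + snd (snd p)) + (snd l + snd (fst p)) - (snd (fst p) + snd (snd p)) = 2 * snd l" by simp
  finally show l: "int n dvd snd l" unfolding odd_dvd_double[OF dvd_refl] .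
  then show "int n dvd snd (fst p)" "int n dvd snd (snd p)"
    using \<open>int n dvd snd l + snd (snd p)\<close> \<open>int n dvd snd l + snd (fst p)\<close> by (simp_all add: dvd_add_right_iff)
qed

text \<open>By exchanging, the terms of \<open>p\<close> form zero pairs with \<open>l\<close> and
  those of \<open>q\<close> do not. Pairing \<open>p\<close> with \<open>q\<close> crosswise then
  leaves no zero pair out of one, although their number is fixed.\<close>

lemma type_uniform:
  assumes d: "decomposition (add_mset p (add_mset q P)) (add_mset l L)"
    and t: "fst (fst p) = fst l" "fst (fst q) = fst l" and z: "zero_pair p" "\<not> zero_pair q"
  shows False
proof -
  have d2: "decomposition (add_mset q (add_mset p P)) (add_mset l L)" using d by (simp add: add_mset_commute)
  have ts: "fst (snd p) = fst l" "fst (snd q) = fst l" using d t by (auto simp: decomposition_def)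
  have q: "\<not> zero_pair (l, snd q)" "\<not> zero_pair (l, fst q)"
    using exchange[OF d2] exchange_snd[OF d2] t z by auto
  have p: "zero_pair (l, snd p)" "zero_pair (l, fst p)"
    using exchange[OF d] exchange_snd[OF d] t z by auto
  have "\<not> zero_pair (fst p, fst q) \<and> \<not> zero_pair (snd p, snd q)"
  proof (cases "fst l")
    case True
    have pd: "int n dvd snd l - snd (fst p)" "int n dvd snd l - snd (snd p)" using p True by (auto simp: pval_def)
    have qd: "\<not> int n dvd snd l - snd (fst q)" "\<not> int n dvd snd l - snd (snd q)" using q True by (auto simp: pval_def)
    have "\<not> int n dvd snd (fst p) - snd (fst q)" using dvd_add[OF pd(1), of "snd (fst p) - snd (fst q)"] qd(1) by auto
    moreover have "\<not> int n dvd snd (snd p) - snd (snd q)" using dvd_add[OF pd(2), of "snd (snd p) - snd (snd q)"] qd(2) by auto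
    ultimately show ?thesis using True t ts by (simp add: pval_def)
  next
    case False
    have l: "int n dvd snd l" "int n dvd snd (fst p)" "int n dvd snd (snd p)" using rotation_zero_pair[OF d] t z False by auto
    have "\<not> int n dvd snd (fst q)" "\<not> int n dvd snd (snd q)"
      using q False l(1) by (auto simp: pval_def dvd_add_right_iff)
    then show ?thesis using False t ts l by (simp add: pval_def dvd_add_right_iff)
  qed
  then show False using regroup[OF d] t z by simp
qed

lemma leftover_of_type:
  assumes d: "decomposition P L" obtains l L' where "L = add_mset l L'" "fst l = b"
proof -
  obtain l0 l1 where L: "L = {#l0, l1#}" using exact_sizes(3)[OF d] size_2_mset by blast
  have "fst l0 \<noteq> fst l1" using count_le_1_distinct[of fst L l0 l1] d L by (auto simp: decomposition_def)
  then consider "fst l0 = b" | "fst l1 = b" by blast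
  then show ?thesis
  proof cases
    case 1 then show ?thesis using that[of l0 "{#l1#}"] L by simp
  next
    case 2 then show ?thesis using that[of l1 "{#l0#}"] L by (simp add: add_mset_commute)
  qed
qed

text \<open>\<open>T\<close> and the pairs of \<open>Z\<close> have different types and are
  therefore disjoint in \<open>S\<close>. How the products combine is left to the hypothesis
  \<open>val\<close>, since rotations in \<open>T\<close> can be inverted only next to a reflection
  of \<open>Z\<close>.\<close>

lemma combine_zeros:
  assumes d: "decomposition P L" and Z: "Z \<subseteq># zeros P" "size Z + k = n" "\<And>p. p \<in># Z \<Longrightarrow> fst (fst p) \<noteq> b"
    and T: "T \<subseteq># {#x\<in>#S. fst x = b#}" "size T = 2 * k"
    and val: "\<And>v. \<lbrakk>dval (elts Z) v\<rbrakk> \<Longrightarrow> dval (T + elts Z) (w + v)" and w: "int n dvd w"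
  shows False
proof -
  have ZP: "Z \<subseteq># P" using Z(1) unfolding zeros_def by (meson multiset_filter_subset subset_mset.order_trans)
  have hZ: "homog Z" "elts Z \<subseteq># S" using sub_pairs[OF d ZP] .
  have "{#x\<in>#elts Z. fst x \<noteq> b#} = elts Z"
  proof (rule filter_mset_all)
    fix x assume "x \<in># elts Z"
    then obtain p where "p \<in># Z" "x = fst p \<or> x = snd p" by (auto simp: elts_def)
    then show "fst x \<noteq> b" using Z(3)[of p] hZ(1) by (auto simp: homog_def)
  qed
  moreover have "{#x\<in>#elts Z. fst x \<noteq> b#} \<subseteq># {#x\<in>#S. fst x \<noteq> b#}" using hZ(2) by (rule multiset_filter_mono)
  ultimately have "elts Z \<subseteq># {#x\<in>#S. fst x \<noteq> b#}" by (simp only:)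
  then have sub: "T + elts Z \<subseteq># S" using subset_filters[OF T(1)] by blast
  have "int n dvd psum Z"
    by (rule dvd_sum_mset) (use Z(1) in \<open>auto simp: zeros_def dest: mset_subset_eqD\<close>)
  then have "int n dvd w + psum Z" using w by simp
  moreover have "size (T + elts Z) = 2 * n" using T(2) Z(2) by simp
  ultimately show False using none sub val[OF dval_elts[OF hZ(1)]] unfolding pone_def by blast
qed

lemma size_type:
  assumes d: "decomposition P L"
  shows "size {#x\<in>#S. fst x = b#} = 2 * size {#p\<in>#P. fst (fst p) = b#} + 1"
proof -
  obtain l0 l1 where L: "L = {#l0, l1#}" using exact_sizes(3)[OF d] size_2_mset by blast
  have "fst l0 \<noteq> fst l1" using count_le_1_distinct[of fst L l0 l1] d L by (auto simp: decomposition_def)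
  then have L1: "size {#x\<in>#L. fst x = b#} = 1" using L by auto
  have "size {#x\<in>#elts P. fst x = b#} = 2 * size {#p\<in>#P. fst (fst p) = b#}"
    if "homog P" for P using that by (induction P) auto
  then show ?thesis using d L1 by (simp add: decomposition_def)
qed

text \<open>A term of each type is left over, so \<open>type_uniform\<close> applies to both types:
  within a type the pairs are all zero or all nonzero. Both kinds exist by
  \<open>exact_sizes\<close>.\<close>

lemma zero_pairs_one_type:
  assumes d: "decomposition P L"
  obtains b where "zeros P = {#p\<in>#P. fst (fst p) \<noteq> b#}" "nonzero P = {#p\<in>#P. fst (fst p) = b#}"
proof -
  have "zeros P \<noteq> {#}" "nonzero P \<noteq> {#}" using exact_sizes[OF d] n3 by (auto simp: Suc_le_eq)
  then obtain p q where "p \<in># zeros P" "q \<in># nonzero P" by blast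
  then have p: "p \<in># P" "zero_pair p" and q: "q \<in># P" "\<not> zero_pair q" by (auto simp: zeros_def nonzero_def)
  have ne: "fst (fst u) \<noteq> fst (fst v)" if u: "u \<in># P" "zero_pair u" and v: "v \<in># P" "\<not> zero_pair v" for u v
  proof
    assume eq: "fst (fst u) = fst (fst v)"
    obtain l L' where L: "L = add_mset l L'" "fst l = fst (fst v)" using leftover_of_type[OF d] .
    obtain P1 where P1: "P = add_mset u P1" using u by (meson multi_member_split)
    have "v \<in># P1" using u v P1 by auto
    then obtain P2 where P2: "P1 = add_mset v P2" by (meson multi_member_split)
    have "fst (fst u) = fst l" using eq L(2) by simp
    from type_uniform[OF d[unfolded L(1) P1 P2] this L(2)[symmetric] u(2) v(2)] show False .
  qed
  define b where "b = fst (fst q)"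
  have iff: "zero_pair u \<longleftrightarrow> fst (fst u) \<noteq> b" if "u \<in># P" for u
  proof (cases "zero_pair u")
    case True then show ?thesis using ne[OF that True q] by (simp add: b_def)
  next
    case False then show ?thesis using ne[OF p that False] ne[OF p q] by (auto simp: b_def)
  qed
  show ?thesis
  proof (rule that[of b])
    show "zeros P = {#p\<in>#P. fst (fst p) \<noteq> b#}" unfolding zeros_def by (rule filter_mset_cong) (use iff in auto)
    show "nonzero P = {#p\<in>#P. fst (fst p) = b#}" unfolding nonzero_def by (rule filter_mset_cong) (use iff in auto)
  qed
qed

text \<open>Let \<open>R\<close> be the n terms of the type of the nonzero pairs. Two of them that
  cancel would be completed by the n-1 zero pairs to length 2n, so the exponents in \<open>R\<close>
  form a complete residue system. Rotations are excluded by 1 + (n-1) = 0, and n \<ge> 5 by four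
  reflections with (0-1) + (3-2) = 0 and n-2 zero pairs. So n = 3, the zero pairs are rotations, and
  \<open>rotation_zero_pair\<close> makes every rotation trivial.\<close>

theorem exceptional_structure:
  "n = 3 \<and> (\<forall>x\<in>#S. \<not> fst x \<longrightarrow> 3 dvd snd x) \<and> size (refls S) = 3
    \<and> image_mset (\<lambda>x. snd x mod 3) (refls S) = mset_set {0..<3}"
proof -
  obtain P L where d: "decomposition P L" by (rule ex_decomposition)
  obtain b where b: "zeros P = {#p\<in>#P. fst (fst p) \<noteq> b#}" "nonzero P = {#p\<in>#P. fst (fst p) = b#}"
    using zero_pairs_one_type[OF d] .
  define R where "R = {#x\<in>#S. fst x = b#}"
  have szR: "size R = n" using size_type[OF d, of b] exact_sizes(1)[OF d] n3 unfolding R_def b(2)[symmetric] by simp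
  have zt: "fst (fst p) \<noteq> b" if "p \<in># zeros P" for p using that b(1) by simp
  have Rb: "fst x = b" if "{#x, y#} \<subseteq># R" for x y using that unfolding R_def by (auto dest: mset_subset_eqD)
  have no2: False if xy: "{#x, y#} \<subseteq># R" and w: "int n dvd w"
    and val: "\<And>v. dval (elts (zeros P)) v \<Longrightarrow> dval ({#x, y#} + elts (zeros P)) (w + v)" for x y w
    by (rule combine_zeros[OF d, of "zeros P" 1 b "{#x, y#}" w]) (use zt xy w val exact_sizes(2)[OF d] n3 in \<open>auto simp: R_def\<close>)
  have le1: "count (image_mset (\<lambda>x. snd x mod int n) R) c \<le> 1" for c
  proof (rule ccontr)
    assume "\<not> ?thesis"
    then have "count (image_mset (\<lambda>x. snd x mod int n) R) c \<ge> 2" by simp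
    then obtain x y where xy: "{#x, y#} \<subseteq># R" "snd x mod int n = c" "snd y mod int n = c" by (rule count_ge_2E)
    have w: "int n dvd snd x - snd y" using xy(2,3) mod_eq_dvd_iff by metis
    have bx: "fst x = b" "fst y = b" using Rb[of x y] Rb[of y x] xy(1) by (auto simp: add_mset_commute)
    show False
    proof (rule no2[OF xy(1) w])
      fix v assume v: "dval (elts (zeros P)) v"
      show "dval ({#x, y#} + elts (zeros P)) (snd x - snd y + v)"
      proof (cases b)
        case True
        then have "dval {#x, y#} (snd x - snd y)" using dval_refl_pair[of "snd x" "snd y"] bx reflection_eq by metis
        then show ?thesis using dval_add v by blast
      next
        case False
        have "zeros P \<noteq> {#}" using exact_sizes(2)[OF d] n3 by auto
        then obtain p where "p \<in># zeros P" by blast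
        then have "\<exists>t\<in>#elts (zeros P). fst t" using zt[of p] False by (auto simp: elts_def)
        then have "dval (add_mset (False, snd y) (elts (zeros P))) (v - snd y)" using dval_insert_neg[OF v] by blast
        from dval_insert_pos[OF this, of "snd x"]
        have "dval (add_mset (False, snd x) (add_mset (False, snd y) (elts (zeros P)))) (v - snd y + snd x)" .
        moreover have "x = (False, snd x)" "y = (False, snd y)" using bx False rotation_eq by metis+
        moreover have "v - snd y + snd x = snd x - snd y + v" by simp
        ultimately show ?thesis by (metis add_mset_add_single union_commute union_mset_add_mset_left empty_neutral(1))
      qed
    qed
  qed
  have eqR: "image_mset (\<lambda>x. snd x mod int n) R = mset_set {0..<int n}"
    using full_residues[of "image_mset snd R" n] szR le1 by (simp add: multiset.map_comp comp_def)
  have res: "\<exists>x\<in>#R. snd x mod int n = c" if "c \<in> {0..<int n}" for c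
  proof -
    have "c \<in># image_mset (\<lambda>x. snd x mod int n) R" unfolding eqR using that by simp
    then show ?thesis by auto
  qed
  have b: "b"
  proof (rule ccontr)
    assume nb: "\<not> b"
    obtain x y where x: "x \<in># R" "snd x mod int n = 1" and y: "y \<in># R" "snd y mod int n = int n - 1"
      using res[of 1] res[of "int n - 1"] n3 by auto
    then have "x \<noteq> y" using n3 by auto
    then have xy: "{#x, y#} \<subseteq># R" using x y by (auto simp: subseteq_mset_def Suc_le_eq)
    have "(snd x + snd y) mod int n = (1 + (int n - 1)) mod int n" using x y by (metis mod_add_eq)
    then have w: "int n dvd snd x + snd y" by (simp add: mod_eq_0_iff_dvd)
    have "\<not> fst x" "\<not> fst y" using x y nb by (auto simp: R_def)
    note f = rotation_eq[OF this(1)] rotation_eq[OF this(2)]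
    show False
    proof (rule no2[OF xy w])
      fix v assume v: "dval (elts (zeros P)) v"
      have "dval {#x, y#} (snd x + snd y)" using dval_add[OF dval_rot[of "snd x"] dval_rot[of "snd y"]] f
        by (metis add_mset_add_single add_mset_commute)
      then show "dval ({#x, y#} + elts (zeros P)) (snd x + snd y + v)" using dval_add v by blast
    qed
  qed
  have "\<not> n \<ge> 5"
  proof
    assume n5: "n \<ge> 5"
    obtain x0 x1 x2 x3 where x: "x0 \<in># R" "snd x0 mod int n = 0" "x1 \<in># R" "snd x1 mod int n = 1"
      "x2 \<in># R" "snd x2 mod int n = 2" "x3 \<in># R" "snd x3 mod int n = 3"
      using res[of 0] res[of 1] res[of 2] res[of 3] n5 by auto
    have ne: "x0 \<noteq> x1" "x0 \<noteq> x2" "x0 \<noteq> x3" "x1 \<noteq> x2" "x1 \<noteq> x3" "x2 \<noteq> x3" using x by auto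
    have T: "{#x0, x1, x3, x2#} \<subseteq># {#x\<in>#S. fst x = b#}"
      unfolding R_def[symmetric] using x(1,3,5,7) ne by (auto simp: subseteq_mset_def Suc_le_eq)
    have f: "x0 = (True, snd x0)" "x1 = (True, snd x1)" "x2 = (True, snd x2)" "x3 = (True, snd x3)"
      using x(1,3,5,7) b unfolding R_def by (auto intro!: reflection_eq)
    define w where "w = (snd x0 - snd x1) + (snd x3 - snd x2)"
    have "dval ({#x0, x1#} + {#x3, x2#}) w" unfolding w_def
      using dval_add[OF dval_refl_pair[of "snd x0" "snd x1"] dval_refl_pair[of "snd x3" "snd x2"]] f by metis
    then have val: "dval {#x0, x1, x3, x2#} w" by (simp add: add_mset_commute)
    have "[w = (0 - 1) + (3 - 2)] (mod int n)" unfolding w_def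
      by (intro cong_add cong_diff) (use x n5 in \<open>auto simp: cong_def\<close>)
    then have w: "int n dvd w" by (simp add: cong_0_iff)
    have "n - 2 \<le> size (zeros P)" using exact_sizes(2)[OF d] by simp
    then obtain Z where Z: "Z \<subseteq># zeros P" "size Z = n - 2" by (rule ex_subset_size)
    show False
    proof (rule combine_zeros[OF d Z(1) _ _ T _ _ w])
      show "size Z + 2 = n" using Z(2) n5 by simp
      show "fst (fst p) \<noteq> b" if "p \<in># Z" for p using that Z(1) zt by (meson mset_subset_eqD)
      show "dval ({#x0, x1, x3, x2#} + elts Z) (w + v)" if "dval (elts Z) v" for v using dval_add[OF val that] .
    qed simp
  qed
  then have n: "n = 3" using n3 odd_n by presburger
  have "3 dvd snd x" if xS: "x \<in># S" and nx: "\<not> fst x" for x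
  proof -
    obtain l L' where L: "L = add_mset l L'" "fst l = False" using leftover_of_type[OF d] .
    have rz: "int n dvd snd l \<and> int n dvd snd (fst p) \<and> int n dvd snd (snd p)" if p: "p \<in># P" "\<not> fst (fst p)" for p
    proof -
      obtain P' where P': "P = add_mset p P'" using p by (meson multi_member_split)
      have "p \<in># zeros P" using p b \<open>zeros P = _\<close> by simp
      then have "zero_pair p" by (simp add: zeros_def)
      then show ?thesis using rotation_zero_pair[of p P' l L'] d P' L p by auto
    qed
    have "zeros P \<noteq> {#}" using exact_sizes(2)[OF d] n3 by auto
    then obtain p where "p \<in># zeros P" by blast
    then have "p \<in># P" "\<not> fst (fst p)" using zt[of p] b by (auto simp: zeros_def)
    then have l: "int n dvd snd l" using rz by blast
    have "x \<in># elts P \<or> x \<in># L" using xS d by (auto simp: decomposition_def)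
    then show ?thesis
    proof
      assume "x \<in># elts P"
      then obtain p where p: "p \<in># P" "x = fst p \<or> x = snd p" by (auto simp: elts_def)
      moreover have "fst (fst p) = fst (snd p)" using d p(1) by (auto simp: decomposition_def homog_def)
      ultimately show ?thesis using rz[of p] nx n by auto
    next
      assume xL: "x \<in># L"
      have "x = l"
      proof (rule ccontr)
        assume "x \<noteq> l"
        then obtain L2 where "L' = add_mset x L2" using xL L(1) by (metis insert_noteq_member multi_member_split)
        then show False using count_le_1_distinct[of fst L l x] d L nx by (auto simp: decomposition_def)
      qed
      then show ?thesis using l n by simp
    qed
  qed
  moreover have "R = refls S" using b by (simp add: R_def)
  ultimately show ?thesis using n szR eqR by auto
qed

end

section \<open>Extremal sequences over the infinite dihedral group\<close>

text \<open>The sequence of five identities and \<tau>, \<alpha>\<tau>, \<alpha>^2\<tau>, with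
  exponents read modulo 3.\<close>

definition exceptional_form :: "dih multiset \<Rightarrow> bool" where
  "exceptional_form S \<longleftrightarrow> (\<forall>x\<in>#S. \<not> fst x \<longrightarrow> 3 dvd snd x) \<and> size (refls S) = 3
    \<and> size (rots S) = 5 \<and> image_mset (\<lambda>x. snd x mod 3) (refls S) = mset_set {0..<3}"

definition extremal_form :: "nat \<Rightarrow> nat \<Rightarrow> nat \<Rightarrow> dih multiset \<Rightarrow> bool" where
  "extremal_form n i j S \<longleftrightarrow> size (refls S) = 1
    \<and> (\<exists>a b. two_valued n i j a b (image_mset snd (rots S)))"

lemma size_split: "size S = size {#x\<in>#S. Q x#} + size {#x\<in>#S. \<not> Q x#}"
  by (metis multiset_partition size_union)

lemma pone_odd:
  assumes "n \<ge> 3" "odd n" "size S = 3 * n - 1" "size (refls S) \<ge> 2" "\<not> pone n (2 * n) S"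
  shows "n = 3" "exceptional_form S"
proof -
  interpret odd_counterexample n S using assms by unfold_locales auto
  show "n = 3" using exceptional_structure by blast
  then show "exceptional_form S" using exceptional_structure size_split[of S fst] assms(3) unfolding exceptional_form_def by auto
qed

lemma pone_add: "pone n j A \<Longrightarrow> pone n k B \<Longrightarrow> pone n (j + k) (A + B)"
proof -
  assume "pone n j A" "pone n k B"
  then obtain T w U v where "T \<subseteq># A" "size T = j" "dval T w" "int n dvd w" "U \<subseteq># B" "size U = k" "dval U v" "int n dvd v"
    unfolding pone_def by blast
  then show ?thesis unfolding pone_def
    by (intro exI[of _ "T + U"] exI[of _ "w + v"]) (auto intro: dval_add subset_mset.add_mono)
qed

lemma dval_rotations: "(\<And>x. x \<in># T \<Longrightarrow> \<not> fst x) \<Longrightarrow> dval T (\<Sum>x\<in>#T. snd x)"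
proof (induction T)
  case (add x T)
  then have "x = (False, snd x)" by (intro rotation_eq) simp
  then show ?case using dval_insert_pos[of T "\<Sum>x\<in>#T. snd x" "snd x"] add by (simp add: add.commute)
qed (simp add: dval_empty)

lemma rotations_zero_sum:
  assumes "zero_sum n k (image_mset snd (rots S))"
  obtains T where "T \<subseteq># rots S" "size T = k" "pone n k T"
proof -
  obtain T where T: "T \<subseteq># rots S" "size T = k" "int n dvd (\<Sum>x\<in>#T. snd x)"
    using assms by (rule zero_sum_imageE)
  have "\<not> fst x" if "x \<in># T" for x using mset_subset_eqD[OF T(1) that] by simp
  then have "dval T (\<Sum>x\<in>#T. snd x)" by (rule dval_rotations)
  then have "pone n k T" using T unfolding pone_def by blast
  then show ?thesis using that T by blast
qed

lemma rotations_pone: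
  assumes "zero_sum n k (image_mset snd (rots S))" shows "pone n k S"
proof -
  obtain T where "T \<subseteq># rots S" "pone n k T" using rotations_zero_sum[OF assms] by blast
  then show ?thesis using pone_mono by (meson multiset_filter_subset subset_mset.order_trans)
qed

lemma ex_subset_with_reflections:
  assumes "k \<le> size (refls S)" "k \<le> s" "s \<le> size S"
  obtains U where "U \<subseteq># S" "size U = s" "k \<le> size (refls U)"
proof -
  obtain Y where Y: "Y \<subseteq># refls S" "size Y = k" using ex_subset_size[OF assms(1)] .
  have "Y \<subseteq># S" using Y(1) by (meson multiset_filter_subset subset_mset.order_trans)
  then obtain U where U: "Y \<subseteq># U" "U \<subseteq># S" "size U = s" using ex_subset_size_between[of Y S s] Y(2) assms by blast
  have "refls Y = Y"
    by (rule filter_mset_all) (use mset_subset_eqD[OF Y(1)] in simp)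
  then have "k \<le> size (refls U)"
    using size_mset_mono[OF multiset_filter_mono[OF U(1), of fst]] Y(2) by simp
  then show ?thesis using that U by blast
qed

text \<open>It suffices to split off a product-one \<open>T\<close> of length n that leaves two
  reflections, as \<open>pone_even\<close> applies to the remaining 2n-1 terms. With 2n-1 rotations
  \<open>T\<close> can consist of rotations; with n+2 reflections any \<open>T\<close> will do.
  Otherwise there are exactly n+1 reflections, and \<open>T\<close> is taken among 2n-1 terms of
  which only two are reflections.\<close>

lemma pone_even_double:
  assumes m: "m \<ge> 2" and n: "n = 2 * m" and S: "size S = 3 * n - 1" and q: "size (refls S) \<ge> 2"
  shows "pone n (2 * n) S"
proof -
  have step: "pone n (2 * n) S"
    if T: "T \<subseteq># S" "size T = n" "pone n n T" "size (refls T) + 2 \<le> size (refls S)" for T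
  proof -
    have ST: "S = (S - T) + T" using T(1) by simp
    have "size (refls S) = size (refls (S - T)) + size (refls T)"
      by (subst ST) simp
    then have "size (refls (S - T)) \<ge> 2" using T(4) by linarith
    moreover have "size (S - T) = 4 * m - 1" using S T(1,2) n by (simp add: size_Diff_submset)
    ultimately have "pone n n (S - T)" using pone_even[OF m] n by simp
    from pone_add[OF this T(3)] show ?thesis using ST by (simp add: mult_2)
  qed
  have inner: "\<exists>T. T \<subseteq># S \<and> size T = n \<and> pone n n T \<and> size (refls T) \<le> size (refls U)"
    if U: "U \<subseteq># S" "size U = 2 * n - 1" "2 \<le> size (refls U)" for U
  proof -
    have "pone n n U" using pone_even[OF m, of U] U n by simp
    then obtain T w where T: "T \<subseteq># U" "size T = n" "dval T w" "int n dvd w" unfolding pone_def by blast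
    have "pone n n T" using T unfolding pone_def by blast
    moreover have "T \<subseteq># S" using T(1) U(1) by (rule subset_mset.order_trans)
    moreover have "size (refls T) \<le> size (refls U)" using T(1) by (intro size_mset_mono multiset_filter_mono)
    ultimately show ?thesis using T(2) by blast
  qed
  show ?thesis
  proof (cases "size (rots S) \<ge> 2 * n - 1")
    case True
    then have "zero_sum n n (image_mset snd (rots S))" using egz[of n] m n by simp
    then obtain T where T: "T \<subseteq># rots S" "size T = n" "pone n n T" by (rule rotations_zero_sum)
    have "refls T = {#}" by (rule filter_mset_none) (use mset_subset_eqD[OF T(1)] in simp)
    moreover have "T \<subseteq># S" using T(1) by (meson multiset_filter_subset subset_mset.order_trans)
    moreover from calculation(1) have "size (refls T) = 0" by (simp only: size_empty)
    ultimately show ?thesis using step[OF _ T(2,3)] q by linarith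
  next
    case False
    have split: "size S = size (refls S) + size (rots S)" by (rule size_split)
    show ?thesis
    proof (cases "size (refls S) \<ge> n + 2")
      case True
      have "2 \<le> 2 * n - 1" "2 * n - 1 \<le> size S" using S m n by linarith+
      from ex_subset_with_reflections[OF q this]
      obtain U where U: "U \<subseteq># S" "size U = 2 * n - 1" "2 \<le> size (refls U)" .
      then obtain T where T: "T \<subseteq># S" "size T = n" "pone n n T" using inner by blast
      have "size (refls T) \<le> n" using size_filter_mset_lesseq[of fst T] T(2) by simp
      then show ?thesis using step[OF T] True by simp
    next
      case q2: False
      obtain Y where Y: "Y \<subseteq># refls S" "size Y = 2" using ex_subset_size[OF q] .
      have "2 * n - 3 \<le> size (rots S)" using split S q2 by linarith
      then obtain V where V: "V \<subseteq># rots S" "size V = 2 * n - 3" by (rule ex_subset_size)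
      have VU: "refls V = {#}" by (rule filter_mset_none) (use mset_subset_eqD[OF V(1)] in simp)
      have YU: "refls Y = Y" by (rule filter_mset_all) (use mset_subset_eqD[OF Y(1)] in simp)
      have "Y + V \<subseteq># S" using subset_filters[OF Y(1) V(1)] .
      moreover have "size (Y + V) = 2 * n - 1" using Y(2) V(2) m n by simp
      moreover have szYV: "size (refls (Y + V)) = 2" using VU YU Y(2) by simp
      ultimately obtain T where T: "T \<subseteq># S" "size T = n" "pone n n T" "size (refls T) \<le> 2"
        using inner[of "Y + V"] by auto
      have "size (refls S) \<ge> 4" using split S False m n by linarith
      then show ?thesis using step[OF T(1-3)] T(4) by linarith
    qed
  qed
qed

theorem inverse_single:
  assumes m: "m \<ge> 2" and n: "n = 2 * m" and S: "size S = 2 * n - 1" and no: "\<not> pone n n S"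
  shows "extremal_form n (n - 1) (n - 1) S"
proof -
  define R where "R = image_mset snd (rots S)"
  have split: "size S = size (refls S) + size R" unfolding R_def using size_split[of S fst] by simp
  have nz: "\<not> zero_sum n n R" using rotations_pone no unfolding R_def by blast
  have "size (refls S) < 2"
  proof (rule ccontr)
    assume "\<not> ?thesis"
    then show False using pone_even[OF m, of S] S n no by simp
  qed
  moreover have "size R < 2 * n - 1"
  proof (rule ccontr)
    assume "\<not> ?thesis"
    then show False using egz[of n R] nz n m by simp
  qed
  ultimately have sizes: "size (refls S) = 1" "size R = 2 * n - 2" using split S by linarith+
  then have "\<exists>a b. two_valued n (n - 1) (n - 1) a b R" using egz_inverse[of n] nz m n unfolding egz_inverse_def by simp
  then show ?thesis using sizes(1) by (simp add: extremal_form_def R_def)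
qed

theorem inverse_double:
  assumes n: "n \<ge> 3" and S: "size S = 3 * n - 1" and no: "\<not> pone n (2 * n) S"
  shows "extremal_form n (2 * n - 1) (n - 1) S \<or> n = 3 \<and> exceptional_form S"
proof (cases "size (refls S) \<ge> 2")
  case True
  have "odd n"
  proof
    assume "even n"
    then obtain m where "n = 2 * m" by blast
    then show False using pone_even_double[of m n S] True S no n by simp
  qed
  then show ?thesis using pone_odd n S True no by blast
next
  case False
  define R where "R = image_mset snd (rots S)"
  have split: "size S = size (refls S) + size R" unfolding R_def using size_split[of S fst] by simp
  have nz: "\<not> zero_sum n (2 * n) R" using rotations_pone no unfolding R_def by blast
  have "size R < 3 * n - 1"
  proof (rule ccontr)
    assume "\<not> ?thesis"
    then show False using egz_multiple[where n=n and k=2 and M=R] nz n by (simp add: mult.commute)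
  qed
  then have sizes: "size (refls S) = 1" "size R = 3 * n - 2" using split S False by linarith+
  have "\<exists>a b. two_valued n (2 * n - 1) (n - 1) a b R"
  proof (rule egz_inverse_long)
    show "\<nexists>T1 T2. T1 + T2 \<subseteq># R \<and> size T1 = n \<and> size T2 = n \<and> int n dvd \<Sum>\<^sub># T1 \<and> int n dvd \<Sum>\<^sub># T2"
    proof
      assume "\<exists>T1 T2. T1 + T2 \<subseteq># R \<and> size T1 = n \<and> size T2 = n \<and> int n dvd \<Sum>\<^sub># T1 \<and> int n dvd \<Sum>\<^sub># T2"
      then obtain T1 T2 where "T1 + T2 \<subseteq># R" "size T1 = n" "size T2 = n" "int n dvd \<Sum>\<^sub># T1" "int n dvd \<Sum>\<^sub># T2" by blast
      then have "zero_sum n (2 * n) R" unfolding zero_sum_def by (intro exI[of _ "T1 + T2"]) simp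
      then show False using nz by simp
    qed
  qed (use n sizes egz_inverse[of n] in auto)
  then show ?thesis using sizes(1) by (simp add: extremal_form_def R_def)
qed

theorem direct_single:
  assumes m: "m \<ge> 2" and n: "n = 2 * m" and S: "size S \<ge> 2 * n"
  shows "pone n n S"
proof (cases "size (rots S) \<ge> 2 * n - 1")
  case True
  then have "zero_sum n n (image_mset snd (rots S))" using egz[of n] m n by simp
  then show ?thesis by (rule rotations_pone)
next
  case False
  then have "2 \<le> size (refls S)" using size_split[of S fst] S by linarith
  moreover have "2 \<le> 2 * n - 1" "2 * n - 1 \<le> size S" using S m n by linarith+
  ultimately obtain U where U: "U \<subseteq># S" "size U = 2 * n - 1" "2 \<le> size (refls U)"
    by (rule ex_subset_with_reflections)
  then have "pone n n U" using pone_even[OF m, of U] n by simp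
  then show ?thesis using U(1) pone_mono by blast
qed

text \<open>By \<open>inverse_double\<close> every subsequence of length 3n-1 with two or more
  reflections would have exactly three, and n = 3. But nine terms contain either eight with at least
  four reflections or eight with exactly two.\<close>

theorem direct_double:
  assumes n: "n \<ge> 3" and S: "size S \<ge> 3 * n"
  shows "pone n (2 * n) S"
proof (rule ccontr)
  assume no: "\<not> ?thesis"
  have split: "size S = size (refls S) + size (rots S)" by (rule size_split)
  have "size (rots S) < 3 * n - 1"
  proof (rule ccontr)
    assume "\<not> ?thesis"
    then have "zero_sum n (2 * n) (image_mset snd (rots S))"
      using egz_multiple[where n=n and k=2 and M="image_mset snd (rots S)"] n by (simp add: mult.commute)
    then show False using rotations_pone no by blast
  qed
  then have q: "2 \<le> size (refls S)" using split S by linarith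
  have three: "n = 3 \<and> size (refls U) = 3" if U: "U \<subseteq># S" "size U = 3 * n - 1" "2 \<le> size (refls U)" for U
  proof -
    have "\<not> pone n (2 * n) U" using U(1) no pone_mono by blast
    then have "extremal_form n (2 * n - 1) (n - 1) U \<or> n = 3 \<and> exceptional_form U" using inverse_double n U(2) by blast
    then show ?thesis using U(3) by (auto simp: extremal_form_def exceptional_form_def)
  qed
  have le: "4 \<le> 3 * n - 1" "2 \<le> 3 * n - 1" "3 * n - 1 \<le> size S" using n S by linarith+
  obtain U where U: "U \<subseteq># S" "size U = 3 * n - 1" "2 \<le> size (refls U)"
    using ex_subset_with_reflections[OF q le(2,3)] .
  then have n3: "n = 3" using three by blast
  show False
  proof (cases "4 \<le> size (refls S)")
    case True
    obtain U where "U \<subseteq># S" "size U = 3 * n - 1" "4 \<le> size (refls U)"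
      using ex_subset_with_reflections[OF True le(1,3)] .
    then show False using three[of U] by simp
  next
    case False
    obtain Y where Y: "Y \<subseteq># refls S" "size Y = 2" using ex_subset_size[OF q] .
    have "6 \<le> size (rots S)" using split S n3 False by linarith
    then obtain V where V: "V \<subseteq># rots S" "size V = 6" by (rule ex_subset_size)
    have "refls V = {#}" by (rule filter_mset_none) (use mset_subset_eqD[OF V(1)] in simp)
    moreover have "refls Y = Y" by (rule filter_mset_all) (use mset_subset_eqD[OF Y(1)] in simp)
    ultimately have "size (refls (Y + V)) = 2" using Y(2) by simp
    moreover have "Y + V \<subseteq># S" using subset_filters[OF Y(1) V(1)] .
    ultimately show False using three[of "Y + V"] Y(2) V(2) n3 by simp
  qed
qed

section \<open>The extremal sequences have no product-one subsequence of the given length\<close>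

lemma even_reflections: "dval T w \<Longrightarrow> even (size (refls T))"
  unfolding dval_def using fst_dprod by (metis fst_conv)

lemma dval_rotations_unique:
  assumes "dval T w" "\<And>x. x \<in># T \<Longrightarrow> \<not> fst x" shows "w = (\<Sum>x\<in>#T. snd x)"
proof -
  obtain xs where xs: "mset xs = T" "dprod xs = (False, w)" using assms(1) by (auto simp: dval_def)
  have "\<forall>x\<in>set xs. \<not> fst x" using assms(2) xs(1) by (metis set_mset_mset)
  then have "dprod xs = (False, \<Sum>x\<in>#mset xs. snd x)" by (induction xs) (auto simp: dmul_def)
  then show ?thesis using xs by simp
qed

text \<open>A product one uses an even number of reflections, here none, and rotations
  commute.\<close>

lemma pone_one_reflection:
  assumes "size (refls S) = 1" "pone n k S"
  shows "zero_sum n k (image_mset snd (rots S))"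
proof -
  obtain T w where T: "T \<subseteq># S" "size T = k" "dval T w" "int n dvd w" using assms(2) unfolding pone_def by blast
  have "size (refls T) \<le> 1" using size_mset_mono[OF multiset_filter_mono[OF T(1), of fst]] assms(1) by simp
  moreover have "size (refls T) \<noteq> 1" using even_reflections[OF T(3)] by auto
  ultimately have "size (refls T) = 0" by linarith
  then have nr: "refls T = {#}" by simp
  have rot: "\<not> fst x" if "x \<in># T" for x
  proof
    assume "fst x"
    then have "x \<in># refls T" using that by simp
    then show False unfolding nr by simp
  qed
  then have "rots T = T" by (intro filter_mset_all)
  then have "T \<subseteq># rots S" using multiset_filter_mono[OF T(1), of "\<lambda>x. \<not> fst x"] by simp
  then have "image_mset snd T \<subseteq># image_mset snd (rots S)" by (rule image_mset_subseteq_mono)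
  moreover have "int n dvd \<Sum>\<^sub># (image_mset snd T)" using T(4) dval_rotations_unique[OF T(3) rot] by simp
  ultimately show ?thesis using T(2) unfolding zero_sum_def by (intro exI[of _ "image_mset snd T"]) simp
qed

text \<open>The multiplicity l of the first value in a zero-sum is a multiple of n by
  \<open>two_valued_zero_sum\<close>. The hypothesis \<open>no\<close> leaves the remaining
  arithmetic to the two shapes.\<close>

lemma two_valued_no_zero_sum:
  assumes tv: "two_valued n i j a b M" and n: "n \<ge> 2" and no: "\<And>l. \<lbrakk>l \<le> i; k - l \<le> j; n dvd l; l \<le> k\<rbrakk> \<Longrightarrow> False"
    and nk: "n dvd k"
  shows "\<not> zero_sum n k M"
proof
  assume "zero_sum n k M"
  then have "zero_sum n k (residues n M)" by (simp add: zero_sum_mod)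
  then obtain T where T: "T \<subseteq># residues n M" "size T = k" "int n dvd \<Sum>\<^sub># T" by (auto simp: zero_sum_def)
  have cop: "coprime (a - b) (int n)" using tv by (simp add: two_valued_def)
  define a' b' where "a' = a mod int n" and "b' = b mod int n"
  have ne: "a' \<noteq> b'" using coprime_residues_distinct[OF cop n] by (simp add: a'_def b'_def)
  have sub: "T \<subseteq># replicate_mset i a' + replicate_mset j b'" using T(1) tv by (simp add: two_valued_def a'_def b'_def)
  have "set_mset T \<subseteq> {a', b'}" using set_mset_mono[OF sub] by (auto split: if_splits)
  then have Teq: "T = replicate_mset (count T a') a' + replicate_mset (count T b') b'" using ne by (rule mset_two_elements)
  have le: "count T a' \<le> i" "count T b' \<le> j"
    using mset_subset_eq_count[OF sub, of a'] mset_subset_eq_count[OF sub, of b'] ne by simp_all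
  have sz: "count T a' + count T b' = k" using arg_cong[OF Teq, of size] T(2) by simp
  have "n dvd count T a'"
  proof (rule two_valued_zero_sum[OF cop])
    show "T = replicate_mset (count T a') (a mod int n) + replicate_mset (count T b') (b mod int n)"
      using Teq unfolding a'_def b'_def .
  qed (use sz nk T(3) in simp_all)
  moreover have "k - count T a' \<le> j" "count T a' \<le> k" using le sz by linarith+
  ultimately show False using no[of "count T a'"] le by blast
qed

theorem extremal_single:
  assumes "n \<ge> 2" "extremal_form n (n - 1) (n - 1) S" shows "\<not> pone n n S"
proof
  assume p: "pone n n S"
  obtain a b where tv: "two_valued n (n - 1) (n - 1) a b (image_mset snd (rots S))"
    and q: "size (refls S) = 1" using assms(2) by (auto simp: extremal_form_def)
  have "\<not> zero_sum n n (image_mset snd (rots S))"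
  proof (rule two_valued_no_zero_sum[OF tv assms(1)])
    fix l assume "l \<le> n - 1" "n - l \<le> n - 1" "n dvd l"
    then show False using dvd_imp_le[of n l] assms(1) by (cases "l = 0") auto
  qed simp
  then show False using pone_one_reflection[OF q p] by blast
qed

theorem extremal_double:
  assumes "n \<ge> 2" "extremal_form n (2 * n - 1) (n - 1) S" shows "\<not> pone n (2 * n) S"
proof
  assume p: "pone n (2 * n) S"
  obtain a b where tv: "two_valued n (2 * n - 1) (n - 1) a b (image_mset snd (rots S))"
    and q: "size (refls S) = 1" using assms(2) by (auto simp: extremal_form_def)
  have "\<not> zero_sum n (2 * n) (image_mset snd (rots S))"
  proof (rule two_valued_no_zero_sum[OF tv assms(1)])
    fix l assume l: "l \<le> 2 * n - 1" "2 * n - l \<le> n - 1" "n dvd l"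
    \<comment> \<open>The bounds say n < l < 2n, where there is no multiple of n.\<close>
    then obtain c where c: "l = n * c" by blast
    have "n * 1 < n * c" "n * c < n * 2" using l c assms(1) by linarith+
    then have "1 < c" "c < 2" using nat_mult_less_cancel_disj by blast+
    then show False by simp
  qed simp
  then show False using pone_one_reflection[OF q p] by blast
qed

lemma dprod_filter_reflections:
  assumes "\<forall>x\<in>set xs. \<not> fst x \<longrightarrow> n dvd snd x"
  shows "fst (dprod xs) = fst (dprod (filter fst xs)) \<and> [snd (dprod xs) = snd (dprod (filter fst xs))] (mod n)"
  using assms
proof (induction xs)
  case (Cons x xs)
  then have IH: "fst (dprod xs) = fst (dprod (filter fst xs))" "[snd (dprod xs) = snd (dprod (filter fst xs))] (mod n)"
    by simp_all
  show ?case
  proof (cases "fst x")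
    case True
    then show ?thesis using IH cong_diff[OF cong_refl IH(2)] by (simp add: dmul_def)
  next
    case False
    then have "[snd x = 0] (mod n)" using Cons.prems by (simp add: cong_0_iff)
    from cong_add[OF this IH(2)] show ?thesis using False IH(1) by (simp add: dmul_def)
  qed
qed simp

text \<open>Six terms cannot all be among the five rotations, so an even number of the three
  reflections occurs, namely two. The rotations are trivial modulo 3, and the product is the nonzero
  difference of two distinct residues.\<close>

theorem exceptional_no_pone:
  assumes "exceptional_form S" shows "\<not> pone 3 6 S"
proof
  assume "pone 3 6 S"
  then obtain T w where T: "T \<subseteq># S" "size T = 6" "dval T w" "3 dvd w" unfolding pone_def by auto
  have S: "\<forall>x\<in>#S. \<not> fst x \<longrightarrow> 3 dvd snd x" "size (refls S) = 3" "size (rots S) = 5"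
    "image_mset (\<lambda>x. snd x mod 3) (refls S) = mset_set {0..<3}" using assms by (auto simp: exceptional_form_def)
  define F where "F = refls T"
  have FS: "F \<subseteq># refls S" unfolding F_def using T(1) by (rule multiset_filter_mono)
  have "size F \<le> 3" using size_mset_mono[OF FS] S(2) by simp
  moreover have "even (size F)" using even_reflections[OF T(3)] by (simp add: F_def)
  moreover have "size F \<noteq> 0"
  proof
    assume "size F = 0"
    then have "size (rots T) = 6" using size_split[of T fst] T(2) unfolding F_def by linarith
    moreover have "size (rots T) \<le> 5"
      using size_mset_mono[OF multiset_filter_mono[OF T(1), of "\<lambda>x. \<not> fst x"]] S(3) by simp
    ultimately show False by simp
  qed
  ultimately have szF: "size F = 2" by presburger
  obtain xs where xs: "mset xs = T" "dprod xs = (False, w)" using T(3) by (auto simp: dval_def)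
  define ys where "ys = filter fst xs"
  have ysF: "mset ys = F" unfolding ys_def F_def xs(1)[symmetric] by (rule mset_filter)
  then have "length ys = 2" using szF by (metis size_mset)
  then obtain x y where ys: "ys = [x, y]" by (auto simp: numeral_2_eq_2 length_Suc_conv)
  have "\<forall>z\<in>set ys. fst z" by (simp add: ys_def)
  then have fxy: "fst x" "fst y" unfolding ys by simp_all
  have "\<forall>x\<in>set xs. \<not> fst x \<longrightarrow> 3 dvd snd x" using S(1) T(1) xs(1) by (metis mset_subset_eqD set_mset_mset)
  from dprod_filter_reflections[OF this] have "[w = snd x - snd y] (mod 3)"
    using xs(2) fxy unfolding ys_def[symmetric] ys by (simp add: dmul_def)
  then have "3 dvd snd x - snd y" using T(4) cong_dvd_iff by blast
  then have "snd x mod 3 = snd y mod 3" by (metis mod_eq_dvd_iff)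
  moreover have "snd x mod 3 \<noteq> snd y mod 3"
  proof (rule count_le_1_distinct[where key="\<lambda>x. snd x mod 3" and L="refls S"])
    show "{#x, y#} \<subseteq># refls S" using FS ysF ys by simp
    show "count (image_mset (\<lambda>x. snd x mod 3) (refls S)) k \<le> 1" for k
      unfolding S(4) by (simp add: count_mset_set')
  qed
  ultimately show False by blast
qed

section \<open>Dihedral groups\<close>

text \<open>The letter for \<tau> and its formal inverse have the same value because
  \<open>(True, 0)\<close> is an involution.\<close>

definition letter_value :: "dihedral_gen \<times> bool \<Rightarrow> dih" where
  "letter_value l = (case fst l of Alpha \<Rightarrow> (False, if snd l then 1 else - 1) | Tau \<Rightarrow> (True, 0))"

definition word_dih :: "dihedral_gen word \<Rightarrow> dih" where
  "word_dih w = dprod (map letter_value w)"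

definition dcong :: "nat \<Rightarrow> dih \<Rightarrow> dih \<Rightarrow> bool" where
  "dcong n g h \<longleftrightarrow> fst g = fst h \<and> [snd g = snd h] (mod int n)"

lemma dcong_dmul: "dcong n g g' \<Longrightarrow> dcong n h h' \<Longrightarrow> dcong n (dmul g h) (dmul g' h')"
  unfolding dcong_def dmul_def by (auto intro: cong_add cong_diff)

lemma word_dih_replicate: "word_dih (replicate k (Alpha, b)) = (False, if b then int k else - int k)"
  by (induction k) (auto simp: word_dih_def letter_value_def dmul_def)

text \<open>The infinite dihedral group modulo \<open>n\<close> is a model of the presentation, which shows that the
  presented group has no fewer than \<open>2n\<close> elements.\<close>

lemma word_equiv_dcong:
  assumes "word_equiv (dihedral_relations n) u v" shows "dcong n (word_dih u) (word_dih v)"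
  using assms
proof (induction rule: word_equiv.induct)
  case (relation u v)
  then consider "u = replicate n (Alpha, True)" "v = []" | "u = replicate 2 (Tau, True)" "v = []"
    | "u = [(Tau, True), (Alpha, True)]" "v = [(Alpha, False), (Tau, True)]"
    by (auto simp: dihedral_relations_def)
  then show ?case
  proof cases
    case 1
    then show ?thesis using word_dih_replicate[of n True] by (simp add: dcong_def word_dih_def cong_0_iff)
  qed (auto simp: dcong_def word_dih_def letter_value_def dmul_def numeral_2_eq_2)
next
  case (cancel x b)
  then show ?case by (cases x) (auto simp: dcong_def word_dih_def letter_value_def dmul_def)
next
  case (append u u' v v')
  then show ?case using dcong_dmul by (simp add: word_dih_def)
next
  case (refl u)
  then show ?case by (simp add: dcong_def)
next
  case (sym u v)
  then show ?case by (auto simp: dcong_def intro: cong_sym)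
next
  case (trans u v w)
  then show ?case by (auto simp: dcong_def intro: cong_trans)
qed

lemma mset_eq_image_msetE:
  assumes "mset ys = image_mset f S"
  obtains xs where "mset xs = S" "map f xs = ys"
proof -
  have "\<exists>xs. mset xs = S \<and> map f xs = ys" using assms
  proof (induction ys arbitrary: S)
    case (Cons y ys)
    then obtain x S' where "S = add_mset x S'" "y = f x" "mset ys = image_mset f S'"
      by (metis mset.simps(2) msed_map_invR)
    then show ?case using Cons.IH[of S'] by (metis list.simps(9) mset.simps(2))
  qed simp
  then show ?thesis using that by blast
qed

text \<open>Worded as in the theorem, with the multiplicities as parameters, so that unfolding it at
  the end yields the statement literally.\<close>

definition extremal_sequence ::
    "('a, 'b) monoid_scheme \<Rightarrow> nat \<Rightarrow> 'a \<Rightarrow> 'a \<Rightarrow> nat \<Rightarrow> nat \<Rightarrow> 'a multiset \<Rightarrow> bool" where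
  "extremal_sequence G n \<alpha> \<tau> i j S \<longleftrightarrow>
     (\<exists>r1\<in>{0..int n - 1}. \<exists>r2\<in>{0..int n - 1}. \<exists>r3\<in>{0..int n - 1}.
       gcd (r1 - r2) (int n) = 1 \<and>
       S = replicate_mset i (\<alpha> [^]\<^bsub>G\<^esub> r1) + replicate_mset j (\<alpha> [^]\<^bsub>G\<^esub> r2)
           + {#\<alpha> [^]\<^bsub>G\<^esub> r3 \<otimes>\<^bsub>G\<^esub> \<tau>#})"

definition three_reflections :: "('a, 'b) monoid_scheme \<Rightarrow> 'a \<Rightarrow> 'a \<Rightarrow> 'a multiset \<Rightarrow> bool" where
  "three_reflections G \<alpha> \<tau> S \<longleftrightarrow>
     S = replicate_mset 5 \<one>\<^bsub>G\<^esub> + {#\<tau>#} + {#\<alpha> \<otimes>\<^bsub>G\<^esub> \<tau>#} + {#\<alpha> [^]\<^bsub>G\<^esub> (2::int) \<otimes>\<^bsub>G\<^esub> \<tau>#}"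

lemma filter_mset_replicate: "filter_mset P (replicate_mset k x) = (if P x then replicate_mset k x else {#})"
  by (induction k) auto

locale dihedral =
  fixes G :: "('a, 'b) monoid_scheme" (structure) and n :: nat and \<alpha> \<tau> :: 'a
  assumes presentation: "dihedral_presentation G n \<alpha> \<tau>" and n3: "n \<ge> 3"
begin

lemma group_G: "group G"
  using presentation by (simp add: dihedral_presentation_def has_presentation_def)

sublocale group G by (rule group_G)

lemma gens [simp]: "\<alpha> \<in> carrier G" "\<tau> \<in> carrier G"
proof -
  have "range (case_dihedral_gen \<alpha> \<tau>) \<subseteq> carrier G"
    using presentation by (simp add: dihedral_presentation_def has_presentation_def)
  then have "case_dihedral_gen \<alpha> \<tau> Alpha \<in> carrier G" "case_dihedral_gen \<alpha> \<tau> Tau \<in> carrier G" by blast+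
  then show "\<alpha> \<in> carrier G" "\<tau> \<in> carrier G" by simp_all
qed

abbreviation wv :: "dihedral_gen word \<Rightarrow> 'a" where
  "wv \<equiv> word_value G (case_dihedral_gen \<alpha> \<tau>)"

lemma word_value_eq_iff: "word_equiv (dihedral_relations n) u v \<longleftrightarrow> wv u = wv v"
  using presentation by (simp add: dihedral_presentation_def has_presentation_def)

lemma wv_simps [simp]: "wv [] = \<one>" "wv ((Alpha, True) # w) = \<alpha> \<otimes> wv w" "wv ((Alpha, False) # w) = inv \<alpha> \<otimes> wv w"
  "wv ((Tau, b) # w) = (if b then \<tau> else inv \<tau>) \<otimes> wv w"
  by (simp_all add: word_value_def)

lemma wv_closed [simp]: "wv w \<in> carrier G"
proof (induction w)
  case (Cons l w)
  obtain x b where "l = (x, b)" by (cases l)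
  then show ?case using Cons by (cases x; cases b) auto
qed simp

lemma wv_replicate: "wv (replicate k (Alpha, True) @ w) = \<alpha> [^] k \<otimes> wv w"
  "wv (replicate k (Alpha, False) @ w) = inv (\<alpha> [^] k) \<otimes> wv w"
proof (induction k)
  case (Suc k)
  case 1
  have "\<alpha> [^] Suc k \<otimes> wv w = (\<alpha> \<otimes> \<alpha> [^] k) \<otimes> wv w" by (simp only: nat_pow_Suc2 gens)
  then show ?case using Suc(1) by (simp add: m_assoc)
next
  case (Suc k)
  case 2
  then show ?case using Suc(2) by (simp add: m_assoc nat_pow_Suc2 inv_mult_group nat_pow_Suc del: nat_pow_Suc2)
qed simp_all

lemma alpha_pow_n: "\<alpha> [^] n = \<one>"
proof -
  have "word_equiv (dihedral_relations n) (replicate n (Alpha, True)) []"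
    by (rule word_equiv.relation) (simp add: dihedral_relations_def)
  then have "wv (replicate n (Alpha, True)) = \<one>" using word_value_eq_iff by fastforce
  then show ?thesis using wv_replicate(1)[of n "[]"] by simp
qed

lemma tau_square: "\<tau> \<otimes> \<tau> = \<one>"
proof -
  have "word_equiv (dihedral_relations n) (replicate 2 (Tau, True)) []"
    by (rule word_equiv.relation) (simp add: dihedral_relations_def)
  then have "wv (replicate 2 (Tau, True)) = \<one>" using word_value_eq_iff by fastforce
  then show ?thesis by (simp add: numeral_2_eq_2)
qed

lemma tau_alpha: "\<tau> \<otimes> \<alpha> = inv \<alpha> \<otimes> \<tau>"
proof -
  have "word_equiv (dihedral_relations n) [(Tau, True), (Alpha, True)] [(Alpha, False), (Tau, True)]"
    by (rule word_equiv.relation) (simp add: dihedral_relations_def)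
  then have "wv [(Tau, True), (Alpha, True)] = wv [(Alpha, False), (Tau, True)]" using word_value_eq_iff by blast
  then show ?thesis by simp
qed

lemma tau_alpha_nat: "\<tau> \<otimes> \<alpha> [^] (k::nat) = inv (\<alpha> [^] k) \<otimes> \<tau>"
proof (induction k)
  case (Suc k)
  have "\<tau> \<otimes> \<alpha> [^] Suc k = (\<tau> \<otimes> \<alpha> [^] k) \<otimes> \<alpha>" by (simp add: m_assoc)
  also have "\<dots> = inv (\<alpha> [^] k) \<otimes> (\<tau> \<otimes> \<alpha>)" using Suc by (simp add: m_assoc)
  also have "\<dots> = (inv (\<alpha> [^] k) \<otimes> inv \<alpha>) \<otimes> \<tau>" by (simp add: tau_alpha m_assoc)
  also have "inv (\<alpha> [^] k) \<otimes> inv \<alpha> = inv (\<alpha> \<otimes> \<alpha> [^] k)" by (simp add: inv_mult_group)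
  also have "\<alpha> \<otimes> \<alpha> [^] k = \<alpha> [^] Suc k" by (simp only: nat_pow_Suc2 gens)
  finally show ?case .
qed simp

lemma tau_alpha_int: "\<tau> \<otimes> \<alpha> [^] (x::int) = \<alpha> [^] (- x) \<otimes> \<tau>"
proof (cases "x \<ge> 0")
  case True
  then obtain k where k: "x = int k" using nonneg_int_cases by blast
  show ?thesis unfolding k using tau_alpha_nat[of k] by (simp add: int_pow_int int_pow_neg_int)
next
  case False
  define k where "k = nat (- x)"
  then have k: "x = - int k" using False by simp
  have "\<tau> = \<alpha> [^] k \<otimes> (\<tau> \<otimes> \<alpha> [^] k)" by (simp add: tau_alpha_nat m_assoc[symmetric])
  then have "\<tau> \<otimes> inv (\<alpha> [^] k) = (\<alpha> [^] k \<otimes> (\<tau> \<otimes> \<alpha> [^] k)) \<otimes> inv (\<alpha> [^] k)" by simp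
  also have "\<dots> = \<alpha> [^] k \<otimes> \<tau>" by (simp add: m_assoc)
  finally show ?thesis unfolding k by (simp add: int_pow_int int_pow_neg_int)
qed

section \<open>The projection of the infinite dihedral group onto G\<close>

definition phi :: "dih \<Rightarrow> 'a" where
  "phi g = \<alpha> [^] snd g \<otimes> (if fst g then \<tau> else \<one>)"

lemma phi_closed [simp]: "phi g \<in> carrier G"
  by (simp add: phi_def)

lemma phi_rotation: "phi (False, x) = \<alpha> [^] x" and phi_reflection: "phi (True, x) = \<alpha> [^] x \<otimes> \<tau>"
  by (simp_all add: phi_def)

lemma phi_one: "phi (False, 0) = \<one>"
  by (simp add: phi_def)

lemma phi_dmul: "phi (dmul g h) = phi g \<otimes> phi h"
proof (cases "fst g")
  case False
  then show ?thesis by (auto simp: phi_def dmul_def int_pow_mult m_assoc)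
next
  case True
  have "phi g \<otimes> phi h = \<alpha> [^] snd g \<otimes> (\<tau> \<otimes> \<alpha> [^] snd h) \<otimes> (if fst h then \<tau> else \<one>)"
    using True by (simp add: phi_def m_assoc)
  also have "\<dots> = (\<alpha> [^] snd g \<otimes> \<alpha> [^] (- snd h)) \<otimes> (\<tau> \<otimes> (if fst h then \<tau> else \<one>))"
    unfolding tau_alpha_int by (simp add: m_assoc)
  also have "\<alpha> [^] snd g \<otimes> \<alpha> [^] (- snd h) = \<alpha> [^] (snd g - snd h)"
    by (simp add: int_pow_mult[symmetric])
  also have "\<tau> \<otimes> (if fst h then \<tau> else \<one>) = (if fst h then \<one> else \<tau>)" by (simp add: tau_square)
  finally show ?thesis using True by (simp add: phi_def dmul_def)
qed

lemma phi_dprod: "foldr (\<otimes>) (map phi xs) \<one> = phi (dprod xs)"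
  by (induction xs) (simp_all add: phi_one phi_dmul)

text \<open>If the image is trivial, a word for \<open>g\<close> is equivalent to the empty word by
  the presentation, and \<open>word_equiv_dcong\<close> transports this to the model, where
  \<open>g\<close> itself can be read off.\<close>

lemma phi_eq_one_iff: "phi g = \<one> \<longleftrightarrow> \<not> fst g \<and> int n dvd snd g"
proof
  assume g: "phi g = \<one>"
  define w where "w = (if snd g \<ge> 0 then replicate (nat (snd g)) (Alpha, True) else replicate (nat (- snd g)) (Alpha, False))
    @ (if fst g then [(Tau, True)] else [])"
  have "wv w = phi g"
  proof (cases "snd g \<ge> 0")
    case True
    then obtain k where "snd g = int k" using nonneg_int_cases by blast
    then show ?thesis by (simp add: w_def wv_replicate phi_def int_pow_int)
  next
    case False
    then have "snd g = - int (nat (- snd g))" "nat (- snd g) > 0" by auto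
    then obtain k where "snd g = - int k" "k > 0" by blast
    then show ?thesis by (simp add: w_def wv_replicate phi_def int_pow_neg_int)
  qed
  then have "word_equiv (dihedral_relations n) w []" using word_value_eq_iff g by simp
  then have "dcong n (word_dih w) (word_dih [])" by (rule word_equiv_dcong)
  moreover have "word_dih w = g"
  proof -
    have "word_dih w = dmul (False, snd g) (fst g, 0)"
      using word_dih_replicate[of "nat (snd g)" True] word_dih_replicate[of "nat (- snd g)" False]
      by (auto simp: w_def word_dih_def letter_value_def dmul_def prod_eq_iff)
    then show ?thesis by (simp add: dmul_def prod_eq_iff)
  qed
  ultimately show "\<not> fst g \<and> int n dvd snd g" by (simp add: dcong_def word_dih_def cong_0_iff)
next
  assume g: "\<not> fst g \<and> int n dvd snd g"
  then obtain k where "snd g = int n * k" by blast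
  then show "phi g = \<one>" using g alpha_pow_n by (simp add: phi_def int_pow_pow[symmetric] int_pow_int)
qed

lemma phi_eq_iff: "phi g = phi h \<longleftrightarrow> dcong n g h"
proof -
  define h' where "h' = (fst h, if fst h then snd h else - snd h)"
  have "dmul h h' = (False, 0)" by (simp add: h'_def dmul_def)
  then have h: "phi h \<otimes> phi h' = \<one>" using phi_dmul phi_one by metis
  have "phi g = phi h \<longleftrightarrow> phi g \<otimes> phi h' = phi h \<otimes> phi h'" by (rule right_cancel[symmetric]) simp_all
  also have "\<dots> \<longleftrightarrow> phi (dmul g h') = \<one>" unfolding h by (simp add: phi_dmul)
  also have "\<dots> \<longleftrightarrow> dcong n g h" unfolding phi_eq_one_iff by (auto simp: h'_def dmul_def dcong_def cong_iff_dvd_diff)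
  finally show ?thesis .
qed

lemma phi_surj: "g \<in> carrier G \<Longrightarrow> \<exists>b. \<exists>x\<in>{0..<int n}. g = phi (b, x)"
proof -
  have sub: "subgroup (range phi) G"
  proof (rule subgroupI)
    fix a assume "a \<in> range phi"
    then obtain g where g: "a = phi g" by blast
    define g' where "g' = (fst g, if fst g then snd g else - snd g)"
    have "dmul g' g = (False, 0)" by (simp add: g'_def dmul_def)
    then have "phi g' \<otimes> phi g = \<one>" using phi_dmul phi_one by metis
    then show "inv a \<in> range phi" using g by (simp add: inv_equality)
  next
    fix a b assume "a \<in> range phi" "b \<in> range phi"
    then obtain g h where "a = phi g" "b = phi h" by blast
    then have "a \<otimes> b = phi (dmul g h)" by (simp add: phi_dmul)
    then show "a \<otimes> b \<in> range phi" by blast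
  qed auto
  have "phi (False, 1) = \<alpha>" "phi (True, 0) = \<tau>" by (simp_all add: phi_def)
  then have "range (case_dihedral_gen \<alpha> \<tau>) \<subseteq> range phi"
  proof (intro subsetI)
    fix x assume "x \<in> range (case_dihedral_gen \<alpha> \<tau>)"
    then obtain d where "x = case_dihedral_gen \<alpha> \<tau> d" by blast
    then have "x = phi (False, 1) \<or> x = phi (True, 0)"
      using \<open>phi (False, 1) = \<alpha>\<close> \<open>phi (True, 0) = \<tau>\<close> by (cases d) simp_all
    then show "x \<in> range phi" by blast
  qed
  then have "generate G (range (case_dihedral_gen \<alpha> \<tau>)) \<subseteq> range phi" by (rule generate_subgroup_incl[OF _ sub])
  then have car: "carrier G \<subseteq> range phi" using presentation by (simp add: dihedral_presentation_def has_presentation_def)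
  assume "g \<in> carrier G"
  then obtain b x where "g = phi (b, x)" using car by auto
  also have "phi (b, x) = phi (b, x mod int n)" by (simp add: phi_eq_iff dcong_def)
  finally have "g = phi (b, x mod int n)" .
  moreover have "x mod int n \<in> {0..<int n}" using n3 by simp
  ultimately show ?thesis by blast
qed

lemma order_G: "order G = 2 * n"
proof -
  have "bij_betw phi (UNIV \<times> {0..<int n}) (carrier G)"
  proof (rule bij_betw_imageI)
    show "inj_on phi (UNIV \<times> {0..<int n})" by (auto simp: inj_on_def phi_eq_iff dcong_def cong_def)
    show "phi ` (UNIV \<times> {0..<int n}) = carrier G" using phi_surj by (fastforce simp: image_iff)
  qed
  then have "card (carrier G) = card (UNIV \<times> {0..<int n} :: dih set)" by (simp add: bij_betw_same_card)
  then show ?thesis by (simp add: order_def card_cartesian_product UNIV_bool)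
qed

lemma phi_pow: "phi (False, x) [^] (k::nat) = phi (False, int k * x)"
  by (induction k) (simp_all add: phi_one phi_dmul[symmetric] dmul_def algebra_simps)

text \<open>Reflections have order 2, which divides n only for even n; \<alpha> has order n.\<close>

lemma exponent_G: assumes "even n" shows "group_exponent G = n"
proof (rule dvd_antisym)
  show "group_exponent G dvd n" unfolding group_exponent_def
  proof (rule Lcm_least)
    fix k assume "k \<in> ord ` carrier G"
    then obtain g where g: "k = ord g" "g \<in> carrier G" by blast
    then obtain b x where x: "g = phi (b, x)" using phi_surj by blast
    have "g [^] n = \<one>"
    proof (cases b)
      case True
      have "g \<otimes> g = \<one>" using True by (simp add: x phi_dmul[symmetric] dmul_def phi_one)
      moreover obtain m where "n = 2 * m" using assms by blast
      moreover have "g [^] (2::nat) = g \<otimes> g" using g(2) by (simp add: numeral_2_eq_2)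
      ultimately show ?thesis using g(2) nat_pow_pow[of g 2 m] by simp
    next
      case False
      then show ?thesis by (simp add: x phi_pow phi_eq_one_iff)
    qed
    then show "k dvd n" using g pow_eq_id by simp
  qed
  have "phi (False, int (ord \<alpha>)) = \<one>" using phi_pow[of 1 "ord \<alpha>"] by (simp add: phi_rotation)
  then have "n dvd ord \<alpha>" by (simp add: phi_eq_one_iff)
  also have "ord \<alpha> dvd group_exponent G" unfolding group_exponent_def by (rule dvd_Lcm) simp
  finally show "n dvd group_exponent G" .
qed

lemma product_one_phi: "product_one G (image_mset phi S) \<longleftrightarrow> (\<exists>w. dval S w \<and> int n dvd w)"
proof
  assume "product_one G (image_mset phi S)"
  then obtain ys where ys: "mset ys = image_mset phi S" "foldr (\<otimes>) ys \<one> = \<one>" by (auto simp: product_one_def)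
  obtain xs where xs: "mset xs = S" "map phi xs = ys" using mset_eq_image_msetE[OF ys(1)] .
  then have "phi (dprod xs) = \<one>" using ys(2) phi_dprod by metis
  then have "dprod xs = (False, snd (dprod xs))" "int n dvd snd (dprod xs)" unfolding phi_eq_one_iff by (simp_all add: prod_eq_iff)
  then show "\<exists>w. dval S w \<and> int n dvd w" using xs(1) unfolding dval_def by blast
next
  assume "\<exists>w. dval S w \<and> int n dvd w"
  then obtain xs w where xs: "mset xs = S" "dprod xs = (False, w)" "int n dvd w" by (auto simp: dval_def)
  then have "foldr (\<otimes>) (map phi xs) \<one> = \<one>" by (simp add: phi_dprod phi_eq_one_iff)
  then show "product_one G (image_mset phi S)" unfolding product_one_def using xs(1) by (intro exI[of _ "map phi xs"]) simp
qed

lemma has_product_one_phi: "has_product_one_subsequence G k (image_mset phi S) \<longleftrightarrow> pone n k S"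
proof
  assume "has_product_one_subsequence G k (image_mset phi S)"
  then obtain T where T: "T \<subseteq># image_mset phi S" "size T = k" "product_one G T" by (auto simp: has_product_one_subsequence_def)
  obtain T' where T': "T' \<subseteq># S" "T = image_mset phi T'" using subset_image_msetE[OF T(1)] .
  then show "pone n k S" using T product_one_phi[of T'] unfolding pone_def by auto
next
  assume "pone n k S"
  then obtain T w where "T \<subseteq># S" "size T = k" "dval T w" "int n dvd w" unfolding pone_def by blast
  then show "has_product_one_subsequence G k (image_mset phi S)"
    unfolding has_product_one_subsequence_def using product_one_phi[of T]
    by (intro exI[of _ "image_mset phi T"]) (auto simp: image_mset_subseteq_mono)
qed

text \<open>Exponents are chosen in [0, n-1], as the ranges of r1, r2, r3 in the theorem
  require.\<close>

lemma lift:
  assumes "set_mset S \<subseteq> carrier G"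
  obtains S' where "S = image_mset phi S'" "\<And>x. x \<in># S' \<Longrightarrow> 0 \<le> snd x \<and> snd x < int n"
proof -
  have "\<forall>g\<in>carrier G. \<exists>d. g = phi d \<and> 0 \<le> snd d \<and> snd d < int n" using phi_surj by fastforce
  then obtain c where c: "\<And>g. g \<in> carrier G \<Longrightarrow> g = phi (c g) \<and> 0 \<le> snd (c g) \<and> snd (c g) < int n" by metis
  have "image_mset phi (image_mset c S) = image_mset (\<lambda>g. g) S"
    unfolding multiset.map_comp comp_def by (rule image_mset_cong) (use c assms in auto)
  then have "S = image_mset phi (image_mset c S)" by simp
  moreover have "0 \<le> snd x \<and> snd x < int n" if x: "x \<in># image_mset c S" for x
  proof -
    obtain g where "g \<in># S" "x = c g" using x by auto
    then show ?thesis using c[of g] assms by auto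
  qed
  ultimately show ?thesis by (rule that)
qed

section \<open>Translation of the extremal forms to G and the two constants\<close>

abbreviation rotation_form :: "nat \<Rightarrow> nat \<Rightarrow> 'a multiset \<Rightarrow> bool" where
  "rotation_form \<equiv> extremal_sequence G n \<alpha> \<tau>"

lemma rotation_form_size: "rotation_form i j S \<Longrightarrow> size S = i + j + 1"
  by (auto simp: extremal_sequence_def)

lemma extremal_lift:
  assumes "rotation_form i j S"
  shows "\<exists>S'. S = image_mset phi S' \<and> extremal_form n i j S'"
  using assms unfolding extremal_sequence_def
proof (elim bexE conjE)
  fix r1 r2 r3 :: int
  assume r: "gcd (r1 - r2) (int n) = 1"
    "S = replicate_mset i (\<alpha> [^] r1) + replicate_mset j (\<alpha> [^] r2) + {#\<alpha> [^] r3 \<otimes> \<tau>#}"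
  define S' where "S' = replicate_mset i (False, r1) + replicate_mset j (False, r2) + {#(True, r3)#}"
  have f: "refls S' = {#(True, r3)#}" "rots S' = replicate_mset i (False, r1) + replicate_mset j (False, r2)"
    unfolding S'_def by (simp_all add: filter_mset_replicate)
  have "two_valued n i j r1 r2 (image_mset snd (rots S'))"
    unfolding f two_valued_def using r(1) by (simp add: coprime_iff_gcd_eq_1)
  then have "extremal_form n i j S'" unfolding extremal_form_def using f(1) by auto
  moreover have "S = image_mset phi S'" unfolding r(2) S'_def by (simp add: phi_rotation phi_reflection)
  ultimately show ?thesis by blast
qed

lemma extremal_descend:
  assumes ex: "extremal_form n i j S" and reps: "\<And>x. x \<in># S \<Longrightarrow> 0 \<le> snd x \<and> snd x < int n"
  shows "rotation_form i j (image_mset phi S)"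
proof -
  define R where "R = rots S"
  obtain a b where q: "size (refls S) = 1" and tv: "two_valued n i j a b (image_mset snd R)"
    using ex by (auto simp: extremal_form_def R_def)
  obtain y where y: "refls S = {#y#}" using q size_1_singleton_mset by blast
  then have "y \<in># refls S" by simp
  then have yS: "y \<in># S" "fst y" by simp_all
  have id: "residues n (image_mset snd R) = image_mset snd R"
    unfolding multiset.map_comp comp_def by (rule image_mset_cong) (use reps in \<open>auto simp: R_def\<close>)
  then have sndR: "image_mset snd R = replicate_mset i (a mod int n) + replicate_mset j (b mod int n)"
    using tv by (simp add: two_valued_def)
  have "image_mset phi R = image_mset (\<lambda>x. \<alpha> [^] x) (image_mset snd R)"
    unfolding multiset.map_comp comp_def by (rule image_mset_cong) (simp add: R_def phi_def)
  then have phiR: "image_mset phi R = replicate_mset i (\<alpha> [^] (a mod int n)) + replicate_mset j (\<alpha> [^] (b mod int n))"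
    unfolding sndR by simp
  have "S = R + {#y#}" unfolding R_def y[symmetric] by (metis multiset_partition union_commute)
  then have "image_mset phi S = image_mset phi R + {#phi y#}" by simp
  also have "phi y = \<alpha> [^] snd y \<otimes> \<tau>" using yS(2) by (simp add: phi_def)
  finally have "image_mset phi S = replicate_mset i (\<alpha> [^] (a mod int n)) + replicate_mset j (\<alpha> [^] (b mod int n)) + {#\<alpha> [^] snd y \<otimes> \<tau>#}"
    unfolding phiR .
  moreover have "gcd (a mod int n - b mod int n) (int n) = 1"
  proof -
    have "[a - b = a mod int n - b mod int n] (mod int n)" by (intro cong_diff) auto
    moreover have "coprime (a - b) (int n)" using tv by (simp add: two_valued_def)
    ultimately show ?thesis using cong_imp_coprime by (simp add: coprime_iff_gcd_eq_1[symmetric]) blast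
  qed
  moreover have "a mod int n \<in> {0..int n - 1}" "b mod int n \<in> {0..int n - 1}" using n3 by auto
  moreover have "snd y \<in> {0..int n - 1}" using reps[OF yS(1)] by simp
  ultimately show ?thesis unfolding extremal_sequence_def
    by (intro bexI[of _ "a mod int n"] bexI[of _ "b mod int n"] bexI[of _ "snd y"] conjI)
qed

lemma residues_3: "mset_set {0..<3::int} = {#0, 1, 2#}"
proof -
  have "{0..<3::int} = {0, 1, 2}" by auto
  then show ?thesis by simp
qed

lemma exceptional_lift:
  assumes "three_reflections G \<alpha> \<tau> S"
  obtains S' where "S = image_mset phi S'" "exceptional_form S'" "size S = 8"
proof -
  define S' where "S' = replicate_mset 5 (False, 0) + {#(True, 0), (True, 1), (True, 2 :: int)#}"
  have f: "refls S' = {#(True, 0), (True, 1), (True, 2)#}" "rots S' = replicate_mset 5 (False, 0)"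
    unfolding S'_def by (simp_all add: filter_mset_replicate)
  have "\<forall>x\<in>#S'. \<not> fst x \<longrightarrow> 3 dvd snd x" unfolding S'_def by auto
  then have "exceptional_form S'" unfolding exceptional_form_def f residues_3 by simp
  moreover have "S = image_mset phi S'" using assms unfolding three_reflections_def S'_def
    by (simp add: phi_def int_pow_1)
  moreover have "size S = 8" using assms by (simp add: three_reflections_def)
  ultimately show ?thesis using that by blast
qed

lemma exceptional_descend:
  assumes n: "n = 3" and ex: "exceptional_form S" and reps: "\<And>x. x \<in># S \<Longrightarrow> 0 \<le> snd x \<and> snd x < int n"
  shows "three_reflections G \<alpha> \<tau> (image_mset phi S)"
proof -
  define R Q where "R = rots S" and "Q = refls S"
  have S: "S = R + Q" unfolding R_def Q_def by (metis multiset_partition union_commute)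
  have "image_mset phi R = image_mset (\<lambda>_. \<one>) R"
  proof (rule image_mset_cong)
    fix x assume "x \<in># R"
    then have "x \<in># S" "\<not> fst x" by (auto simp: R_def)
    then show "phi x = \<one>" using ex n unfolding phi_eq_one_iff by (auto simp: exceptional_form_def)
  qed
  also have "\<dots> = replicate_mset 5 \<one>" using ex by (simp add: image_mset_const_eq exceptional_form_def R_def)
  finally have R: "image_mset phi R = replicate_mset 5 \<one>" .
  have "image_mset phi Q = image_mset (\<lambda>x. \<alpha> [^] x \<otimes> \<tau>) (image_mset (\<lambda>x. snd x mod 3) Q)"
    unfolding multiset.map_comp comp_def
  proof (rule image_mset_cong)
    fix x assume "x \<in># Q"
    then have "x \<in># S" "fst x" by (auto simp: Q_def)
    then show "phi x = \<alpha> [^] (snd x mod 3) \<otimes> \<tau>" using reps[of x] n by (simp add: phi_def)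
  qed
  also have "image_mset (\<lambda>x. snd x mod 3) Q = {#0, 1, 2#}" using ex by (simp add: exceptional_form_def Q_def residues_3)
  finally show ?thesis unfolding three_reflections_def S using R by (simp add: int_pow_1)
qed

lemma no_product_one_extremal:
  assumes "rotation_form i j S" "\<And>S'. extremal_form n i j S' \<Longrightarrow> \<not> pone n k S'"
  shows "\<not> has_product_one_subsequence G k S"
proof -
  obtain S' where "S = image_mset phi S'" "extremal_form n i j S'" using extremal_lift[OF assms(1)] by blast
  then show ?thesis using assms(2) by (simp add: has_product_one_phi)
qed

text \<open>The exponents 0 and 1 have difference -1, which is prime to every n. This is the witness
  for the lower bounds of both constants.\<close>

lemma ex_rotation_form: "\<exists>S. set_mset S \<subseteq> carrier G \<and> size S = i + j + 1 \<and> rotation_form i j S"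
proof (intro exI conjI)
  let ?S = "replicate_mset i (\<alpha> [^] (0::int)) + replicate_mset j (\<alpha> [^] (1::int)) + {#\<alpha> [^] (0::int) \<otimes> \<tau>#}"
  show "set_mset ?S \<subseteq> carrier G" by (auto split: if_splits)
  show "size ?S = i + j + 1" by simp
  show "rotation_form i j ?S" unfolding extremal_sequence_def
    by (intro bexI[of _ 0] bexI[of _ 1] conjI refl) (use n3 in auto)
qed

lemma s_constant_G: assumes "even n" shows "s_constant G = 2 * n"
  unfolding s_constant_def exponent_G[OF assms]
proof (rule Least_equality)
  obtain m where m: "n = 2 * m" "m \<ge> 2" using assms n3 by (auto elim!: evenE)
  show "\<forall>S. set_mset S \<subseteq> carrier G \<and> 2 * n \<le> size S \<longrightarrow> has_product_one_subsequence G n S"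
  proof (intro allI impI)
    fix S assume S: "set_mset S \<subseteq> carrier G \<and> 2 * n \<le> size S"
    then obtain S' where "S = image_mset phi S'" using lift by blast
    then show "has_product_one_subsequence G n S" using S direct_single[OF m(2,1), of S'] by (simp add: has_product_one_phi)
  qed
  fix l assume l: "\<forall>S. set_mset S \<subseteq> carrier G \<and> l \<le> size S \<longrightarrow> has_product_one_subsequence G n S"
  obtain S where S: "set_mset S \<subseteq> carrier G" "size S = (n - 1) + (n - 1) + 1" "rotation_form (n - 1) (n - 1) S"
    using ex_rotation_form by blast
  have "\<not> has_product_one_subsequence G n S"
    by (rule no_product_one_extremal[OF S(3)]) (use extremal_single n3 in simp)
  then have "\<not> l \<le> size S" using l S(1) by blast
  then show "2 * n \<le> l" using S(2) n3 by linarith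
qed

lemma E_constant_G: "E_constant G = 3 * n"
  unfolding E_constant_def order_G
proof (rule Least_equality)
  show "\<forall>S. set_mset S \<subseteq> carrier G \<and> 3 * n \<le> size S \<longrightarrow> has_product_one_subsequence G (2 * n) S"
  proof (intro allI impI)
    fix S assume S: "set_mset S \<subseteq> carrier G \<and> 3 * n \<le> size S"
    then obtain S' where "S = image_mset phi S'" using lift by blast
    then show "has_product_one_subsequence G (2 * n) S" using S direct_double[OF n3, of S'] by (simp add: has_product_one_phi)
  qed
  fix l assume l: "\<forall>S. set_mset S \<subseteq> carrier G \<and> l \<le> size S \<longrightarrow> has_product_one_subsequence G (2 * n) S"
  obtain S where S: "set_mset S \<subseteq> carrier G" "size S = (2 * n - 1) + (n - 1) + 1" "rotation_form (2 * n - 1) (n - 1) S"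
    using ex_rotation_form by blast
  have "\<not> has_product_one_subsequence G (2 * n) S"
    by (rule no_product_one_extremal[OF S(3)]) (use extremal_double n3 in simp)
  then have "\<not> l \<le> size S" using l S(1) by blast
  then show "3 * n \<le> l" using S(2) n3 by linarith
qed

lemma single_forward:
  assumes "even n" "set_mset S \<subseteq> carrier G" "size S = 2 * n - 1" "\<not> has_product_one_subsequence G n S"
  shows "rotation_form (n - 1) (n - 1) S"
proof -
  obtain m where m: "n = 2 * m" "m \<ge> 2" using assms(1) n3 by (auto elim!: evenE)
  obtain S' where S': "S = image_mset phi S'" "\<And>x. x \<in># S' \<Longrightarrow> 0 \<le> snd x \<and> snd x < int n" using lift[OF assms(2)] by blast
  then have "extremal_form n (n - 1) (n - 1) S'"
    using inverse_single[OF m(2,1), of S'] assms(3,4) by (simp add: has_product_one_phi)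
  then show ?thesis unfolding S'(1) using S'(2) by (rule extremal_descend)
qed

lemma single_backward:
  assumes "even n" "rotation_form (n - 1) (n - 1) S"
  shows "size S = 2 * n - 1" "\<not> has_product_one_subsequence G n S"
proof -
  have "size S = (n - 1) + (n - 1) + 1" using rotation_form_size[OF assms(2)] .
  then show "size S = 2 * n - 1" using n3 by linarith
  show "\<not> has_product_one_subsequence G n S"
    by (rule no_product_one_extremal[OF assms(2)]) (use extremal_single n3 in simp)
qed

lemma double_forward:
  assumes "set_mset S \<subseteq> carrier G" "size S = 3 * n - 1" "\<not> has_product_one_subsequence G (2 * n) S"
  shows "rotation_form (2 * n - 1) (n - 1) S \<or> n = 3 \<and> three_reflections G \<alpha> \<tau> S"
proof -
  obtain S' where S': "S = image_mset phi S'" "\<And>x. x \<in># S' \<Longrightarrow> 0 \<le> snd x \<and> snd x < int n" using lift[OF assms(1)] by blast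
  then have "extremal_form n (2 * n - 1) (n - 1) S' \<or> n = 3 \<and> exceptional_form S'"
    using inverse_double[OF n3, of S'] assms(2,3) by (simp add: has_product_one_phi)
  then show ?thesis unfolding S'(1) using extremal_descend exceptional_descend S'(2) by blast
qed

lemma double_backward:
  assumes "rotation_form (2 * n - 1) (n - 1) S \<or> n = 3 \<and> three_reflections G \<alpha> \<tau> S"
  shows "size S = 3 * n - 1" "\<not> has_product_one_subsequence G (2 * n) S"
proof -
  have "size S = 3 * n - 1 \<and> \<not> has_product_one_subsequence G (2 * n) S"
    using assms
  proof
    assume f: "rotation_form (2 * n - 1) (n - 1) S"
    have "size S = (2 * n - 1) + (n - 1) + 1" using rotation_form_size[OF f] .
    then have "size S = 3 * n - 1" using n3 by linarith
    moreover have "\<not> has_product_one_subsequence G (2 * n) S"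
      by (rule no_product_one_extremal[OF f]) (use extremal_double n3 in simp)
    ultimately show ?thesis by blast
  next
    assume f: "n = 3 \<and> three_reflections G \<alpha> \<tau> S"
    obtain S' where "S = image_mset phi S'" "exceptional_form S'" "size S = 8" using f exceptional_lift by blast
    then show ?thesis using f exceptional_no_pone by (simp add: has_product_one_phi)
  qed
  then show "size S = 3 * n - 1" "\<not> has_product_one_subsequence G (2 * n) S" by blast+
qed

end

theorem theorem1p2:
  fixes G :: "('a, 'b) monoid_scheme" (structure)
    and n :: nat
    and S :: "'a multiset"
  assumes "n \<ge> 3"
    and "dihedral_group G n"
    and "set_mset S \<subseteq> carrier G"
  shows
    "(n \<ge> 4 \<and> even n \<longrightarrow>
        group_exponent G = n \<and>
        ((int (size S) = int (s_constant G) - 1 \<and>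
            \<not> has_product_one_subsequence G (group_exponent G) S)
         \<longleftrightarrow>
         (\<exists>\<alpha>\<in>carrier G. \<exists>\<tau>\<in>carrier G. dihedral_presentation G n \<alpha> \<tau> \<and>
            (\<exists>r1\<in>{0..int n - 1}. \<exists>r2\<in>{0..int n - 1}. \<exists>r3\<in>{0..int n - 1}.
               gcd (r1 - r2) (int n) = 1 \<and>
               S = replicate_mset (n - 1) (\<alpha> [^] r1) + replicate_mset (n - 1) (\<alpha> [^] r2)
                   + {#\<alpha> [^] r3 \<otimes> \<tau>#}))))
     \<and>
     ((int (size S) = int (E_constant G) - 1 \<and>
         \<not> has_product_one_subsequence G (order G) S)
      \<longleftrightarrow>
      (\<exists>\<alpha>\<in>carrier G. \<exists>\<tau>\<in>carrier G. dihedral_presentation G n \<alpha> \<tau> \<and>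
         ((n \<ge> 4 \<and>
             (\<exists>r1\<in>{0..int n - 1}. \<exists>r2\<in>{0..int n - 1}. \<exists>r3\<in>{0..int n - 1}.
                gcd (r1 - r2) (int n) = 1 \<and>
                S = replicate_mset (2 * n - 1) (\<alpha> [^] r1) + replicate_mset (n - 1) (\<alpha> [^] r2)
                    + {#\<alpha> [^] r3 \<otimes> \<tau>#}))
          \<or>
          (n = 3 \<and>
             (S = replicate_mset 5 \<one> + {#\<tau>#} + {#\<alpha> \<otimes> \<tau>#} + {#\<alpha> [^] (2::int) \<otimes> \<tau>#}
              \<or>
              (\<exists>t1\<in>{0..2::int}. \<exists>t2\<in>{0..2::int}. \<exists>t3\<in>{0..2::int}.
                 gcd (t1 - t2) 3 = 1 \<and>
                 S = replicate_mset 5 (\<alpha> [^] t1) + replicate_mset 2 (\<alpha> [^] t2)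
                     + {#\<alpha> [^] t3 \<otimes> \<tau>#}))))))"
proof -
  obtain a t where at: "a \<in> carrier G" "t \<in> carrier G" "dihedral_presentation G n a t"
    using assms(2) unfolding dihedral_group_def by blast
  \<comment> \<open>The generators in (b) need not be the ones fixed here, so the backward
    directions instantiate the locale afresh; exponent, order and both constants depend on
    \<open>G\<close> alone.\<close>
  have loc: "dihedral G n \<alpha> \<tau>" if "dihedral_presentation G n \<alpha> \<tau>" for \<alpha> \<tau>
    using that assms(1) by unfold_locales
  interpret D: dihedral G n a t using loc[OF at(3)] .
  have part1: "n \<ge> 4 \<and> even n \<longrightarrow> group_exponent G = n \<and>
     ((int (size S) = int (s_constant G) - 1 \<and> \<not> has_product_one_subsequence G (group_exponent G) S)
      \<longleftrightarrow> (\<exists>\<alpha>\<in>carrier G. \<exists>\<tau>\<in>carrier G. dihedral_presentation G n \<alpha> \<tau> \<and>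
            extremal_sequence G n \<alpha> \<tau> (n - 1) (n - 1) S))"
  proof (intro impI conjI)
    assume n: "n \<ge> 4 \<and> even n"
    show exp: "group_exponent G = n" using D.exponent_G n by blast
    show "(int (size S) = int (s_constant G) - 1 \<and> \<not> has_product_one_subsequence G (group_exponent G) S)
      \<longleftrightarrow> (\<exists>\<alpha>\<in>carrier G. \<exists>\<tau>\<in>carrier G. dihedral_presentation G n \<alpha> \<tau> \<and>
            extremal_sequence G n \<alpha> \<tau> (n - 1) (n - 1) S)" (is "?l \<longleftrightarrow> ?r")
    proof
      assume l: ?l
      have "size S = 2 * n - 1" using l D.s_constant_G n by auto
      moreover have "\<not> has_product_one_subsequence G n S" using l exp by simp
      ultimately have "extremal_sequence G n a t (n - 1) (n - 1) S"
        using D.single_forward[OF _ assms(3)] n by blast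
      then show ?r using at by blast
    next
      assume ?r
      then obtain \<alpha> \<tau> where p: "dihedral_presentation G n \<alpha> \<tau>" "extremal_sequence G n \<alpha> \<tau> (n - 1) (n - 1) S" by blast
      have "even n" using n by blast
      note b = dihedral.single_backward[OF loc[OF p(1)] this p(2)]
      have "int (size S) = int (s_constant G) - 1" using b(1) D.s_constant_G[OF \<open>even n\<close>] assms(1) by simp
      then show ?l using b(2) exp by simp
    qed
  qed
  have part2: "(int (size S) = int (E_constant G) - 1 \<and> \<not> has_product_one_subsequence G (order G) S)
      \<longleftrightarrow> (\<exists>\<alpha>\<in>carrier G. \<exists>\<tau>\<in>carrier G. dihedral_presentation G n \<alpha> \<tau> \<and>
            (extremal_sequence G n \<alpha> \<tau> (2 * n - 1) (n - 1) S \<or> n = 3 \<and> three_reflections G \<alpha> \<tau> S))"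
    (is "?l \<longleftrightarrow> ?r")
  proof
    assume l: ?l
    have "size S = 3 * n - 1" using l D.E_constant_G assms(1) by auto
    moreover have "\<not> has_product_one_subsequence G (2 * n) S" using l D.order_G by simp
    ultimately have "extremal_sequence G n a t (2 * n - 1) (n - 1) S \<or> n = 3 \<and> three_reflections G a t S"
      by (rule D.double_forward[OF assms(3)])
    then show ?r using at by blast
  next
    assume ?r
    then obtain \<alpha> \<tau> where p: "dihedral_presentation G n \<alpha> \<tau>"
      "extremal_sequence G n \<alpha> \<tau> (2 * n - 1) (n - 1) S \<or> n = 3 \<and> three_reflections G \<alpha> \<tau> S" by blast
    note b = dihedral.double_backward[OF loc[OF p(1)] p(2)]
    have "int (size S) = int (E_constant G) - 1" using b(1) assms(1) D.E_constant_G by simp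
    then show ?l using b(2) D.order_G by simp
  qed
  \<comment> \<open>For n = 3 the general family reappears as the second option of (ii), since 2n-1
    = 5 and n-1 = 2.\<close>
  have form: "extremal_sequence G n \<alpha> \<tau> (2 * n - 1) (n - 1) S \<or> n = 3 \<and> three_reflections G \<alpha> \<tau> S
      \<longleftrightarrow> n \<ge> 4 \<and> extremal_sequence G n \<alpha> \<tau> (2 * n - 1) (n - 1) S
        \<or> n = 3 \<and> (three_reflections G \<alpha> \<tau> S
          \<or> (\<exists>t1\<in>{0..2::int}. \<exists>t2\<in>{0..2::int}. \<exists>t3\<in>{0..2::int}.
                 gcd (t1 - t2) 3 = 1 \<and>
                 S = replicate_mset 5 (\<alpha> [^] t1) + replicate_mset 2 (\<alpha> [^] t2)
                     + {#\<alpha> [^] t3 \<otimes> \<tau>#}))" for \<alpha> \<tau>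
  proof (cases "n = 3")
    case True
    then have "int n - 1 = 2" "int n = 3" "2 * n - 1 = 5" "n - 1 = 2" by simp_all
    then have "extremal_sequence G n \<alpha> \<tau> (2 * n - 1) (n - 1) S \<longleftrightarrow> (\<exists>t1\<in>{0..2::int}. \<exists>t2\<in>{0..2::int}. \<exists>t3\<in>{0..2::int}.
                 gcd (t1 - t2) 3 = 1 \<and>
                 S = replicate_mset 5 (\<alpha> [^] t1) + replicate_mset 2 (\<alpha> [^] t2)
                     + {#\<alpha> [^] t3 \<otimes> \<tau>#})" unfolding extremal_sequence_def by (simp only:)
    then show ?thesis using True by blast
  next
    case False
    then show ?thesis using assms(1) by auto
  qed
  show ?thesis
    using part1 part2 unfolding form unfolding extremal_sequence_def three_reflections_def by (rule conjI)
qed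

end
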